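(* Let $(X,\mu,m)$ be a connected weighted graph which is stochastically complete. Then every non-negative superharmonic function in $L^1(X,m)$ is constant.
   Context: Weighted graph: $X$ is a countable discrete set, $m:X\to(0,\infty)$ is extended additively to a measure on all subsets of $X$, and $\mu:X\times X\to[0,\infty)$, $(x,y)\mapsto\mu_{xy}$, is symmetric, zero on the diagonal, and satisfies $\sum_{y\in X}\mu_{xy}<\infty$ for all $x\in X$ (local finiteness is not assumed). Write $x\sim y$ if $\mu_{xy}>0$. The graph is connected if any two vertices $x,y$ are joined by a path $x=x_0\sim x_1\sim\dots\sim x_n=y$. Superharmonic: let $F(X)=\{f:X\to\mathbb{R}\mid \sum_{y\in X}\mu_{xy}|f(y)|<\infty \text{ for all }x\in X\}$ and $\Delta f(x)=\frac1{m(x)}\sum_{y\in X}\mu_{xy}(f(x)-f(y))$ for $f\in F(X)$. A function $f:X\to\mathbb{R}$ is superharmonic if $f\in F(X)$ and $\Delta f\ge0$ pointwise. Stochastic completeness: let $E(f)=\frac12\sum_{x,y\in X}\mu_{xy}|f(x)-f(y)|^2$, let $Q$ be the closure in $L^2(X,m)$ of the restriction of $E$ to the finitely supported functions $C_c(X)$, and let $L\ge0$ be the positive selfadjoint operator on $L^2(X,m)$ associated with $Q$. Since $Q$ is a Dirichlet form, the semigroup $e^{-tL}$, $t\ge0$, extends to $L^\infty(X)$ (for non-negative bounded functions, by monotone limits of functions in $L^2(X,m)$). The graph is stochastically complete if $e^{-tL}1=1$ for all $t\ge 0$, where $1$ is the function constantly equal to one. *)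

theory Defs
  imports "HOL-Analysis.Analysis"
begin

section \<open>Weighted graphs\<close>

text \<open>
  The countable discrete vertex set is a type of class \<open>countable\<close>. All function spaces are real.
  For real families, \<open>summable_on\<close> is absolute summability.
\<close>

definition weighted_graph :: "('v::countable \<Rightarrow> real) \<Rightarrow> ('v \<Rightarrow> 'v \<Rightarrow> real) \<Rightarrow> bool" where
  "weighted_graph m \<mu> \<longleftrightarrow>
     (\<forall>x. m x > 0) \<and>
     (\<forall>x y. \<mu> x y \<ge> 0) \<and>
     (\<forall>x y. \<mu> x y = \<mu> y x) \<and>
     (\<forall>x. \<mu> x x = 0) \<and>
     (\<forall>x. (\<lambda>y. \<mu> x y) summable_on UNIV)"

definition adjacent :: "('v \<Rightarrow> 'v \<Rightarrow> real) \<Rightarrow> 'v \<Rightarrow> 'v \<Rightarrow> bool" where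
  "adjacent \<mu> x y \<longleftrightarrow> \<mu> x y > 0"

definition connected_graph :: "('v \<Rightarrow> 'v \<Rightarrow> real) \<Rightarrow> bool" where
  "connected_graph \<mu> \<longleftrightarrow> (\<forall>x y. (adjacent \<mu>)\<^sup>*\<^sup>* x y)"

definition formal_domain :: "('v \<Rightarrow> 'v \<Rightarrow> real) \<Rightarrow> ('v \<Rightarrow> real) set" where
  "formal_domain \<mu> = {f. \<forall>x. (\<lambda>y. \<mu> x y * \<bar>f y\<bar>) summable_on UNIV}"

definition laplacian :: "('v \<Rightarrow> real) \<Rightarrow> ('v \<Rightarrow> 'v \<Rightarrow> real) \<Rightarrow> ('v \<Rightarrow> real) \<Rightarrow> 'v \<Rightarrow> real" where
  "laplacian m \<mu> f x = 1 / m x * (\<Sum>\<^sub>\<infinity>y\<in>UNIV. \<mu> x y * (f x - f y))"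

definition superharmonic :: "('v \<Rightarrow> real) \<Rightarrow> ('v \<Rightarrow> 'v \<Rightarrow> real) \<Rightarrow> ('v \<Rightarrow> real) \<Rightarrow> bool" where
  "superharmonic m \<mu> f \<longleftrightarrow> f \<in> formal_domain \<mu> \<and> (\<forall>x. laplacian m \<mu> f x \<ge> 0)"


section \<open>Lebesgue spaces\<close>

text \<open>
  The measure is purely atomic with mass \<open>m x\<close> at \<open>x\<close>, so integrals are weighted sums; as \<open>m > 0\<close>
  there are no nontrivial null sets and classes of functions are functions.
\<close>

definition L1 :: "('v \<Rightarrow> real) \<Rightarrow> ('v \<Rightarrow> real) set" where
  "L1 m = {f. (\<lambda>x. m x * \<bar>f x\<bar>) summable_on UNIV}"

definition L2 :: "('v \<Rightarrow> real) \<Rightarrow> ('v \<Rightarrow> real) set" where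
  "L2 m = {f. (\<lambda>x. m x * (f x)\<^sup>2) summable_on UNIV}"

definition L2_inner :: "('v \<Rightarrow> real) \<Rightarrow> ('v \<Rightarrow> real) \<Rightarrow> ('v \<Rightarrow> real) \<Rightarrow> real" where
  "L2_inner m f g = (\<Sum>\<^sub>\<infinity>x\<in>UNIV. m x * f x * g x)"

definition L2_norm :: "('v \<Rightarrow> real) \<Rightarrow> ('v \<Rightarrow> real) \<Rightarrow> real" where
  "L2_norm m f = sqrt (L2_inner m f f)"


section \<open>The form \<open>Q\<close> and its operator \<open>L\<close>\<close>

definition finitely_supported :: "('v \<Rightarrow> real) set" where
  "finitely_supported = {f. finite {x. f x \<noteq> 0}}"

text \<open>Only used on finitely supported functions, where the double series converges.\<close>

definition energy :: "('v \<Rightarrow> 'v \<Rightarrow> real) \<Rightarrow> ('v \<Rightarrow> real) \<Rightarrow> real" where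
  "energy \<mu> f = 1 / 2 * (\<Sum>\<^sub>\<infinity>(x, y)\<in>UNIV. \<mu> x y * \<bar>f x - f y\<bar>\<^sup>2)"

text \<open>
  The closure of a closable form consists of the \<open>L\<^sup>2\<close>-limits of sequences from the original domain
  that are Cauchy with respect to the form; its value is the limit of the values of the form, which
  by closability does not depend on the approximating sequence.
\<close>

definition form_approximates ::
  "('v \<Rightarrow> real) \<Rightarrow> ('v \<Rightarrow> 'v \<Rightarrow> real) \<Rightarrow> (nat \<Rightarrow> 'v \<Rightarrow> real) \<Rightarrow> ('v \<Rightarrow> real) \<Rightarrow> bool" where
  "form_approximates m \<mu> \<phi> f \<longleftrightarrow>
     (\<forall>n. \<phi> n \<in> finitely_supported) \<and>
     (\<lambda>n. L2_norm m (\<lambda>x. \<phi> n x - f x)) \<longlonglongrightarrow> 0 \<and>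
     (\<forall>e>0. \<exists>N. \<forall>k\<ge>N. \<forall>l\<ge>N. energy \<mu> (\<lambda>x. \<phi> k x - \<phi> l x) < e)"

definition form_domain :: "('v \<Rightarrow> real) \<Rightarrow> ('v \<Rightarrow> 'v \<Rightarrow> real) \<Rightarrow> ('v \<Rightarrow> real) set" where
  "form_domain m \<mu> = {f \<in> L2 m. \<exists>\<phi>. form_approximates m \<mu> \<phi> f}"

definition closed_form :: "('v \<Rightarrow> real) \<Rightarrow> ('v \<Rightarrow> 'v \<Rightarrow> real) \<Rightarrow> ('v \<Rightarrow> real) \<Rightarrow> real" where
  "closed_form m \<mu> f =
     (THE q. \<exists>\<phi>. form_approximates m \<mu> \<phi> f \<and> (\<lambda>n. energy \<mu> (\<phi> n)) \<longlonglongrightarrow> q)"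

definition closed_form_bilinear ::
  "('v \<Rightarrow> real) \<Rightarrow> ('v \<Rightarrow> 'v \<Rightarrow> real) \<Rightarrow> ('v \<Rightarrow> real) \<Rightarrow> ('v \<Rightarrow> real) \<Rightarrow> real" where
  "closed_form_bilinear m \<mu> f g =
     (closed_form m \<mu> (\<lambda>x. f x + g x) - closed_form m \<mu> (\<lambda>x. f x - g x)) / 4"

text \<open>
  The operator associated with \<open>Q\<close>, given by its graph: \<open>form_operator m \<mu> f g\<close> means that \<open>f\<close>
  belongs to the domain of \<open>L\<close> and \<open>L f = g\<close>.
\<close>

definition form_operator ::
  "('v \<Rightarrow> real) \<Rightarrow> ('v \<Rightarrow> 'v \<Rightarrow> real) \<Rightarrow> ('v \<Rightarrow> real) \<Rightarrow> ('v \<Rightarrow> real) \<Rightarrow> bool" where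
  "form_operator m \<mu> f g \<longleftrightarrow>
     f \<in> form_domain m \<mu> \<and> g \<in> L2 m \<and>
     (\<forall>h\<in>form_domain m \<mu>. closed_form_bilinear m \<mu> f h = L2_inner m g h)"


section \<open>The semigroup \<open>e\<^bsup>-tL\<^esup>\<close> and stochastic completeness\<close>

definition L2_bounded_operator :: "('v \<Rightarrow> real) \<Rightarrow> (('v \<Rightarrow> real) \<Rightarrow> ('v \<Rightarrow> real)) \<Rightarrow> bool" where
  "L2_bounded_operator m T \<longleftrightarrow>
     (\<forall>f\<in>L2 m. T f \<in> L2 m) \<and>
     (\<forall>f\<in>L2 m. \<forall>g\<in>L2 m. T (\<lambda>x. f x + g x) = (\<lambda>x. T f x + T g x)) \<and>
     (\<forall>c. \<forall>f\<in>L2 m. T (\<lambda>x. c * f x) = (\<lambda>x. c * T f x)) \<and>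
     (\<exists>C. \<forall>f\<in>L2 m. L2_norm m (T f) \<le> C * L2_norm m f)"

definition C0_semigroup ::
  "('v \<Rightarrow> real) \<Rightarrow> (real \<Rightarrow> ('v \<Rightarrow> real) \<Rightarrow> ('v \<Rightarrow> real)) \<Rightarrow> bool" where
  "C0_semigroup m P \<longleftrightarrow>
     (\<forall>t\<ge>0. L2_bounded_operator m (P t)) \<and>
     (\<forall>f\<in>L2 m. P 0 f = f) \<and>
     (\<forall>s\<ge>0. \<forall>t\<ge>0. \<forall>f\<in>L2 m. P (s + t) f = P s (P t f)) \<and>
     (\<forall>f\<in>L2 m. ((\<lambda>t. L2_norm m (\<lambda>x. P t f x - f x)) \<longlongrightarrow> 0) (at_right 0))"

definition generator ::
  "('v \<Rightarrow> real) \<Rightarrow> (real \<Rightarrow> ('v \<Rightarrow> real) \<Rightarrow> ('v \<Rightarrow> real)) \<Rightarrow> ('v \<Rightarrow> real) \<Rightarrow> ('v \<Rightarrow> real) \<Rightarrow> bool" where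
  "generator m P f g \<longleftrightarrow>
     f \<in> L2 m \<and> g \<in> L2 m \<and>
     ((\<lambda>t. L2_norm m (\<lambda>x. (P t f x - f x) / t - g x)) \<longlongrightarrow> 0) (at_right 0)"

text \<open>
  \<open>P t = e\<^bsup>-tL\<^esup>\<close>: the strongly continuous semigroup on \<open>L\<^sup>2\<close> whose generator is exactly \<open>-L\<close>,
  domains included. As \<open>L\<close> is selfadjoint and non-negative, it exists and is unique on \<open>L\<^sup>2\<close> for
  \<open>t \<ge> 0\<close>; the values of \<open>P\<close> elsewhere are irrelevant.
\<close>

definition heat_semigroup ::
  "('v \<Rightarrow> real) \<Rightarrow> ('v \<Rightarrow> 'v \<Rightarrow> real) \<Rightarrow> (real \<Rightarrow> ('v \<Rightarrow> real) \<Rightarrow> ('v \<Rightarrow> real)) \<Rightarrow> bool" where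
  "heat_semigroup m \<mu> P \<longleftrightarrow>
     C0_semigroup m P \<and>
     (\<forall>f g. generator m P f g \<longleftrightarrow> form_operator m \<mu> f (\<lambda>x. - g x))"

text \<open>
  Extension of a positivity preserving operator on \<open>L\<^sup>2\<close> to a non-negative bounded function \<open>f\<close>, by
  monotone limits; for the semigroup the limit does not depend on the sequence.
\<close>

definition monotone_extension ::
  "('v \<Rightarrow> real) \<Rightarrow> (('v \<Rightarrow> real) \<Rightarrow> ('v \<Rightarrow> real)) \<Rightarrow> ('v \<Rightarrow> real) \<Rightarrow> 'v \<Rightarrow> real" where
  "monotone_extension m T f x =
     (THE a. \<exists>\<phi>. (\<forall>n. \<phi> n \<in> L2 m) \<and>
                 (\<forall>n y. 0 \<le> \<phi> n y \<and> \<phi> n y \<le> \<phi> (Suc n) y) \<and>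
                 (\<forall>y. (\<lambda>n. \<phi> n y) \<longlonglongrightarrow> f y) \<and>
                 (\<lambda>n. T (\<phi> n) x) \<longlonglongrightarrow> a)"

definition stochastically_complete :: "('v \<Rightarrow> real) \<Rightarrow> ('v \<Rightarrow> 'v \<Rightarrow> real) \<Rightarrow> bool" where
  "stochastically_complete m \<mu> \<longleftrightarrow>
     (\<exists>P. heat_semigroup m \<mu> P \<and>
          (\<forall>t\<ge>0. monotone_extension m (P t) (\<lambda>x. 1) = (\<lambda>x. 1)))"

end

theory Submission
  imports Defs
begin

text \<open>
  Fix a superharmonic function \<open>u \<ge> 0\<close> in \<open>L\<^sup>1\<close>. Truncation keeps superharmonicity, so it suffices to
  show that every non-negative integrable superharmonic \<open>v\<close> is harmonic: for \<open>v = min u (u x)\<close>, which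
  has its maximum at \<open>x\<close>, harmonicity at \<open>x\<close> forces \<open>v = u x\<close> at all neighbours of \<open>x\<close>, that is
  \<open>u \<ge> u x\<close> there. Along paths \<open>u\<close> cannot decrease, in either direction, and connectedness makes it constant
  (\<open>superharmonic_L1_le_neighbour\<close>).

  Harmonicity of \<open>v\<close> comes from testing against finitely supported functions \<open>h\<^sub>k\<close> with
  \<open>0 \<le> h\<^sub>k \<le> 1\<close>, \<open>\<Delta> h\<^sub>k \<le> 1 - h\<^sub>k\<close> and \<open>h\<^sub>k \<rightarrow> 1\<close>. Green's formula is unproblematic for finite supports and gives
  \<open>0 \<le> \<Sum> m h\<^sub>k \<Delta>v = \<Sum> m v \<Delta>h\<^sub>k \<le> \<Sum> m v (1 - h\<^sub>k)\<close>, and the right-hand side tends to \<open>0\<close> by dominated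
  convergence since \<open>v\<close> is integrable (\<open>superharmonic_L1_imp_harmonic\<close>).

  The functions \<open>h\<^sub>k\<close> are produced by a monotone iteration (\<open>iterate\<close>) for the equation
  \<open>(\<Delta> + \<alpha>) f = \<alpha> \<phi>\<close>, here with \<open>\<alpha> = 1\<close> and \<open>\<phi> = 1\<close>. That their limit is \<open>1\<close> and not smaller is exactly what stochastic
  completeness provides. For \<open>\<phi> \<ge> 0\<close> in \<open>L\<^sup>2\<close> the same iteration converges in the form norm to
  \<open>\<alpha> (L + \<alpha>)\<^sup>-\<^sup>1 \<phi>\<close> (\<open>iterate_converges\<close>); thus the resolvent exists and is Markovian, and applied to
  indicators of finite sets it lies below the limit of the \<open>h\<^sub>k\<close>. On the other hand it is the Laplace transform of
  the semigroup (\<open>resolvent_integral\<close>), and the semigroup applied to those indicators increases to \<open>1\<close>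
  (\<open>iterate_one_tendsto\<close>).

  The last assertion is what stochastic completeness says once the monotone extension of the semigroup is
  known to be well defined (\<open>monotone_extension_one\<close>). For this the semigroup has to be Markovian, a property it inherits
  from the resolvent through Euler's formula \<open>P\<^sub>t = lim (\<alpha> (L + \<alpha>)\<^sup>-\<^sup>1)\<^sup>n\<close>, \<open>\<alpha> = n / t\<close> (\<open>Euler_formula\<close>). Since a
  strongly continuous semigroup is only assumed to be bounded for each single time, local uniform boundedness in time is first
  derived from the Banach--Steinhaus theorem (\<open>uniform_boundedness\<close>).
\<close>

section \<open>Weighted square-summable functions\<close>

lemma summable_on_abs_le:
  fixes f g :: "'a \<Rightarrow> real"
  assumes "g summable_on A" "\<And>x. x \<in> A \<Longrightarrow> \<bar>f x\<bar> \<le> g x"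
  shows "f summable_on A"
proof -
  have "(\<lambda>x. \<bar>f x\<bar>) summable_on A"
    by (rule summable_on_comparison_test[OF assms(1)]) (use assms(2) in auto)
  then show ?thesis
    by (metis (mono_tags, lifting) real_norm_def summable_on_cong summable_on_iff_abs_summable_on_real)
qed

lemma infsum_diff_real:
  fixes f g :: "'a \<Rightarrow> real"
  assumes "f summable_on A" "g summable_on A"
  shows "(\<Sum>\<^sub>\<infinity>x\<in>A. f x - g x) = infsum f A - infsum g A"
    and "(\<lambda>x. f x - g x) summable_on A"
proof -
  have "((\<lambda>x. f x + (-1) * g x) has_sum (infsum f A + (-1) * infsum g A)) A"
    by (intro has_sum_add has_sum_cmult_right has_sum_infsum assms)
  then have *: "((\<lambda>x. f x - g x) has_sum (infsum f A - infsum g A)) A"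
    by simp
  show "(\<Sum>\<^sub>\<infinity>x\<in>A. f x - g x) = infsum f A - infsum g A"
    by (rule infsumI[OF *])
  show "(\<lambda>x. f x - g x) summable_on A"
    using * by (auto simp: summable_on_def)
qed

text \<open>
  Dominated convergence: a finite set carries all but a small part of the majorant, uniformly in \<open>n\<close>.
\<close>

lemma infsum_dominated_null:
  fixes a :: "nat \<Rightarrow> 'a \<Rightarrow> real"
  assumes h: "h summable_on UNIV" and le: "\<And>n x. \<bar>a n x\<bar> \<le> h x"
    and lim: "\<And>x. (\<lambda>n. a n x) \<longlonglongrightarrow> 0"
  shows "(\<lambda>n. \<Sum>\<^sub>\<infinity>x\<in>UNIV. a n x) \<longlonglongrightarrow> 0"
proof (rule LIMSEQ_I)
  fix e :: real assume e: "e > 0"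
  have "(sum h \<longlongrightarrow> infsum h UNIV) (finite_subsets_at_top UNIV)"
    using has_sum_infsum[OF h] by (simp add: has_sum_def)
  then have "\<forall>\<^sub>F F in finite_subsets_at_top UNIV. dist (sum h F) (infsum h UNIV) < e / 2"
    using e by (intro tendstoD) auto
  then obtain F where F: "finite F" "dist (sum h F) (infsum h UNIV) < e / 2"
    by (auto simp: eventually_finite_subsets_at_top)
  have "(\<lambda>n. \<Sum>x\<in>F. \<bar>a n x\<bar>) \<longlonglongrightarrow> (\<Sum>x\<in>F. 0)"
    using lim by (intro tendsto_sum tendsto_rabs_zero)
  then obtain N where N: "\<And>n. n \<ge> N \<Longrightarrow> (\<Sum>x\<in>F. \<bar>a n x\<bar>) < e / 2"
    using LIMSEQ_D[of _ 0 "e / 2"] e by fastforce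
  have "norm ((\<Sum>\<^sub>\<infinity>x\<in>UNIV. a n x) - 0) < e" if n: "n \<ge> N" for n
  proof -
    have abs: "(\<lambda>x. \<bar>a n x\<bar>) summable_on A" for A
      by (rule summable_on_comparison_test[of h])
        (use le summable_on_subset_banach[OF h] in auto)
    have hF: "h summable_on - F"
      by (rule summable_on_subset_banach[OF h]) auto
    have "norm (\<Sum>\<^sub>\<infinity>x\<in>UNIV. a n x) \<le> (\<Sum>\<^sub>\<infinity>x\<in>UNIV. \<bar>a n x\<bar>)"
      using norm_infsum_bound[of "a n" UNIV] abs by simp
    also have "\<dots> = (\<Sum>\<^sub>\<infinity>x\<in>F. \<bar>a n x\<bar>) + (\<Sum>\<^sub>\<infinity>x\<in>-F. \<bar>a n x\<bar>)"
      using infsum_Un_disjoint[OF abs abs, of F "-F"] by simp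
    also have "\<dots> \<le> (\<Sum>x\<in>F. \<bar>a n x\<bar>) + (\<Sum>\<^sub>\<infinity>x\<in>-F. h x)"
      using F(1) le by (intro add_mono infsum_mono abs hF) auto
    also have "(\<Sum>\<^sub>\<infinity>x\<in>-F. h x) = infsum h UNIV - sum h F"
      using infsum_Un_disjoint[OF summable_on_finite[OF F(1)] hF] F(1) by simp
    finally show ?thesis
      using N[OF n] F(2) unfolding dist_real_def real_norm_def diff_0_right by arith
  qed
  then show "\<exists>no. \<forall>n\<ge>no. norm ((\<Sum>\<^sub>\<infinity>x\<in>UNIV. a n x) - 0) < e" by blast
qed

lemma square_sum_le: "(a + b)\<^sup>2 \<le> 2 * a\<^sup>2 + 2 * (b::real)\<^sup>2"
proof -
  have "0 \<le> (a - b)\<^sup>2" by simp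
  then show ?thesis by (simp add: power2_eq_square algebra_simps)
qed

text \<open>
  Vertices and edges carry \<open>L\<^sup>2\<close> spaces of the same kind; edge weights may vanish, so the general theory
  is developed for weights that are only non-negative.
\<close>

locale weight =
  fixes w :: "'a \<Rightarrow> real"
  assumes weight_nonneg: "w x \<ge> 0"
begin

lemma L2_add: 
  assumes "f \<in> L2 w" "g \<in> L2 w"
  shows "(\<lambda>x. f x + g x) \<in> L2 w"
proof -
  have "(\<lambda>x. 2 * (w x * (f x)\<^sup>2) + 2 * (w x * (g x)\<^sup>2)) summable_on UNIV"
    using assms unfolding L2_def by (intro summable_on_add summable_on_cmult_right) auto
  then show ?thesis
    unfolding L2_def mem_Collect_eq
  proof (rule summable_on_abs_le)
    fix x
    show "\<bar>w x * (f x + g x)\<^sup>2\<bar> \<le> 2 * (w x * (f x)\<^sup>2) + 2 * (w x * (g x)\<^sup>2)"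
      using mult_left_mono[OF square_sum_le[of "f x" "g x"] weight_nonneg[of x]] weight_nonneg[of x]
      by (simp add: abs_mult algebra_simps)
  qed
qed

lemma L2_scale: 
  assumes "f \<in> L2 w"
  shows "(\<lambda>x. c * f x) \<in> L2 w"
proof -
  have "(\<lambda>x. c\<^sup>2 * (w x * (f x)\<^sup>2)) summable_on UNIV"
    using assms unfolding L2_def by (intro summable_on_cmult_right) auto
  moreover have "(\<lambda>x. c\<^sup>2 * (w x * (f x)\<^sup>2)) = (\<lambda>x. w x * (c * f x)\<^sup>2)"
    by (auto simp: power_mult_distrib)
  ultimately show ?thesis
    unfolding L2_def by simp
qed

lemma L2_uminus: "f \<in> L2 w \<Longrightarrow> (\<lambda>x. - f x) \<in> L2 w"
  using L2_scale[of f "-1"] by simp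

lemma L2_diff: "f \<in> L2 w \<Longrightarrow> g \<in> L2 w \<Longrightarrow> (\<lambda>x. f x - g x) \<in> L2 w"
  using L2_add[of f "\<lambda>x. - g x"] L2_uminus[of g] by simp

lemma L2_zero: "(\<lambda>x. 0) \<in> L2 w"
  by (simp add: L2_def)

lemma L2_abs_le:
  assumes "g \<in> L2 w" "\<And>x. \<bar>f x\<bar> \<le> \<bar>g x\<bar>"
  shows "f \<in> L2 w"
  using assms(1) unfolding L2_def mem_Collect_eq
proof (rule summable_on_abs_le)
  fix x
  have "(f x)\<^sup>2 \<le> (g x)\<^sup>2"
    using assms(2)[of x] by (simp add: abs_le_square_iff)
  then show "\<bar>w x * (f x)\<^sup>2\<bar> \<le> w x * (g x)\<^sup>2"
    using weight_nonneg[of x] by (simp add: abs_mult mult_left_mono)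
qed

lemma L2_finite_support:
  assumes "finite {x. f x \<noteq> 0}"
  shows "f \<in> L2 w"
proof -
  have "(\<lambda>x. w x * (f x)\<^sup>2) summable_on {x. f x \<noteq> 0}"
    using assms by (rule summable_on_finite)
  also have "?this \<longleftrightarrow> (\<lambda>x. w x * (f x)\<^sup>2) summable_on UNIV"
    by (rule summable_on_cong_neutral) auto
  finally show ?thesis by (simp add: L2_def)
qed

lemma inner_summable:
  assumes "f \<in> L2 w" "g \<in> L2 w"
  shows "(\<lambda>x. w x * f x * g x) summable_on UNIV"
proof (rule summable_on_abs_le)
  show "(\<lambda>x. w x * (f x)\<^sup>2 + w x * (g x)\<^sup>2) summable_on UNIV"
    using assms unfolding L2_def by (intro summable_on_add) auto
  fix x
  have "2 * \<bar>f x * g x\<bar> \<le> (f x)\<^sup>2 + (g x)\<^sup>2"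
    using sum_squares_bound[of "\<bar>f x\<bar>" "\<bar>g x\<bar>"] by (simp add: abs_mult mult.assoc)
  then have "\<bar>f x * g x\<bar> \<le> (f x)\<^sup>2 + (g x)\<^sup>2"
    using abs_ge_zero[of "f x * g x"] by linarith
  then have "w x * \<bar>f x * g x\<bar> \<le> w x * ((f x)\<^sup>2 + (g x)\<^sup>2)"
    by (rule mult_left_mono) (rule weight_nonneg)
  then show "\<bar>w x * f x * g x\<bar> \<le> w x * (f x)\<^sup>2 + w x * (g x)\<^sup>2"
    using weight_nonneg[of x] by (simp add: abs_mult algebra_simps)
qed

lemma inner_commute: "L2_inner w f g = L2_inner w g f"
  unfolding L2_inner_def by (rule infsum_cong) (simp add: mult_ac)

lemma inner_add_left:
  assumes "f \<in> L2 w" "g \<in> L2 w" "h \<in> L2 w"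
  shows "L2_inner w (\<lambda>x. f x + g x) h = L2_inner w f h + L2_inner w g h"
  unfolding L2_inner_def
  by (subst infsum_add[symmetric, OF inner_summable inner_summable, OF assms(1,3) assms(2,3)])
    (simp add: algebra_simps)

lemma inner_scale_left: "L2_inner w (\<lambda>x. c * f x) h = c * L2_inner w f h"
  unfolding L2_inner_def by (subst infsum_cmult_right'[symmetric]) (simp add: algebra_simps)

lemma inner_diff_left:
  assumes "f \<in> L2 w" "g \<in> L2 w" "h \<in> L2 w"
  shows "L2_inner w (\<lambda>x. f x - g x) h = L2_inner w f h - L2_inner w g h"
  using inner_add_left[OF assms(1) L2_scale[OF assms(2), of "-1"] assms(3)] inner_scale_left[of "-1" g h]
  by simp

lemma inner_add_right:
  assumes "f \<in> L2 w" "g \<in> L2 w" "h \<in> L2 w"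
  shows "L2_inner w h (\<lambda>x. f x + g x) = L2_inner w h f + L2_inner w h g"
  using inner_add_left[OF assms] by (simp add: inner_commute)

lemma inner_diff_right:
  assumes "f \<in> L2 w" "g \<in> L2 w" "h \<in> L2 w"
  shows "L2_inner w h (\<lambda>x. f x - g x) = L2_inner w h f - L2_inner w h g"
  using inner_diff_left[OF assms] by (simp add: inner_commute)

lemma inner_scale_right: "L2_inner w h (\<lambda>x. c * f x) = c * L2_inner w h f"
  using inner_scale_left by (simp add: inner_commute)

lemma inner_self_nonneg: "L2_inner w f f \<ge> 0"
  unfolding L2_inner_def using weight_nonneg by (intro infsum_nonneg) (simp add: mult.assoc)

lemma norm_nonneg: "L2_norm w f \<ge> 0"
  using inner_self_nonneg by (simp add: L2_norm_def)

lemma norm_square: "(L2_norm w f)\<^sup>2 = L2_inner w f f"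
  using inner_self_nonneg by (simp add: L2_norm_def)

lemma norm_square_infsum: "(L2_norm w f)\<^sup>2 = (\<Sum>\<^sub>\<infinity>x\<in>UNIV. w x * (f x)\<^sup>2)"
  unfolding norm_square L2_inner_def by (simp add: power2_eq_square algebra_simps)

lemma norm_scale: "L2_norm w (\<lambda>x. c * f x) = \<bar>c\<bar> * L2_norm w f"
  unfolding L2_norm_def inner_scale_left inner_scale_right
  by (simp add: real_sqrt_mult mult.assoc[symmetric])

lemma norm_uminus: "L2_norm w (\<lambda>x. - f x) = L2_norm w f"
  using norm_scale[of "-1" f] by simp

lemma norm_minus_commute: "L2_norm w (\<lambda>x. f x - g x) = L2_norm w (\<lambda>x. g x - f x)"
  using norm_uminus[of "\<lambda>x. f x - g x"] by simp

lemma norm_zero: "L2_norm w (\<lambda>x. 0) = 0"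
  by (simp add: L2_norm_def L2_inner_def)

lemma norm_square_add:
  assumes "f \<in> L2 w" "g \<in> L2 w"
  shows "L2_inner w (\<lambda>x. f x + g x) (\<lambda>x. f x + g x) = L2_inner w f f + 2 * L2_inner w f g + L2_inner w g g"
  using assms by (simp add: inner_add_left inner_add_right L2_add inner_commute[of g f])

lemma norm_square_diff:
  assumes "f \<in> L2 w" "g \<in> L2 w"
  shows "L2_inner w (\<lambda>x. f x - g x) (\<lambda>x. f x - g x) = L2_inner w f f - 2 * L2_inner w f g + L2_inner w g g"
  using assms by (simp add: inner_diff_left inner_diff_right L2_diff inner_commute[of g f])

text \<open>
  The Cauchy--Schwarz inequality, from \<open>\<parallel>s f - t g\<parallel>\<^sup>2 \<ge> 0\<close> with \<open>s = \<parallel>g\<parallel>\<close> and \<open>t = \<parallel>f\<parallel>\<close>.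
\<close>

lemma inner_le_norm_mult:
  assumes "f \<in> L2 w" "g \<in> L2 w"
  shows "L2_inner w f g \<le> L2_norm w f * L2_norm w g"
proof -
  let ?a = "L2_norm w f" and ?b = "L2_norm w g"
  have *: "2 * (s * t) * L2_inner w f g \<le> s\<^sup>2 * ?a\<^sup>2 + t\<^sup>2 * ?b\<^sup>2" for s t
    using inner_self_nonneg[of "\<lambda>x. s * f x - t * g x"]
      norm_square_diff[OF L2_scale[OF assms(1), of s] L2_scale[OF assms(2), of t]]
    unfolding norm_square by (simp add: inner_scale_left inner_scale_right power2_eq_square mult.assoc)
  show ?thesis
  proof (cases "?a = 0 \<or> ?b = 0")
    case False
    then have "2 * (?a * ?b) > 0" using norm_nonneg[of f] norm_nonneg[of g] by (auto simp: less_le)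
    moreover have "2 * (?a * ?b) * L2_inner w f g \<le> 2 * (?a * ?b) * (?a * ?b)"
      using *[of ?b ?a] by (simp add: power2_eq_square algebra_simps)
    ultimately show ?thesis
      by (rule mult_left_le_imp_le[rotated])
  next
    case True
    \<comment> \<open>If one norm vanishes, scaling that function makes the left side of the bound arbitrarily large and leaves the right side fixed.\<close>
    show ?thesis
    proof (rule ccontr)
      assume "\<not> ?thesis"
      then have pos: "L2_inner w f g > 0" using True by auto
      define c where "c = ?a\<^sup>2 + ?b\<^sup>2"
      have c: "c \<ge> 0" by (simp add: c_def)
      define r where "r = (c + 1) / L2_inner w f g"
      have r: "r * L2_inner w f g = c + 1" using pos by (simp add: r_def)
      have "2 * (c + 1) \<le> c"
        using True
      proof
        assume a: "?a = 0"
        have "2 * (r * L2_inner w f g) \<le> ?b\<^sup>2"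
          using *[of r 1] unfolding a by (simp add: mult.assoc)
        then show "2 * (c + 1) \<le> c" unfolding r by (simp add: c_def a)
      next
        assume b: "?b = 0"
        have "2 * (r * L2_inner w f g) \<le> ?a\<^sup>2"
          using *[of 1 r] unfolding b by (simp add: mult.assoc)
        then show "2 * (c + 1) \<le> c" unfolding r by (simp add: c_def b)
      qed
      then show False using c by simp
    qed
  qed
qed

lemma abs_inner_le_norm_mult:
  assumes "f \<in> L2 w" "g \<in> L2 w"
  shows "\<bar>L2_inner w f g\<bar> \<le> L2_norm w f * L2_norm w g"
  using inner_le_norm_mult[OF assms] inner_le_norm_mult[OF L2_scale[OF assms(1), of "-1"] assms(2)]
    inner_scale_left[of "-1" f g] norm_scale[of "-1" f]
  by (simp add: abs_le_iff)

lemma norm_triangle: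
  assumes "f \<in> L2 w" "g \<in> L2 w"
  shows "L2_norm w (\<lambda>x. f x + g x) \<le> L2_norm w f + L2_norm w g"
proof (rule power2_le_imp_le)
  show "(L2_norm w (\<lambda>x. f x + g x))\<^sup>2 \<le> (L2_norm w f + L2_norm w g)\<^sup>2"
    using inner_le_norm_mult[OF assms] norm_square_add[OF assms]
    by (simp add: power2_sum norm_square)
qed (simp add: norm_nonneg)

lemma norm_triangle_minus:
  assumes "f \<in> L2 w" "g \<in> L2 w"
  shows "L2_norm w (\<lambda>x. f x - g x) \<le> L2_norm w f + L2_norm w g"
  using norm_triangle[OF assms(1) L2_uminus[OF assms(2)]] norm_uminus[of g] by simp

lemma norm_triangle_diff:
  assumes "f \<in> L2 w" "g \<in> L2 w" "h \<in> L2 w"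
  shows "L2_norm w (\<lambda>x. f x - h x) \<le> L2_norm w (\<lambda>x. f x - g x) + L2_norm w (\<lambda>x. g x - h x)"
  using norm_triangle[OF L2_diff[OF assms(1,2)] L2_diff[OF assms(2,3)]] by simp

lemma norm_le_add:
  assumes "f \<in> L2 w" "g \<in> L2 w"
  shows "L2_norm w f \<le> L2_norm w g + L2_norm w (\<lambda>x. f x - g x)"
  using norm_triangle[OF assms(2) L2_diff[OF assms]] by simp

lemma point_le_norm:
  assumes "f \<in> L2 w"
  shows "sqrt (w x) * \<bar>f x\<bar> \<le> L2_norm w f"
proof (rule power2_le_imp_le)
  have "(\<Sum>x\<in>{x}. w x * (f x)\<^sup>2) \<le> (\<Sum>\<^sub>\<infinity>x\<in>UNIV. w x * (f x)\<^sup>2)"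
    using assms weight_nonneg by (intro finite_sum_le_infsum) (auto simp: L2_def)
  then show "(sqrt (w x) * \<bar>f x\<bar>)\<^sup>2 \<le> (L2_norm w f)\<^sup>2"
    using weight_nonneg by (simp add: power_mult_distrib norm_square_infsum)
qed (rule norm_nonneg)

lemma tendsto_point:
  assumes "w x > 0" "\<And>n. f n \<in> L2 w" "g \<in> L2 w" "((\<lambda>n. L2_norm w (\<lambda>y. f n y - g y)) \<longlongrightarrow> 0) F"
  shows "((\<lambda>n. f n x) \<longlongrightarrow> g x) F"
proof -
  have "((\<lambda>n. f n x - g x) \<longlongrightarrow> 0) F"
  proof (rule Lim_null_comparison)
    show "\<forall>\<^sub>F n in F. norm (f n x - g x) \<le> L2_norm w (\<lambda>y. f n y - g y) / sqrt (w x)"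
    proof (intro always_eventually allI)
      fix n
      have "sqrt (w x) * \<bar>f n x - g x\<bar> \<le> L2_norm w (\<lambda>y. f n y - g y)"
        by (rule point_le_norm[OF L2_diff[OF assms(2,3)]])
      then show "norm (f n x - g x) \<le> L2_norm w (\<lambda>y. f n y - g y) / sqrt (w x)"
        using assms(1) by (simp add: pos_le_divide_eq mult.commute)
    qed
    show "((\<lambda>n. L2_norm w (\<lambda>y. f n y - g y) / sqrt (w x)) \<longlongrightarrow> 0) F"
      using tendsto_divide[OF assms(4) tendsto_const[of "sqrt (w x)"]] assms(1) by simp
  qed
  then show ?thesis by (simp add: LIM_zero_iff)
qed

text \<open>
  A Fatou lemma. It holds because the weighted square sum is a supremum of finite sums, and those are continuous
  under pointwise convergence. Points of weight zero are ignored.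
\<close>

lemma Fatou_norm:
  assumes "\<And>n::nat. n \<ge> N \<Longrightarrow> f n \<in> L2 w" "\<And>n. n \<ge> N \<Longrightarrow> L2_norm w (f n) \<le> C" 
    and lim: "\<And>x. w x > 0 \<Longrightarrow> (\<lambda>n. f n x) \<longlonglongrightarrow> g x"
  shows "g \<in> L2 w" "L2_norm w g \<le> C"
proof -
  have C: "C \<ge> 0" using assms(2)[of N] norm_nonneg[of "f N"] by simp
  have fin: "(\<Sum>x\<in>A. w x * (g x)\<^sup>2) \<le> C\<^sup>2" if A: "finite A" for A
  proof (rule LIMSEQ_le_const2)
    have "(\<lambda>n. w x * (f n x)\<^sup>2) \<longlonglongrightarrow> w x * (g x)\<^sup>2" for x
    proof (cases "w x > 0")
      case True
      then show ?thesis by (intro tendsto_intros lim)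
    next
      case False
      then have "w x = 0" using weight_nonneg[of x] by simp
      then show ?thesis by simp
    qed
    then show "(\<lambda>n. \<Sum>x\<in>A. w x * (f n x)\<^sup>2) \<longlonglongrightarrow> (\<Sum>x\<in>A. w x * (g x)\<^sup>2)"
      by (rule tendsto_sum)
    show "\<exists>N. \<forall>n\<ge>N. (\<Sum>x\<in>A. w x * (f n x)\<^sup>2) \<le> C\<^sup>2"
    proof (intro exI allI impI)
      fix n assume n: "n \<ge> N"
      have "(\<Sum>x\<in>A. w x * (f n x)\<^sup>2) \<le> (L2_norm w (f n))\<^sup>2"
        unfolding norm_square_infsum
        using assms(1)[OF n] weight_nonneg A by (intro finite_sum_le_infsum) (auto simp: L2_def)
      also have "\<dots> \<le> C\<^sup>2" using assms(2)[OF n] norm_nonneg by (intro power_mono)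
      finally show "(\<Sum>x\<in>A. w x * (f n x)\<^sup>2) \<le> C\<^sup>2" .
    qed
  qed
  show g: "g \<in> L2 w"
    unfolding L2_def mem_Collect_eq
  proof (rule nonneg_bdd_above_summable_on)
    show "bdd_above (sum (\<lambda>x. w x * (g x)\<^sup>2) ` {F. F \<subseteq> UNIV \<and> finite F})"
      using fin by (intro bdd_aboveI[of _ "C\<^sup>2"]) auto
  qed (simp add: weight_nonneg)
  show "L2_norm w g \<le> C"
  proof (rule power2_le_imp_le[OF _ C])
    show "(L2_norm w g)\<^sup>2 \<le> C\<^sup>2"
      unfolding norm_square_infsum using g fin by (intro infsum_le_finite_sums) (auto simp: L2_def)
  qed
qed

definition Cauchy_norm :: "(nat \<Rightarrow> 'a \<Rightarrow> real) \<Rightarrow> bool" where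
  "Cauchy_norm f \<longleftrightarrow> (\<forall>e>0. \<exists>N. \<forall>k\<ge>N. \<forall>l\<ge>N. L2_norm w (\<lambda>x. f k x - f l x) < e)"

text \<open>
  Completeness in the form in which it is used below, where pointwise limits are known beforehand:
  let \<open>k \<rightarrow> \<infinity>\<close> in \<open>\<parallel>f\<^sub>l - f\<^sub>k\<parallel> \<le> e\<close> by the Fatou lemma.
\<close>

lemma Cauchy_norm_pointwise_limit:
  assumes L2: "\<And>n. f n \<in> L2 w" and "Cauchy_norm f"
    and lim: "\<And>x. w x > 0 \<Longrightarrow> (\<lambda>n. f n x) \<longlonglongrightarrow> g x"
  shows "g \<in> L2 w" "(\<lambda>n. L2_norm w (\<lambda>x. f n x - g x)) \<longlonglongrightarrow> 0"
proof -
  have *: "\<exists>N. \<forall>l\<ge>N. (\<lambda>x. f l x - g x) \<in> L2 w \<and> L2_norm w (\<lambda>x. f l x - g x) \<le> e" if e: "e > 0" for e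
  proof -
    obtain N where N: "\<And>k l. k \<ge> N \<Longrightarrow> l \<ge> N \<Longrightarrow> L2_norm w (\<lambda>x. f l x - f k x) < e"
      using assms(2) e unfolding Cauchy_norm_def by blast
    have "(\<lambda>x. f l x - g x) \<in> L2 w \<and> L2_norm w (\<lambda>x. f l x - g x) \<le> e" if l: "l \<ge> N" for l
    proof -
      have a: "(\<lambda>k. f l x - f k x) \<longlonglongrightarrow> f l x - g x" if "w x > 0" for x
        by (intro tendsto_intros lim that)
      have b: "L2_norm w (\<lambda>x. f l x - f k x) \<le> e" if "k \<ge> N" for k
        using N[OF that l] by simp
      show ?thesis
        using Fatou_norm[where N=N and f="\<lambda>k x. f l x - f k x", OF L2_diff[OF L2 L2] b a] by blast
    qed
    then show ?thesis by blast
  qed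
  obtain N where "(\<lambda>x. f N x - g x) \<in> L2 w" using *[of 1] by auto
  from L2_diff[OF L2[of N] this] show "g \<in> L2 w" by simp
  show "(\<lambda>n. L2_norm w (\<lambda>x. f n x - g x)) \<longlonglongrightarrow> 0"
  proof (rule LIMSEQ_I)
    fix r :: real assume "r > 0"
    then show "\<exists>no. \<forall>n\<ge>no. norm (L2_norm w (\<lambda>x. f n x - g x) - 0) < r"
      using *[of "r/2"] norm_nonneg by fastforce
  qed
qed

lemma Cauchy_norm_imp_limit:
  assumes pos: "\<And>x. w x > 0" and L2: "\<And>n. f n \<in> L2 w" and Cauchy: "Cauchy_norm f"
  obtains g where "g \<in> L2 w" "(\<lambda>n. L2_norm w (\<lambda>x. f n x - g x)) \<longlonglongrightarrow> 0"
proof -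
  have "Cauchy (\<lambda>n. f n x)" for x
  proof (rule metric_CauchyI)
    fix e :: real assume "e > 0"
    then have "e * sqrt (w x) > 0" using pos by simp
    then obtain N where N: "\<And>k l. k \<ge> N \<Longrightarrow> l \<ge> N \<Longrightarrow> L2_norm w (\<lambda>x. f k x - f l x) < e * sqrt (w x)"
      using Cauchy unfolding Cauchy_norm_def by blast
    have "dist (f k x) (f l x) < e" if "k \<ge> N" "l \<ge> N" for k l
    proof -
      have "sqrt (w x) * \<bar>f k x - f l x\<bar> < sqrt (w x) * e"
        using N[OF that] point_le_norm[OF L2_diff[OF L2[of k] L2[of l]], of x] by (simp add: mult.commute)
      then show ?thesis using pos by (simp add: dist_real_def)
    qed
    then show "\<exists>M. \<forall>m\<ge>M. \<forall>n\<ge>M. dist (f m x) (f n x) < e" by blast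
  qed
  then have "(\<lambda>n. f n x) \<longlonglongrightarrow> lim (\<lambda>n. f n x)" for x
    by (simp add: real_Cauchy_convergent flip: convergent_LIMSEQ_iff)
  from Cauchy_norm_pointwise_limit[OF L2 Cauchy, of "\<lambda>x. lim (\<lambda>n. f n x)", OF this]
  show ?thesis by (rule that)
qed

lemma convergent_imp_Cauchy_norm:
  assumes "\<And>n. f n \<in> L2 w" "g \<in> L2 w" "(\<lambda>n. L2_norm w (\<lambda>x. f n x - g x)) \<longlonglongrightarrow> 0"
  shows "Cauchy_norm f"
  unfolding Cauchy_norm_def
proof (intro allI impI)
  fix e :: real assume "e > 0"
  then obtain N where N: "\<And>n. n \<ge> N \<Longrightarrow> L2_norm w (\<lambda>x. f n x - g x) < e / 2"
    using LIMSEQ_D[OF assms(3), of "e/2"] norm_nonneg by auto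
  have "L2_norm w (\<lambda>x. f k x - f l x) < e" if "k \<ge> N" "l \<ge> N" for k l
    using norm_triangle_diff[OF assms(1,2,1), of k l] N[OF that(1)] N[OF that(2)]
      norm_minus_commute[of "f l" g] by simp
  then show "\<exists>N. \<forall>k\<ge>N. \<forall>l\<ge>N. L2_norm w (\<lambda>x. f k x - f l x) < e" by blast
qed

lemma norm_dominated:
  assumes "h \<in> L2 w" "\<And>n x. \<bar>f n x - g x\<bar> \<le> h x" "\<And>x. (\<lambda>n. f n x) \<longlonglongrightarrow> g x"
  shows "(\<lambda>n. L2_norm w (\<lambda>x. f n x - g x)) \<longlonglongrightarrow> 0"
proof -
  have "(\<lambda>n. (L2_norm w (\<lambda>x. f n x - g x))\<^sup>2) \<longlonglongrightarrow> 0"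
    unfolding norm_square_infsum
  proof (rule infsum_dominated_null)
    show "(\<lambda>x. w x * (h x)\<^sup>2) summable_on UNIV"
      using assms(1) by (simp add: L2_def)
    show "\<bar>w x * (f n x - g x)\<^sup>2\<bar> \<le> w x * (h x)\<^sup>2" for n x
      using power_mono[OF assms(2)[of n x], of 2] weight_nonneg[of x] by (simp add: abs_mult mult_left_mono)
    have "(\<lambda>n. w x * (f n x - g x)\<^sup>2) \<longlonglongrightarrow> w x * (g x - g x)\<^sup>2" for x
      by (intro tendsto_intros assms(3))
    then show "(\<lambda>n. w x * (f n x - g x)\<^sup>2) \<longlonglongrightarrow> 0" for x by simp
  qed
  from tendsto_real_sqrt[OF this] show ?thesis by (simp add: norm_nonneg)
qed

lemma Cauchy_normI:
  assumes L2: "\<And>n. f n \<in> L2 w"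
    and *: "\<And>e. e > 0 \<Longrightarrow> \<exists>g\<in>L2 w. \<forall>\<^sub>F n in sequentially. L2_norm w (\<lambda>x. f n x - g x) < e"
  shows "Cauchy_norm f"
  unfolding Cauchy_norm_def
proof (intro allI impI)
  fix e :: real assume "e > 0"
  then obtain g N where g: "g \<in> L2 w" and N: "\<And>n. n \<ge> N \<Longrightarrow> L2_norm w (\<lambda>x. f n x - g x) < e / 2"
    using *[of "e/2"] by (auto simp: eventually_sequentially)
  have "L2_norm w (\<lambda>x. f k x - f l x) < e" if "k \<ge> N" "l \<ge> N" for k l
    using norm_triangle_diff[OF L2 g L2, of k l] N[OF that(1)] N[OF that(2)]
      norm_minus_commute[of "f l" g] by simp
  then show "\<exists>N. \<forall>k\<ge>N. \<forall>l\<ge>N. L2_norm w (\<lambda>x. f k x - f l x) < e" by blast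
qed

lemma inner_tendsto:
  assumes "\<And>n. f n \<in> L2 w" "f' \<in> L2 w" "\<And>n. g n \<in> L2 w" "g' \<in> L2 w"
    and f: "((\<lambda>n. L2_norm w (\<lambda>x. f n x - f' x)) \<longlongrightarrow> 0) F"
    and g: "((\<lambda>n. L2_norm w (\<lambda>x. g n x - g' x)) \<longlongrightarrow> 0) F"
  shows "((\<lambda>n. L2_inner w (f n) (g n)) \<longlongrightarrow> L2_inner w f' g') F"
proof -
  let ?p = "\<lambda>n. L2_norm w (\<lambda>x. f n x - f' x)" and ?q = "\<lambda>n. L2_norm w (\<lambda>x. g n x - g' x)"
  have "((\<lambda>n. L2_inner w (f n) (g n) - L2_inner w f' g') \<longlongrightarrow> 0) F"
  proof (rule Lim_null_comparison)
    show "\<forall>\<^sub>F n in F. norm (L2_inner w (f n) (g n) - L2_inner w f' g')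
        \<le> ?p n * (L2_norm w g' + ?q n) + L2_norm w f' * ?q n"
    proof (intro always_eventually allI)
      fix n
      have "L2_inner w (f n) (g n) - L2_inner w f' g'
          = L2_inner w (\<lambda>x. f n x - f' x) (g n) + L2_inner w f' (\<lambda>x. g n x - g' x)"
        using assms(1-4) by (simp add: inner_diff_left inner_diff_right)
      moreover have "\<bar>L2_inner w (\<lambda>x. f n x - f' x) (g n)\<bar> \<le> ?p n * L2_norm w (g n)"
        by (intro abs_inner_le_norm_mult L2_diff assms)
      moreover have "?p n * L2_norm w (g n) \<le> ?p n * (L2_norm w g' + ?q n)"
        by (intro mult_left_mono norm_le_add assms norm_nonneg)
      moreover have "\<bar>L2_inner w f' (\<lambda>x. g n x - g' x)\<bar> \<le> L2_norm w f' * ?q n"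
        by (intro abs_inner_le_norm_mult L2_diff assms)
      ultimately show "norm (L2_inner w (f n) (g n) - L2_inner w f' g')
          \<le> ?p n * (L2_norm w g' + ?q n) + L2_norm w f' * ?q n" by simp
    qed
    have "((\<lambda>n. ?p n * (L2_norm w g' + ?q n) + L2_norm w f' * ?q n)
        \<longlongrightarrow> 0 * (L2_norm w g' + 0) + L2_norm w f' * 0) F"
      by (intro tendsto_intros f g)
    then show "((\<lambda>n. ?p n * (L2_norm w g' + ?q n) + L2_norm w f' * ?q n) \<longlongrightarrow> 0) F" by simp
  qed
  then show ?thesis by (simp add: LIM_zero_iff)
qed

end


section \<open>The Dirichlet form\<close>

text \<open>
  The energy is half the squared norm of a gradient in a weighted \<open>L\<^sup>2\<close> space over the pairs of vertices.
  Closability and completeness of the form thereby reduce to facts about these spaces.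
\<close>

definition edge_weight :: "('v \<Rightarrow> 'v \<Rightarrow> real) \<Rightarrow> 'v \<times> 'v \<Rightarrow> real" where
  "edge_weight \<mu> = (\<lambda>(x, y). \<mu> x y)"

definition grad :: "('v \<Rightarrow> real) \<Rightarrow> 'v \<times> 'v \<Rightarrow> real" where
  "grad f = (\<lambda>(x, y). f x - f y)"

definition energy_form :: "('v \<Rightarrow> 'v \<Rightarrow> real) \<Rightarrow> ('v \<Rightarrow> real) \<Rightarrow> ('v \<Rightarrow> real) \<Rightarrow> real" where
  "energy_form \<mu> f g = 1 / 2 * L2_inner (edge_weight \<mu>) (grad f) (grad g)"

text \<open>
  This is \<open>m \<Delta> f\<close>; without the division by \<open>m\<close> Green's formula becomes symmetric.
\<close>

definition weighted_laplacian :: "('v \<Rightarrow> 'v \<Rightarrow> real) \<Rightarrow> ('v \<Rightarrow> real) \<Rightarrow> 'v \<Rightarrow> real" where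
  "weighted_laplacian \<mu> f x = (\<Sum>\<^sub>\<infinity>y\<in>UNIV. \<mu> x y * (f x - f y))"

lemma grad_add: "grad (\<lambda>x. f x + g x) = (\<lambda>p. grad f p + grad g p)"
  by (auto simp: grad_def)

lemma grad_diff: "grad (\<lambda>x. f x - g x) = (\<lambda>p. grad f p - grad g p)"
  by (auto simp: grad_def)

lemma grad_scale: "grad (\<lambda>x. c * f x) = (\<lambda>p. c * grad f p)"
  by (auto simp: grad_def right_diff_distrib)

lemma finitely_supported_add:
  assumes "f \<in> finitely_supported" "g \<in> finitely_supported"
  shows "(\<lambda>x. f x + g x) \<in> finitely_supported"
  using assms unfolding finitely_supported_def mem_Collect_eq
  by (intro finite_subset[of "{x. f x + g x \<noteq> 0}" "{x. f x \<noteq> 0} \<union> {x. g x \<noteq> 0}"]) auto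

lemma finitely_supported_scale:
  assumes "f \<in> finitely_supported"
  shows "(\<lambda>x. c * f x) \<in> finitely_supported"
  using assms unfolding finitely_supported_def mem_Collect_eq
  by (intro finite_subset[of "{x. c * f x \<noteq> 0}" "{x. f x \<noteq> 0}"]) auto

locale graph =
  fixes m :: "'v::countable \<Rightarrow> real" and \<mu> :: "'v \<Rightarrow> 'v \<Rightarrow> real"
  assumes weighted: "weighted_graph m \<mu>"
begin

lemma m_pos: "m x > 0" and \<mu>_nonneg: "\<mu> x y \<ge> 0" and \<mu>_commute: "\<mu> x y = \<mu> y x"
  and \<mu>_summable: "\<mu> x summable_on UNIV"
  using weighted by (auto simp: weighted_graph_def)

sublocale V: weight m
  by unfold_locales (use m_pos less_imp_le in blast)

sublocale E: weight "edge_weight \<mu>"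
  by unfold_locales (auto simp: edge_weight_def \<mu>_nonneg)

definition deg :: "'v \<Rightarrow> real" where
  "deg x = (\<Sum>\<^sub>\<infinity>y\<in>UNIV. \<mu> x y)"

lemma deg_nonneg: "deg x \<ge> 0"
  unfolding deg_def by (intro infsum_nonneg \<mu>_nonneg)

lemma energy_eq: "energy \<mu> f = 1 / 2 * (L2_norm (edge_weight \<mu>) (grad f))\<^sup>2"
  unfolding energy_def E.norm_square_infsum
  by (auto simp: edge_weight_def grad_def intro!: infsum_cong)

lemma fst_in_edge_L2:
  assumes "f \<in> finitely_supported"
  shows "(\<lambda>(x, y). f x) \<in> L2 (edge_weight \<mu>)"
proof -
  have "(\<lambda>(x, y). \<mu> x y * (f x)\<^sup>2) summable_on UNIV \<times> UNIV"
  proof (rule summable_on_SigmaI)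
    fix x
    show "((\<lambda>y. case (x, y) of (x, y) \<Rightarrow> \<mu> x y * (f x)\<^sup>2) has_sum (deg x * (f x)\<^sup>2)) UNIV"
      unfolding deg_def prod.case by (intro has_sum_cmult_left has_sum_infsum \<mu>_summable)
    have "(\<lambda>x. deg x * (f x)\<^sup>2) summable_on {x. f x \<noteq> 0}"
      using assms by (intro summable_on_finite) (simp add: finitely_supported_def)
    also have "?this \<longleftrightarrow> (\<lambda>x. deg x * (f x)\<^sup>2) summable_on UNIV"
      by (rule summable_on_cong_neutral) auto
    finally show "(\<lambda>x. deg x * (f x)\<^sup>2) summable_on UNIV" .
  qed (simp add: \<mu>_nonneg)
  then show ?thesis
    by (simp add: L2_def edge_weight_def case_prod_beta')
qed

lemma edge_sum_swap:
  "(\<Sum>\<^sub>\<infinity>p\<in>UNIV. F (prod.swap p)) = (\<Sum>\<^sub>\<infinity>p\<in>UNIV. (F p :: real))"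
  "(\<lambda>p. F (prod.swap p)) summable_on UNIV \<longleftrightarrow> F summable_on (UNIV :: ('v \<times> 'v) set)"
proof -
  show "(\<Sum>\<^sub>\<infinity>p\<in>UNIV. F (prod.swap p)) = (\<Sum>\<^sub>\<infinity>p\<in>UNIV. F p)"
    using infsum_reindex[of prod.swap "UNIV :: ('v \<times> 'v) set" F] by (simp add: o_def surj_swap)
  show "(\<lambda>p. F (prod.swap p)) summable_on UNIV \<longleftrightarrow> F summable_on (UNIV :: ('v \<times> 'v) set)"
    using summable_on_reindex[of prod.swap "UNIV :: ('v \<times> 'v) set" F] by (simp add: o_def surj_swap)
qed

lemma edge_weight_swap: "edge_weight \<mu> (prod.swap p) = edge_weight \<mu> p"
  using \<mu>_commute by (cases p) (auto simp: edge_weight_def)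

lemma snd_in_edge_L2:
  assumes "f \<in> finitely_supported"
  shows "(\<lambda>(x, y). f y) \<in> L2 (edge_weight \<mu>)"
  using fst_in_edge_L2[OF assms] unfolding L2_def mem_Collect_eq
  by (subst (asm) edge_sum_swap(2)[symmetric]) (simp add: edge_weight_swap case_prod_beta)

lemma grad_in_edge_L2:
  assumes "f \<in> finitely_supported"
  shows "grad f \<in> L2 (edge_weight \<mu>)"
  using E.L2_diff[OF fst_in_edge_L2[OF assms] snd_in_edge_L2[OF assms]]
  by (simp add: grad_def case_prod_beta')

lemma finitely_supported_in_L2: "f \<in> finitely_supported \<Longrightarrow> f \<in> L2 m"
  by (simp add: V.L2_finite_support finitely_supported_def)

text \<open>
  Green's formula. By the symmetry of \<open>\<mu>\<close> the summands \<open>h x\<close> and \<open>- h y\<close> of the gradient of \<open>h\<close> contribute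
  the same amount, which accounts for the factor \<open>1 / 2\<close>. As each summand is separately square summable over the
  pairs, the double series may be summed iteratively.
\<close>

lemma Green_formula:
  assumes h: "h \<in> finitely_supported" and f: "grad f \<in> L2 (edge_weight \<mu>)"
  shows "energy_form \<mu> f h = (\<Sum>x | h x \<noteq> 0. weighted_laplacian \<mu> f x * h x)"
proof -
  let ?a = "\<lambda>(x, y). h x" and ?b = "\<lambda>(x, y). h y"
  note ab = fst_in_edge_L2[OF h] snd_in_edge_L2[OF h]
  have grad_h: "grad h = (\<lambda>p. ?a p - ?b p)"
    by (auto simp: grad_def)
  have swap: "L2_inner (edge_weight \<mu>) (grad f) ?b = - L2_inner (edge_weight \<mu>) (grad f) ?a"
  proof -
    have "L2_inner (edge_weight \<mu>) (grad f) ?b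
        = (\<Sum>\<^sub>\<infinity>p\<in>UNIV. edge_weight \<mu> (prod.swap p) * grad f (prod.swap p) * ?b (prod.swap p))"
      unfolding L2_inner_def by (subst edge_sum_swap) simp
    also have "\<dots> = (\<Sum>\<^sub>\<infinity>p\<in>UNIV. - (edge_weight \<mu> p * grad f p * ?a p))"
      by (rule infsum_cong) (auto simp: edge_weight_swap grad_def algebra_simps)
    finally show ?thesis by (simp add: L2_inner_def infsum_uminus)
  qed
  have "energy_form \<mu> f h = L2_inner (edge_weight \<mu>) (grad f) ?a"
    unfolding energy_form_def grad_h E.inner_diff_right[OF ab f] swap by simp
  also have "\<dots> = (\<Sum>\<^sub>\<infinity>x\<in>UNIV. \<Sum>\<^sub>\<infinity>y\<in>UNIV. edge_weight \<mu> (x, y) * grad f (x, y) * ?a (x, y))"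
    using E.inner_summable[OF f ab(1)] unfolding L2_inner_def
    by (subst infsum_Sigma_banach) (simp_all add: case_prod_beta)
  also have "\<dots> = (\<Sum>\<^sub>\<infinity>x\<in>UNIV. weighted_laplacian \<mu> f x * h x)"
    by (simp add: edge_weight_def grad_def weighted_laplacian_def infsum_cmult_left')
  also have "\<dots> = (\<Sum>\<^sub>\<infinity>x\<in>{x. h x \<noteq> 0}. weighted_laplacian \<mu> f x * h x)"
    by (rule infsum_cong_neutral) auto
  also have "\<dots> = (\<Sum>x | h x \<noteq> 0. weighted_laplacian \<mu> f x * h x)"
    using h by (intro infsum_finite) (simp add: finitely_supported_def)
  finally show ?thesis .
qed

lemma inner_finitely_supported:
  assumes "h \<in> finitely_supported"
  shows "L2_inner m f h = (\<Sum>x | h x \<noteq> 0. m x * f x * h x)"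
proof -
  have "L2_inner m f h = (\<Sum>\<^sub>\<infinity>x\<in>{x. h x \<noteq> 0}. m x * f x * h x)"
    unfolding L2_inner_def by (rule infsum_cong_neutral) auto
  also have "\<dots> = (\<Sum>x | h x \<noteq> 0. m x * f x * h x)"
    using assms by (intro infsum_finite) (simp add: finitely_supported_def)
  finally show ?thesis .
qed


subsection \<open>The closure of the form\<close>

definition converges_in_form :: "(nat \<Rightarrow> 'v \<Rightarrow> real) \<Rightarrow> ('v \<Rightarrow> real) \<Rightarrow> bool" where
  "converges_in_form \<phi> f \<longleftrightarrow> (\<forall>n. \<phi> n \<in> finitely_supported) \<and> f \<in> L2 m \<and> grad f \<in> L2 (edge_weight \<mu>) \<and>
     (\<lambda>n. L2_norm m (\<lambda>x. \<phi> n x - f x)) \<longlonglongrightarrow> 0 \<and>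
     (\<lambda>n. L2_norm (edge_weight \<mu>) (\<lambda>p. grad (\<phi> n) p - grad f p)) \<longlonglongrightarrow> 0"

lemma energy_diff: "energy \<mu> (\<lambda>x. f x - g x) = 1 / 2 * (L2_norm (edge_weight \<mu>) (\<lambda>p. grad f p - grad g p))\<^sup>2"
  by (simp add: energy_eq grad_diff)

lemma energy_Cauchy_iff:
  "(\<forall>e>0. \<exists>N. \<forall>k\<ge>N. \<forall>l\<ge>N. energy \<mu> (\<lambda>x. \<phi> k x - \<phi> l x) < e) \<longleftrightarrow> E.Cauchy_norm (\<lambda>n. grad (\<phi> n))"
proof
  assume L: "\<forall>e>0. \<exists>N. \<forall>k\<ge>N. \<forall>l\<ge>N. energy \<mu> (\<lambda>x. \<phi> k x - \<phi> l x) < e"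
  show "E.Cauchy_norm (\<lambda>n. grad (\<phi> n))"
    unfolding E.Cauchy_norm_def
  proof (intro allI impI)
    fix e :: real assume e: "e > 0"
    then have "e\<^sup>2 / 2 > 0" by simp
    with L obtain N where N: "\<And>k l. k \<ge> N \<Longrightarrow> l \<ge> N \<Longrightarrow> energy \<mu> (\<lambda>x. \<phi> k x - \<phi> l x) < e\<^sup>2 / 2"
      by blast
    have "L2_norm (edge_weight \<mu>) (\<lambda>p. grad (\<phi> k) p - grad (\<phi> l) p) < e" if "k \<ge> N" "l \<ge> N" for k l
      using N[OF that] e unfolding energy_diff by (intro power2_less_imp_less[of _ e]) auto
    then show "\<exists>N. \<forall>k\<ge>N. \<forall>l\<ge>N. L2_norm (edge_weight \<mu>) (\<lambda>p. grad (\<phi> k) p - grad (\<phi> l) p) < e"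
      by blast
  qed
next
  assume R: "E.Cauchy_norm (\<lambda>n. grad (\<phi> n))"
  show "\<forall>e>0. \<exists>N. \<forall>k\<ge>N. \<forall>l\<ge>N. energy \<mu> (\<lambda>x. \<phi> k x - \<phi> l x) < e"
  proof (intro allI impI)
    fix e :: real assume e: "e > 0"
    then have "sqrt (2 * e) > 0" by simp
    with R obtain N where N: "\<And>k l. k \<ge> N \<Longrightarrow> l \<ge> N \<Longrightarrow>
        L2_norm (edge_weight \<mu>) (\<lambda>p. grad (\<phi> k) p - grad (\<phi> l) p) < sqrt (2 * e)"
      unfolding E.Cauchy_norm_def by blast
    have "energy \<mu> (\<lambda>x. \<phi> k x - \<phi> l x) < e" if "k \<ge> N" "l \<ge> N" for k l
      using power_strict_mono[OF N[OF that] E.norm_nonneg, of 2] e unfolding energy_diff by simp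
    then show "\<exists>N. \<forall>k\<ge>N. \<forall>l\<ge>N. energy \<mu> (\<lambda>x. \<phi> k x - \<phi> l x) < e"
      by blast
  qed
qed

text \<open>
  The form is closable: \<open>L\<^sup>2\<close> convergence is pointwise convergence, hence it already determines the
  limit of the gradients.
\<close>

lemma form_approximates_iff:
  assumes "f \<in> L2 m"
  shows "form_approximates m \<mu> \<phi> f \<longleftrightarrow> converges_in_form \<phi> f"
proof
  assume "form_approximates m \<mu> \<phi> f"
  then have fs: "\<And>n. \<phi> n \<in> finitely_supported"
    and lim: "(\<lambda>n. L2_norm m (\<lambda>x. \<phi> n x - f x)) \<longlonglongrightarrow> 0"
    and C: "E.Cauchy_norm (\<lambda>n. grad (\<phi> n))"
    by (auto simp: form_approximates_def energy_Cauchy_iff)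
  have "(\<lambda>n. \<phi> n x) \<longlonglongrightarrow> f x" for x
    by (rule V.tendsto_point[OF m_pos finitely_supported_in_L2[OF fs] assms lim])
  then have "(\<lambda>n. grad (\<phi> n) p) \<longlonglongrightarrow> grad f p" for p
    by (cases p) (auto simp: grad_def intro!: tendsto_intros)
  from E.Cauchy_norm_pointwise_limit[OF grad_in_edge_L2[OF fs] C this]
  show "converges_in_form \<phi> f"
    using fs lim assms by (simp add: converges_in_form_def)
next
  assume R: "converges_in_form \<phi> f"
  then have "E.Cauchy_norm (\<lambda>n. grad (\<phi> n))"
    by (intro E.convergent_imp_Cauchy_norm[where g="grad f"])
      (auto simp: converges_in_form_def intro: grad_in_edge_L2)
  with R show "form_approximates m \<mu> \<phi> f"
    by (simp add: form_approximates_def energy_Cauchy_iff converges_in_form_def)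
qed

lemma form_domain_iff: "f \<in> form_domain m \<mu> \<longleftrightarrow> (\<exists>\<phi>. converges_in_form \<phi> f)"
  using form_approximates_iff by (auto simp: form_domain_def converges_in_form_def)

lemma form_domain_L2: "f \<in> form_domain m \<mu> \<Longrightarrow> f \<in> L2 m"
  and form_domain_grad: "f \<in> form_domain m \<mu> \<Longrightarrow> grad f \<in> L2 (edge_weight \<mu>)"
  by (auto simp: form_domain_iff converges_in_form_def)

lemma energy_form_self: "energy_form \<mu> f f = energy \<mu> f"
  by (simp add: energy_form_def energy_eq E.norm_square)

lemma energy_nonneg: "energy \<mu> f \<ge> 0"
  by (simp add: energy_eq)

lemma converges_in_form_energy_form:
  assumes "converges_in_form \<phi> f" "converges_in_form \<psi> g"
  shows "(\<lambda>n. energy_form \<mu> (\<phi> n) (\<psi> n)) \<longlonglongrightarrow> energy_form \<mu> f g"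
  unfolding energy_form_def using assms
  by (intro tendsto_intros E.inner_tendsto) (auto simp: converges_in_form_def intro: grad_in_edge_L2)

lemma converges_in_form_const:
  assumes "f \<in> finitely_supported"
  shows "converges_in_form (\<lambda>_. f) f"
  using assms by (simp add: converges_in_form_def finitely_supported_in_L2 grad_in_edge_L2 V.norm_zero E.norm_zero)

lemma finitely_supported_in_form_domain: "f \<in> finitely_supported \<Longrightarrow> f \<in> form_domain m \<mu>"
  using converges_in_form_const form_domain_iff by blast

lemma converges_in_form_add:
  assumes "converges_in_form \<phi> f" "converges_in_form \<psi> g"
  shows "converges_in_form (\<lambda>n x. \<phi> n x + \<psi> n x) (\<lambda>x. f x + g x)"
proof -
  have "(\<lambda>n. L2_norm m (\<lambda>x. \<phi> n x + \<psi> n x - (f x + g x))) \<longlonglongrightarrow> 0"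
  proof (rule Lim_null_comparison)
    show "\<forall>\<^sub>F n in sequentially. norm (L2_norm m (\<lambda>x. \<phi> n x + \<psi> n x - (f x + g x)))
        \<le> L2_norm m (\<lambda>x. \<phi> n x - f x) + L2_norm m (\<lambda>x. \<psi> n x - g x)"
      using assms V.norm_triangle[OF V.L2_diff V.L2_diff, of "\<phi> _" f "\<psi> _" g] finitely_supported_in_L2
      by (intro always_eventually) (auto simp: converges_in_form_def V.norm_nonneg algebra_simps)
    show "(\<lambda>n. L2_norm m (\<lambda>x. \<phi> n x - f x) + L2_norm m (\<lambda>x. \<psi> n x - g x)) \<longlonglongrightarrow> 0"
      using assms by (intro tendsto_add_zero) (auto simp: converges_in_form_def)
  qed
  moreover have "(\<lambda>n. L2_norm (edge_weight \<mu>) (\<lambda>p. grad (\<lambda>x. \<phi> n x + \<psi> n x) p - grad (\<lambda>x. f x + g x) p)) \<longlonglongrightarrow> 0"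
  proof (rule Lim_null_comparison)
    show "\<forall>\<^sub>F n in sequentially. norm (L2_norm (edge_weight \<mu>) (\<lambda>p. grad (\<lambda>x. \<phi> n x + \<psi> n x) p - grad (\<lambda>x. f x + g x) p))
        \<le> L2_norm (edge_weight \<mu>) (\<lambda>p. grad (\<phi> n) p - grad f p) + L2_norm (edge_weight \<mu>) (\<lambda>p. grad (\<psi> n) p - grad g p)"
      using assms E.norm_triangle[OF E.L2_diff E.L2_diff, of "grad (\<phi> _)" "grad f" "grad (\<psi> _)" "grad g"] grad_in_edge_L2
      by (intro always_eventually) (auto simp: converges_in_form_def E.norm_nonneg grad_add algebra_simps)
    show "(\<lambda>n. L2_norm (edge_weight \<mu>) (\<lambda>p. grad (\<phi> n) p - grad f p) + L2_norm (edge_weight \<mu>) (\<lambda>p. grad (\<psi> n) p - grad g p)) \<longlonglongrightarrow> 0"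
      using assms by (intro tendsto_add_zero) (auto simp: converges_in_form_def)
  qed
  ultimately show ?thesis
    using assms by (auto simp: converges_in_form_def finitely_supported_add V.L2_add E.L2_add grad_add)
qed

lemma converges_in_form_scale:
  assumes "converges_in_form \<phi> f"
  shows "converges_in_form (\<lambda>n x. c * \<phi> n x) (\<lambda>x. c * f x)"
proof -
  have 1: "(\<lambda>n. \<bar>c\<bar> * L2_norm m (\<lambda>x. \<phi> n x - f x)) \<longlonglongrightarrow> 0"
    "(\<lambda>n. \<bar>c\<bar> * L2_norm (edge_weight \<mu>) (\<lambda>p. grad (\<phi> n) p - grad f p)) \<longlonglongrightarrow> 0"
    using assms by (auto intro!: tendsto_mult_right_zero simp: converges_in_form_def)
  then show ?thesis
    using assms unfolding V.norm_scale[symmetric] E.norm_scale[symmetric]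
    by (auto simp: converges_in_form_def finitely_supported_scale V.L2_scale E.L2_scale grad_scale right_diff_distrib)
qed

lemma form_domain_add: "f \<in> form_domain m \<mu> \<Longrightarrow> g \<in> form_domain m \<mu> \<Longrightarrow> (\<lambda>x. f x + g x) \<in> form_domain m \<mu>"
  unfolding form_domain_iff using converges_in_form_add by blast

lemma form_domain_scale: "f \<in> form_domain m \<mu> \<Longrightarrow> (\<lambda>x. c * f x) \<in> form_domain m \<mu>"
  unfolding form_domain_iff using converges_in_form_scale by blast

lemma form_domain_diff: "f \<in> form_domain m \<mu> \<Longrightarrow> g \<in> form_domain m \<mu> \<Longrightarrow> (\<lambda>x. f x - g x) \<in> form_domain m \<mu>"
  using form_domain_add[of f "\<lambda>x. -1 * g x"] form_domain_scale[of g "-1"] by simp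

text \<open>
  The closure acts on its domain by the same series as the original form, so that the definite description
  can be eliminated for good.
\<close>

lemma closed_form_eq:
  assumes "f \<in> form_domain m \<mu>"
  shows "closed_form m \<mu> f = energy \<mu> f"
  unfolding closed_form_def
proof (rule the_equality)
  note iff = form_approximates_iff[OF form_domain_L2[OF assms]]
  have lim: "(\<lambda>n. energy \<mu> (\<phi> n)) \<longlonglongrightarrow> energy \<mu> f" if "form_approximates m \<mu> \<phi> f" for \<phi>
    using converges_in_form_energy_form[of \<phi> f \<phi> f] that by (simp add: iff energy_form_self)
  then show "\<exists>\<phi>. form_approximates m \<mu> \<phi> f \<and> (\<lambda>n. energy \<mu> (\<phi> n)) \<longlonglongrightarrow> energy \<mu> f"
    using assms form_domain_iff iff by blast
  show "q = energy \<mu> f" if "\<exists>\<phi>. form_approximates m \<mu> \<phi> f \<and> (\<lambda>n. energy \<mu> (\<phi> n)) \<longlonglongrightarrow> q" for q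
    using that lim LIMSEQ_unique by blast
qed

lemma closed_form_bilinear_eq:
  assumes "f \<in> form_domain m \<mu>" "g \<in> form_domain m \<mu>"
  shows "closed_form_bilinear m \<mu> f g = energy_form \<mu> f g"
  unfolding closed_form_bilinear_def closed_form_eq[OF form_domain_add[OF assms]]
    closed_form_eq[OF form_domain_diff[OF assms]] energy_form_def energy_eq E.norm_square grad_add grad_diff
    E.norm_square_add[OF assms[THEN form_domain_grad]] E.norm_square_diff[OF assms[THEN form_domain_grad]]
  by (simp add: field_simps)

lemma form_operatorD:
  assumes "form_operator m \<mu> f g"
  shows "f \<in> form_domain m \<mu>" "g \<in> L2 m" "h \<in> form_domain m \<mu> \<Longrightarrow> energy_form \<mu> f h = L2_inner m g h"
  using assms closed_form_bilinear_eq by (auto simp: form_operator_def)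

text \<open>
  By density of the finitely supported functions in the form norm, the weak equation has to be tested
  against those only.
\<close>

lemma form_operatorI:
  assumes f: "f \<in> form_domain m \<mu>" and g: "g \<in> L2 m"
    and eq: "\<And>h. h \<in> finitely_supported \<Longrightarrow> energy_form \<mu> f h = L2_inner m g h"
  shows "form_operator m \<mu> f g"
  unfolding form_operator_def
proof (intro conjI ballI f g)
  fix h assume h: "h \<in> form_domain m \<mu>"
  then obtain \<phi> where \<phi>: "converges_in_form \<phi> h" by (auto simp: form_domain_iff)
  have "(\<lambda>n. energy_form \<mu> f (\<phi> n)) \<longlonglongrightarrow> energy_form \<mu> f h"
    unfolding energy_form_def using \<phi> form_domain_grad[OF f]
    by (intro tendsto_intros E.inner_tendsto)
      (auto simp: converges_in_form_def E.norm_zero intro: grad_in_edge_L2)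
  moreover have "(\<lambda>n. L2_inner m g (\<phi> n)) \<longlonglongrightarrow> L2_inner m g h"
    using \<phi> g finitely_supported_in_L2
    by (intro V.inner_tendsto) (auto simp: converges_in_form_def V.norm_zero)
  moreover have "energy_form \<mu> f (\<phi> n) = L2_inner m g (\<phi> n)" for n
    using \<phi> by (intro eq) (simp add: converges_in_form_def)
  ultimately show "closed_form_bilinear m \<mu> f h = L2_inner m g h"
    using LIMSEQ_unique by (auto simp: closed_form_bilinear_eq[OF f h])
qed

end


section \<open>The resolvent as a limit of subsolutions\<close>

context graph
begin

subsection \<open>Monotone iteration\<close>

definition exhaustion :: "nat \<Rightarrow> 'v set" where
  "exhaustion n = {x. to_nat x < n}"

lemma finite_exhaustion: "finite (exhaustion n)"
  unfolding exhaustion_def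
  by (rule finite_imageD[of to_nat]) (auto intro: finite_subset[of _ "{..<n}"])

lemma exhaustion_mono: "k \<le> l \<Longrightarrow> exhaustion k \<subseteq> exhaustion l"
  by (auto simp: exhaustion_def)

lemma eventually_in_exhaustion: "\<forall>\<^sub>F n in sequentially. x \<in> exhaustion n"
  unfolding eventually_sequentially exhaustion_def by (auto intro!: exI[of _ "Suc (to_nat x)"])

text \<open>
  At a vertex \<open>x\<close> the equation \<open>(\<Delta> + \<alpha>) f = \<alpha> \<phi>\<close>, multiplied by \<open>m x\<close>, reads
  \<open>(deg x + \<alpha> * m x) * f x = \<alpha> * m x * \<phi> x + (\<Sum>y. \<mu> x y * f y)\<close>. The iteration solves this for \<open>f x\<close> with the previous
  values on the right, restricted in step \<open>k\<close> to the \<open>k\<close>-th set of the exhaustion. All iterates are therefore finitely supported, and no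
  boundary value problem on a finite set has to be solved.
\<close>

primrec iterate :: "real \<Rightarrow> ('v \<Rightarrow> real) \<Rightarrow> nat \<Rightarrow> 'v \<Rightarrow> real" where
  "iterate \<alpha> \<phi> 0 = (\<lambda>x. 0)"
| "iterate \<alpha> \<phi> (Suc k) = (\<lambda>x. if x \<in> exhaustion k
     then (\<alpha> * m x * \<phi> x + (\<Sum>\<^sub>\<infinity>y\<in>UNIV. \<mu> x y * iterate \<alpha> \<phi> k y)) / (deg x + \<alpha> * m x) else 0)"

lemma iterate_finitely_supported: "iterate \<alpha> \<phi> k \<in> finitely_supported"
proof (cases k)
  case (Suc n)
  then show ?thesis
    unfolding finitely_supported_def mem_Collect_eq
    by (intro finite_subset[OF _ finite_exhaustion[of n]]) auto
qed (simp add: finitely_supported_def)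

lemma finitely_supported_neighbour_summable:
  assumes "f \<in> finitely_supported"
  shows "(\<lambda>y. \<mu> x y * f y) summable_on UNIV"
proof -
  have "(\<lambda>y. \<mu> x y * f y) summable_on {y. f y \<noteq> 0}"
    using assms by (intro summable_on_finite) (simp add: finitely_supported_def)
  also have "?this \<longleftrightarrow> (\<lambda>y. \<mu> x y * f y) summable_on UNIV"
    by (rule summable_on_cong_neutral) auto
  finally show ?thesis .
qed

lemma weighted_laplacian_eq:
  assumes "(\<lambda>y. \<mu> x y * f y) summable_on UNIV"
  shows "weighted_laplacian \<mu> f x = deg x * f x - (\<Sum>\<^sub>\<infinity>y\<in>UNIV. \<mu> x y * f y)"
  unfolding weighted_laplacian_def right_diff_distrib deg_def
  by (subst infsum_diff_real) (auto intro: assms summable_on_cmult_left \<mu>_summable simp: infsum_cmult_left')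

lemma neighbour_sum_mono:
  assumes "\<And>y. f y \<le> g y" "f \<in> finitely_supported" "g \<in> finitely_supported"
  shows "(\<Sum>\<^sub>\<infinity>y\<in>UNIV. \<mu> x y * f y) \<le> (\<Sum>\<^sub>\<infinity>y\<in>UNIV. \<mu> x y * g y)"
  using assms by (intro infsum_mono finitely_supported_neighbour_summable mult_left_mono \<mu>_nonneg)

lemma denominator_pos: "\<alpha> > 0 \<Longrightarrow> deg x + \<alpha> * m x > 0"
  using deg_nonneg[of x] m_pos[of x] by (simp add: add_nonneg_pos)

context
  fixes \<alpha> :: real
  assumes \<alpha>: "\<alpha> > 0"
begin

lemma iterate_mono_source:
  assumes "\<And>x. \<phi> x \<le> \<psi> x"
  shows "iterate \<alpha> \<phi> k x \<le> iterate \<alpha> \<psi> k x"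
proof (induction k arbitrary: x)
  case (Suc k)
  have "\<alpha> * m x * \<phi> x + (\<Sum>\<^sub>\<infinity>y\<in>UNIV. \<mu> x y * iterate \<alpha> \<phi> k y)
      \<le> \<alpha> * m x * \<psi> x + (\<Sum>\<^sub>\<infinity>y\<in>UNIV. \<mu> x y * iterate \<alpha> \<psi> k y)"
    using \<alpha> m_pos[of x] assms[of x]
    by (intro add_mono mult_left_mono neighbour_sum_mono iterate_finitely_supported Suc) auto
  then show ?case
    using denominator_pos[OF \<alpha>, of x] by (simp add: divide_right_mono)
qed simp

lemma iterate_nonneg:
  assumes "\<And>x. 0 \<le> \<phi> x"
  shows "0 \<le> iterate \<alpha> \<phi> k x"
proof (induction k arbitrary: x)
  case (Suc k)
  have "0 \<le> \<alpha> * m x * \<phi> x + (\<Sum>\<^sub>\<infinity>y\<in>UNIV. \<mu> x y * iterate \<alpha> \<phi> k y)"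
    using \<alpha> m_pos[of x] assms[of x]
    by (intro add_nonneg_nonneg mult_nonneg_nonneg infsum_nonneg \<mu>_nonneg Suc) auto
  then show ?case
    using denominator_pos[OF \<alpha>, of x] by simp
qed simp

lemma iterate_le_Suc:
  assumes "\<And>x. 0 \<le> \<phi> x"
  shows "iterate \<alpha> \<phi> k x \<le> iterate \<alpha> \<phi> (Suc k) x"
proof (induction k arbitrary: x)
  case 0
  then show ?case using iterate_nonneg[where \<phi>=\<phi> and k="Suc 0", OF assms] by simp
next
  case (Suc k)
  have "(\<Sum>\<^sub>\<infinity>y\<in>UNIV. \<mu> x y * iterate \<alpha> \<phi> k y) \<le> (\<Sum>\<^sub>\<infinity>y\<in>UNIV. \<mu> x y * iterate \<alpha> \<phi> (Suc k) y)"
    by (intro neighbour_sum_mono iterate_finitely_supported Suc)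
  then have "(\<alpha> * m x * \<phi> x + (\<Sum>\<^sub>\<infinity>y\<in>UNIV. \<mu> x y * iterate \<alpha> \<phi> k y)) / (deg x + \<alpha> * m x)
      \<le> (\<alpha> * m x * \<phi> x + (\<Sum>\<^sub>\<infinity>y\<in>UNIV. \<mu> x y * iterate \<alpha> \<phi> (Suc k) y)) / (deg x + \<alpha> * m x)"
    using denominator_pos[OF \<alpha>, of x] by (intro divide_right_mono) auto
  moreover have "x \<in> exhaustion k \<Longrightarrow> x \<in> exhaustion (Suc k)"
    using exhaustion_mono[of k "Suc k"] by auto
  moreover have "0 \<le> iterate \<alpha> \<phi> (Suc (Suc k)) x" by (rule iterate_nonneg[OF assms])
  ultimately show ?case
    unfolding iterate.simps(2)[of _ _ "Suc k"] iterate.simps(2)[of _ _ k, THEN fun_cong, of _ _ x]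
    by (auto split: if_splits)
qed

lemma iterate_incseq:
  assumes "\<And>x. 0 \<le> \<phi> x"
  shows "incseq (\<lambda>k. iterate \<alpha> \<phi> k x)"
  using iterate_le_Suc[OF assms] by (intro incseq_SucI)

text \<open>
  The constant \<open>1\<close> is a supersolution when \<open>\<phi> \<le> 1\<close>.
\<close>

lemma iterate_le_1:
  assumes "\<And>x. \<phi> x \<le> 1"
  shows "iterate \<alpha> \<phi> k x \<le> 1"
proof (induction k arbitrary: x)
  case (Suc k)
  have "(\<Sum>\<^sub>\<infinity>y\<in>UNIV. \<mu> x y * iterate \<alpha> \<phi> k y) \<le> deg x"
    unfolding deg_def
    using Suc \<mu>_nonneg by (intro infsum_mono finitely_supported_neighbour_summable iterate_finitely_supported \<mu>_summable)
      (simp add: mult_left_le)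
  moreover have "\<alpha> * m x * \<phi> x \<le> \<alpha> * m x"
    using \<alpha> m_pos[of x] assms[of x] by (intro mult_left_le) auto
  ultimately show ?case
    using denominator_pos[OF \<alpha>, of x] by (simp add: divide_le_eq_1)
qed simp

text \<open>
  The defect of an iterate is a multiple of the next increment. It is non-negative by monotonicity and
  tends to zero wherever the iterates converge, without any interchange of limit and summation.
\<close>

lemma iterate_laplacian:
  assumes "x \<in> exhaustion k"
  shows "weighted_laplacian \<mu> (iterate \<alpha> \<phi> k) x
    = \<alpha> * m x * (\<phi> x - iterate \<alpha> \<phi> k x) - (deg x + \<alpha> * m x) * (iterate \<alpha> \<phi> (Suc k) x - iterate \<alpha> \<phi> k x)"
proof -
  have "(deg x + \<alpha> * m x) * iterate \<alpha> \<phi> (Suc k) x = \<alpha> * m x * \<phi> x + (\<Sum>\<^sub>\<infinity>y\<in>UNIV. \<mu> x y * iterate \<alpha> \<phi> k y)"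
    using assms denominator_pos[OF \<alpha>, of x] by simp
  then show ?thesis
    unfolding weighted_laplacian_eq[OF finitely_supported_neighbour_summable[OF iterate_finitely_supported]]
    by (simp only: algebra_simps)
qed

lemma iterate_subsolution:
  assumes "\<And>x. 0 \<le> \<phi> x"
  shows "weighted_laplacian \<mu> (iterate \<alpha> \<phi> k) x \<le> \<alpha> * m x * (\<phi> x - iterate \<alpha> \<phi> k x)"
proof (cases "x \<in> exhaustion k")
  case True
  have "0 \<le> (deg x + \<alpha> * m x) * (iterate \<alpha> \<phi> (Suc k) x - iterate \<alpha> \<phi> k x)"
    using iterate_le_Suc[where \<phi>=\<phi> and k=k and x=x, OF assms] denominator_pos[OF \<alpha>, of x] by (intro mult_nonneg_nonneg) auto
  then show ?thesis
    unfolding iterate_laplacian[OF True] by simp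
next
  case False
  then have 0: "iterate \<alpha> \<phi> k x = 0"
    using exhaustion_mono[of "k - 1" k] by (cases k) auto
  have "0 \<le> (\<Sum>\<^sub>\<infinity>y\<in>UNIV. \<mu> x y * iterate \<alpha> \<phi> k y)"
    by (intro infsum_nonneg mult_nonneg_nonneg \<mu>_nonneg iterate_nonneg assms)
  moreover have "0 \<le> \<alpha> * m x * \<phi> x"
    using \<alpha> m_pos[of x] assms[of x] by simp
  ultimately show ?thesis
    unfolding weighted_laplacian_eq[OF finitely_supported_neighbour_summable[OF iterate_finitely_supported]] 0
    by simp
qed

lemma iterate_laplacian_tendsto:
  assumes "(\<lambda>k. iterate \<alpha> \<phi> k x) \<longlonglongrightarrow> f x"
  shows "(\<lambda>k. weighted_laplacian \<mu> (iterate \<alpha> \<phi> k) x) \<longlonglongrightarrow> \<alpha> * m x * (\<phi> x - f x)"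
proof -
  have "(\<lambda>k. \<alpha> * m x * (\<phi> x - iterate \<alpha> \<phi> k x) - (deg x + \<alpha> * m x) * (iterate \<alpha> \<phi> (Suc k) x - iterate \<alpha> \<phi> k x))
      \<longlonglongrightarrow> \<alpha> * m x * (\<phi> x - f x) - (deg x + \<alpha> * m x) * (f x - f x)"
    by (intro tendsto_intros assms LIMSEQ_Suc[OF assms])
  then have "(\<lambda>k. \<alpha> * m x * (\<phi> x - iterate \<alpha> \<phi> k x) - (deg x + \<alpha> * m x) * (iterate \<alpha> \<phi> (Suc k) x - iterate \<alpha> \<phi> k x))
      \<longlonglongrightarrow> \<alpha> * m x * (\<phi> x - f x)" by simp
  then show ?thesis
    by (rule Lim_transform_eventually)
      (rule eventually_mono[OF eventually_in_exhaustion[of x]], rule iterate_laplacian[symmetric])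
qed

lemma iterate_test_nonneg:
  assumes "\<And>x. 0 \<le> \<phi> x" "h \<in> finitely_supported" "\<And>x. 0 \<le> h x"
  shows "energy_form \<mu> (iterate \<alpha> \<phi> k) h + \<alpha> * L2_inner m (iterate \<alpha> \<phi> k) h \<le> \<alpha> * L2_inner m \<phi> h"
proof -
  have "energy_form \<mu> (iterate \<alpha> \<phi> k) h + \<alpha> * L2_inner m (iterate \<alpha> \<phi> k) h
      = (\<Sum>x | h x \<noteq> 0. (weighted_laplacian \<mu> (iterate \<alpha> \<phi> k) x + \<alpha> * m x * iterate \<alpha> \<phi> k x) * h x)"
    unfolding Green_formula[OF assms(2) grad_in_edge_L2[OF iterate_finitely_supported]]
      inner_finitely_supported[OF assms(2)] sum_distrib_left sum.distrib[symmetric]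
    by (simp add: algebra_simps)
  also have "\<dots> \<le> (\<Sum>x | h x \<noteq> 0. (\<alpha> * m x * \<phi> x) * h x)"
  proof (intro sum_mono mult_right_mono assms(3))
    fix x
    show "weighted_laplacian \<mu> (iterate \<alpha> \<phi> k) x + \<alpha> * m x * iterate \<alpha> \<phi> k x \<le> \<alpha> * m x * \<phi> x"
      using iterate_subsolution[where \<phi>=\<phi> and k=k and x=x, OF assms(1)] by (simp add: right_diff_distrib)
  qed
  also have "\<dots> = \<alpha> * L2_inner m \<phi> h"
    unfolding inner_finitely_supported[OF assms(2)] sum_distrib_left by (simp add: mult.assoc)
  finally show ?thesis .
qed

lemma iterate_test_tendsto:
  assumes "\<And>x. (\<lambda>k. iterate \<alpha> \<phi> k x) \<longlonglongrightarrow> f x" "h \<in> finitely_supported"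
  shows "(\<lambda>k. energy_form \<mu> (iterate \<alpha> \<phi> k) h) \<longlonglongrightarrow> L2_inner m (\<lambda>x. \<alpha> * (\<phi> x - f x)) h"
proof -
  have "(\<lambda>k. \<Sum>x | h x \<noteq> 0. weighted_laplacian \<mu> (iterate \<alpha> \<phi> k) x * h x)
      \<longlonglongrightarrow> (\<Sum>x | h x \<noteq> 0. \<alpha> * m x * (\<phi> x - f x) * h x)"
    by (intro tendsto_intros iterate_laplacian_tendsto assms)
  then show ?thesis
    unfolding Green_formula[OF assms(2) grad_in_edge_L2[OF iterate_finitely_supported]]
      inner_finitely_supported[OF assms(2)] by (simp add: algebra_simps)
qed

text \<open>
  Testing the subsolution inequality with the iterate itself.
\<close>

lemma iterate_norm_le:
  assumes "\<And>x. 0 \<le> \<phi> x" "\<phi> \<in> L2 m"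
  shows "L2_norm m (iterate \<alpha> \<phi> k) \<le> L2_norm m \<phi>"
proof -
  let ?f = "iterate \<alpha> \<phi> k"
  have "\<alpha> * L2_inner m ?f ?f \<le> \<alpha> * L2_inner m \<phi> ?f"
    using iterate_test_nonneg[where \<phi>=\<phi> and k=k, OF assms(1) iterate_finitely_supported[of \<alpha> \<phi> k] iterate_nonneg[OF assms(1)]]
      energy_nonneg[of ?f] by (simp add: energy_form_self)
  then have "(L2_norm m ?f)\<^sup>2 \<le> L2_norm m \<phi> * L2_norm m ?f"
    using \<alpha> V.inner_le_norm_mult[OF assms(2) finitely_supported_in_L2[OF iterate_finitely_supported], of \<alpha> \<phi> k]
    by (simp add: V.norm_square)
  then show ?thesis
    using V.norm_nonneg[of ?f] V.norm_nonneg[of \<phi>] by (cases "L2_norm m ?f = 0") (auto simp: power2_eq_square)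
qed

text \<open>
  Write \<open>E(f, g) = Q(f, g) + \<alpha> \<langle>f, g\<rangle>\<close> and \<open>s\<^sub>k = \<langle>\<phi>, f\<^sub>k\<rangle>\<close>, an increasing sequence with limit \<open>S\<close>.
  The subsolution property yields \<open>E(f\<^sub>k, f\<^sub>k) \<le> \<alpha> s\<^sub>k\<close>, and for fixed \<open>l\<close> the numbers \<open>E(f\<^sub>k, f\<^sub>l)\<close> tend to
  \<open>\<alpha> s\<^sub>l\<close> because \<open>f\<^sub>l\<close> has finite support. Expanding the square, the limit superior of \<open>E(f\<^sub>k - f\<^sub>l, f\<^sub>k - f\<^sub>l)\<close> in \<open>k\<close> is
  at most \<open>\<alpha> (S - s\<^sub>l)\<close>, which is small for large \<open>l\<close>. So the iterates form a Cauchy sequence in the form norm.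
\<close>

lemma iterate_converges:
  assumes \<phi>: "\<And>x. 0 \<le> \<phi> x" "\<phi> \<in> L2 m"
  obtains f where "\<And>x. (\<lambda>k. iterate \<alpha> \<phi> k x) \<longlonglongrightarrow> f x" "form_operator m \<mu> f (\<lambda>x. \<alpha> * (\<phi> x - f x))"
proof -
  define f where "f x = lim (\<lambda>k. iterate \<alpha> \<phi> k x)" for x
  let ?f = "iterate \<alpha> \<phi>"
  note fs = iterate_finitely_supported[of \<alpha> \<phi>]
  note L2 = finitely_supported_in_L2[OF fs] and gL2 = grad_in_edge_L2[OF fs]
  have lim: "(\<lambda>k. ?f k x) \<longlonglongrightarrow> f x" for x
  proof -
    have "?f k x \<le> L2_norm m \<phi> / sqrt (m x)" for k
    proof -
      have "sqrt (m x) * \<bar>?f k x\<bar> \<le> L2_norm m \<phi>"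
        using V.point_le_norm[OF L2] iterate_norm_le[OF \<phi>] by (rule order_trans)
      then have "\<bar>?f k x\<bar> \<le> L2_norm m \<phi> / sqrt (m x)"
        using m_pos by (simp add: pos_le_divide_eq mult.commute)
      then show ?thesis by simp
    qed
    then obtain L where "(\<lambda>k. ?f k x) \<longlonglongrightarrow> L"
      using incseq_convergent[OF iterate_incseq[where \<phi>=\<phi> and x=x, OF \<phi>(1)]] by blast
    then have "convergent (\<lambda>k. ?f k x)" by (rule convergentI)
    then show ?thesis by (simp add: f_def convergent_LIMSEQ_iff)
  qed
  define s where "s k = L2_inner m \<phi> (?f k)" for k
  have s_mono: "incseq s"
  proof (rule incseq_SucI)
    fix k
    show "s k \<le> s (Suc k)"
      unfolding s_def L2_inner_def
    proof (intro infsum_mono V.inner_summable \<phi> L2)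
      fix x
      show "m x * \<phi> x * ?f k x \<le> m x * \<phi> x * ?f (Suc k) x"
        using \<phi>(1)[of x] m_pos[of x] by (intro mult_left_mono iterate_le_Suc \<phi>(1)) simp
    qed
  qed
  have "s k \<le> L2_norm m \<phi> * L2_norm m \<phi>" for k
    unfolding s_def
    by (rule order_trans[OF V.inner_le_norm_mult[OF \<phi>(2) L2] mult_left_mono[OF iterate_norm_le[OF \<phi>] V.norm_nonneg]])
  then obtain S where S: "s \<longlonglongrightarrow> S" "\<And>k. s k \<le> S"
    using incseq_convergent[OF s_mono] by blast
  define D where "D k l = energy \<mu> (\<lambda>x. ?f k x - ?f l x) + \<alpha> * (L2_norm m (\<lambda>x. ?f k x - ?f l x))\<^sup>2" for k l
  have D: "\<exists>l. \<forall>\<^sub>F k in sequentially. D k l < e" if e: "e > 0" for e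
  proof -
    have "(\<lambda>l. \<alpha> * S - \<alpha> * s l) \<longlonglongrightarrow> \<alpha> * S - \<alpha> * S"
      by (intro tendsto_intros S)
    then have "\<forall>\<^sub>F l in sequentially. \<alpha> * S - \<alpha> * s l < e"
      using e by (intro order_tendstoD(2)[where a=e]) auto
    then obtain l where l: "\<alpha> * S - \<alpha> * s l < e"
      by (auto simp: eventually_sequentially)
    let ?a = "\<lambda>k. energy_form \<mu> (?f k) (?f l) + \<alpha> * L2_inner m (?f k) (?f l)"
    have "(\<lambda>k. \<Sum>x | ?f l x \<noteq> 0. m x * ?f k x * ?f l x) \<longlonglongrightarrow> (\<Sum>x | ?f l x \<noteq> 0. m x * f x * ?f l x)"
      by (intro tendsto_intros lim)
    then have "(\<lambda>k. L2_inner m (?f k) (?f l)) \<longlonglongrightarrow> L2_inner m f (?f l)"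
      unfolding inner_finitely_supported[OF fs] .
    then have "?a \<longlonglongrightarrow> L2_inner m (\<lambda>x. \<alpha> * (\<phi> x - f x)) (?f l) + \<alpha> * L2_inner m f (?f l)"
      by (intro tendsto_intros iterate_test_tendsto lim fs)
    moreover have "L2_inner m (\<lambda>x. \<alpha> * (\<phi> x - f x)) (?f l) + \<alpha> * L2_inner m f (?f l) = \<alpha> * s l"
      unfolding s_def inner_finitely_supported[OF fs] sum_distrib_left sum.distrib[symmetric]
      by (simp add: algebra_simps)
    ultimately have a: "?a \<longlonglongrightarrow> \<alpha> * s l" by simp
    have "(\<lambda>k. \<alpha> * S - 2 * ?a k + \<alpha> * s l) \<longlonglongrightarrow> \<alpha> * S - 2 * (\<alpha> * s l) + \<alpha> * s l"
      by (intro tendsto_intros a)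
    then have ev: "\<forall>\<^sub>F k in sequentially. \<alpha> * S - 2 * ?a k + \<alpha> * s l < e"
      using l by (intro order_tendstoD(2)) auto
    have le: "energy_form \<mu> (?f k) (?f k) + \<alpha> * L2_inner m (?f k) (?f k) \<le> \<alpha> * s k" for k
      unfolding s_def by (intro iterate_test_nonneg fs iterate_nonneg \<phi>)
    have "D k l \<le> \<alpha> * S - 2 * ?a k + \<alpha> * s l" for k
    proof -
      have "D k l = (energy_form \<mu> (?f k) (?f k) + \<alpha> * L2_inner m (?f k) (?f k)) - 2 * ?a k
          + (energy_form \<mu> (?f l) (?f l) + \<alpha> * L2_inner m (?f l) (?f l))"
        unfolding D_def energy_diff E.norm_square V.norm_square energy_form_def
          E.norm_square_diff[OF gL2 gL2] V.norm_square_diff[OF L2 L2] by (simp add: algebra_simps)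
      moreover have "\<alpha> * s k \<le> \<alpha> * S" using S(2) \<alpha> by simp
      ultimately show ?thesis using le[of k] le[of l] by linarith
    qed
    then have "\<forall>\<^sub>F k in sequentially. D k l < e"
      by (intro eventually_mono[OF ev]) (rule le_less_trans)
    then show ?thesis by blast
  qed
  have "V.Cauchy_norm ?f"
  proof (rule V.Cauchy_normI[OF L2])
    fix e :: real assume e: "e > 0"
    then obtain l where l: "\<forall>\<^sub>F k in sequentially. D k l < \<alpha> * e\<^sup>2"
      using D[of "\<alpha> * e\<^sup>2"] \<alpha> by auto
    have near: "L2_norm m (\<lambda>x. ?f k x - ?f l x) < e" if "D k l < \<alpha> * e\<^sup>2" for k
    proof (rule power2_less_imp_less)
      have "\<alpha> * (L2_norm m (\<lambda>x. ?f k x - ?f l x))\<^sup>2 < \<alpha> * e\<^sup>2"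
        using that energy_nonneg[of "\<lambda>x. ?f k x - ?f l x"] unfolding D_def by linarith
      then show "(L2_norm m (\<lambda>x. ?f k x - ?f l x))\<^sup>2 < e\<^sup>2" using \<alpha> by simp
    qed (use e in simp)
    show "\<exists>g\<in>L2 m. \<forall>\<^sub>F n in sequentially. L2_norm m (\<lambda>x. ?f n x - g x) < e"
      by (rule bexI[OF _ L2[of l]], rule eventually_mono[OF l], rule near)
  qed
  then have f: "f \<in> L2 m" "(\<lambda>n. L2_norm m (\<lambda>x. ?f n x - f x)) \<longlonglongrightarrow> 0"
    using V.Cauchy_norm_pointwise_limit[OF L2 _ lim] by auto
  have grad_Cauchy: "E.Cauchy_norm (\<lambda>k. grad (?f k))"
  proof (rule E.Cauchy_normI[OF gL2])
    fix e :: real assume e: "e > 0"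
    then obtain l where l: "\<forall>\<^sub>F k in sequentially. D k l < e\<^sup>2 / 2"
      using D[of "e\<^sup>2 / 2"] by auto
    have near: "L2_norm (edge_weight \<mu>) (\<lambda>x. grad (?f k) x - grad (?f l) x) < e" if "D k l < e\<^sup>2 / 2" for k
    proof (rule power2_less_imp_less)
      have "0 \<le> \<alpha> * (L2_norm m (\<lambda>x. ?f k x - ?f l x))\<^sup>2" using \<alpha> by simp
      then have "energy \<mu> (\<lambda>x. ?f k x - ?f l x) < e\<^sup>2 / 2"
        using that unfolding D_def by linarith
      then show "(L2_norm (edge_weight \<mu>) (\<lambda>x. grad (?f k) x - grad (?f l) x))\<^sup>2 < e\<^sup>2"
        by (simp add: energy_diff)
    qed (use e in simp)
    show "\<exists>g\<in>L2 (edge_weight \<mu>). \<forall>\<^sub>F n in sequentially. L2_norm (edge_weight \<mu>) (\<lambda>x. grad (?f n) x - g x) < e"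
      by (rule bexI[OF _ gL2[of l]], rule eventually_mono[OF l], rule near)
  qed
  have grad_lim: "(\<lambda>n. grad (?f n) p) \<longlonglongrightarrow> grad f p" for p
    by (cases p) (auto simp: grad_def intro!: tendsto_intros lim)
  have g: "grad f \<in> L2 (edge_weight \<mu>)"
      "(\<lambda>n. L2_norm (edge_weight \<mu>) (\<lambda>p. grad (?f n) p - grad f p)) \<longlonglongrightarrow> 0"
    using E.Cauchy_norm_pointwise_limit[OF gL2 grad_Cauchy grad_lim] .
  have conv: "converges_in_form ?f f"
    using fs f g by (simp add: converges_in_form_def)
  have "form_operator m \<mu> f (\<lambda>x. \<alpha> * (\<phi> x - f x))"
  proof (rule form_operatorI)
    show "f \<in> form_domain m \<mu>" using conv form_domain_iff by blast
    show "(\<lambda>x. \<alpha> * (\<phi> x - f x)) \<in> L2 m"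
      by (intro V.L2_scale V.L2_diff \<phi> f)
    fix h :: "'v \<Rightarrow> real" assume h: "h \<in> finitely_supported"
    have "(\<lambda>k. energy_form \<mu> (?f k) h) \<longlonglongrightarrow> energy_form \<mu> f h"
      by (rule converges_in_form_energy_form[OF conv converges_in_form_const[OF h]])
    with iterate_test_tendsto[OF lim h] show "energy_form \<mu> f h = L2_inner m (\<lambda>x. \<alpha> * (\<phi> x - f x)) h"
      using LIMSEQ_unique by blast
  qed
  with lim show ?thesis by (rule that)
qed

end

subsection \<open>The resolvent\<close>

lemma form_operator_add:
  assumes "form_operator m \<mu> f g" "form_operator m \<mu> f' g'"
  shows "form_operator m \<mu> (\<lambda>x. f x + f' x) (\<lambda>x. g x + g' x)"
proof (rule form_operatorI)
  note D = form_operatorD[OF assms(1)] and D' = form_operatorD[OF assms(2)]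
  show "(\<lambda>x. f x + f' x) \<in> form_domain m \<mu>" by (intro form_domain_add D D')
  show "(\<lambda>x. g x + g' x) \<in> L2 m" by (intro V.L2_add D D')
  fix h :: "'v \<Rightarrow> real" assume h: "h \<in> finitely_supported"
  then have hD: "h \<in> form_domain m \<mu>" by (rule finitely_supported_in_form_domain)
  show "energy_form \<mu> (\<lambda>x. f x + f' x) h = L2_inner m (\<lambda>x. g x + g' x) h"
    using D(3)[OF hD] D'(3)[OF hD] D(1)[THEN form_domain_grad] D'(1)[THEN form_domain_grad] hD[THEN form_domain_grad]
      D(2) D'(2) form_domain_L2[OF hD]
    by (simp add: energy_form_def grad_add E.inner_add_left V.inner_add_left)
qed

lemma form_operator_scale:
  assumes "form_operator m \<mu> f g"
  shows "form_operator m \<mu> (\<lambda>x. c * f x) (\<lambda>x. c * g x)"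
proof (rule form_operatorI)
  note D = form_operatorD[OF assms(1)]
  show "(\<lambda>x. c * f x) \<in> form_domain m \<mu>" by (intro form_domain_scale D)
  show "(\<lambda>x. c * g x) \<in> L2 m" by (intro V.L2_scale D)
  fix h :: "'v \<Rightarrow> real" assume h: "h \<in> finitely_supported"
  then have hD: "h \<in> form_domain m \<mu>" by (rule finitely_supported_in_form_domain)
  show "energy_form \<mu> (\<lambda>x. c * f x) h = L2_inner m (\<lambda>x. c * g x) h"
    using D(3)[OF hD] by (simp add: energy_form_def grad_scale E.inner_scale_left V.inner_scale_left)
qed

lemma form_operator_diff:
  assumes "form_operator m \<mu> f g" "form_operator m \<mu> f' g'"
  shows "form_operator m \<mu> (\<lambda>x. f x - f' x) (\<lambda>x. g x - g' x)"
  using form_operator_add[OF assms(1) form_operator_scale[OF assms(2), of "-1"]] by simp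

text \<open>
  The normalised resolvent \<open>\<alpha> (L + \<alpha>)\<^sup>-\<^sup>1\<close>, which preserves the bounds \<open>0 \<le> \<phi> \<le> 1\<close> and
  tends strongly to the identity as \<open>\<alpha> \<rightarrow> \<infinity>\<close>.
\<close>

definition resolvent :: "real \<Rightarrow> ('v \<Rightarrow> real) \<Rightarrow> 'v \<Rightarrow> real" where
  "resolvent \<alpha> \<phi> = (THE f. form_operator m \<mu> f (\<lambda>x. \<alpha> * (\<phi> x - f x)))"

context
  fixes \<alpha> :: real
  assumes \<alpha>: "\<alpha> > 0"
begin

lemma resolvent_equation_norm_le:
  assumes "form_operator m \<mu> f (\<lambda>x. \<alpha> * (\<phi> x - f x))" and \<phi>: "\<phi> \<in> L2 m"
  shows "L2_norm m f \<le> L2_norm m \<phi>"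
proof -
  note D = form_operatorD[OF assms(1)]
  have f: "f \<in> L2 m" using D(1) by (rule form_domain_L2)
  have "0 \<le> energy_form \<mu> f f" by (simp add: energy_form_self energy_nonneg)
  also have "\<dots> = \<alpha> * (L2_inner m \<phi> f - L2_inner m f f)"
    unfolding D(3)[OF D(1)] V.inner_scale_left V.inner_diff_left[OF \<phi> f f] ..
  finally have "L2_inner m f f \<le> L2_inner m \<phi> f"
    using \<alpha> by (simp add: zero_le_mult_iff)
  also have "\<dots> \<le> L2_norm m \<phi> * L2_norm m f" by (rule V.inner_le_norm_mult[OF \<phi> f])
  finally have "L2_norm m f * L2_norm m f \<le> L2_norm m \<phi> * L2_norm m f"
    unfolding V.norm_square[symmetric] power2_eq_square .
  then show ?thesis
    using V.norm_nonneg[of f] V.norm_nonneg[of \<phi>] by (cases "L2_norm m f = 0") auto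
qed

lemma resolvent_equation_unique:
  assumes "form_operator m \<mu> f (\<lambda>x. \<alpha> * (\<phi> x - f x))" "form_operator m \<mu> g (\<lambda>x. \<alpha> * (\<phi> x - g x))"
  shows "f = g"
proof
  fix x
  have op: "form_operator m \<mu> (\<lambda>x. f x - g x) (\<lambda>x. \<alpha> * (0 - (f x - g x)))"
    using form_operator_diff[OF assms] by (simp add: algebra_simps)
  then have L2: "(\<lambda>x. f x - g x) \<in> L2 m" by (intro form_domain_L2 form_operatorD)
  have "sqrt (m x) * \<bar>f x - g x\<bar> \<le> 0"
    using V.point_le_norm[OF L2, of x] resolvent_equation_norm_le[OF op V.L2_zero] by (simp add: V.norm_zero)
  then show "f x = g x" using m_pos[of x] by (simp add: mult_le_0_iff)
qed

lemma resolvent_eqI: "form_operator m \<mu> f (\<lambda>x. \<alpha> * (\<phi> x - f x)) \<Longrightarrow> resolvent \<alpha> \<phi> = f"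
  unfolding resolvent_def using resolvent_equation_unique by blast

lemma iterate_tendsto_resolvent:
  assumes "\<And>x. 0 \<le> \<phi> x" "\<phi> \<in> L2 m"
  shows "(\<lambda>k. iterate \<alpha> \<phi> k x) \<longlonglongrightarrow> resolvent \<alpha> \<phi> x"
  by (rule iterate_converges[OF \<alpha> assms]) (auto dest: resolvent_eqI)

text \<open>
  For a function of arbitrary sign, the positive and the negative part are treated separately.
\<close>

lemma resolvent_operator:
  assumes \<phi>: "\<phi> \<in> L2 m"
  shows "form_operator m \<mu> (resolvent \<alpha> \<phi>) (\<lambda>x. \<alpha> * (\<phi> x - resolvent \<alpha> \<phi> x))"
proof -
  have "(\<lambda>x. max 0 (\<phi> x)) \<in> L2 m" "(\<lambda>x. max 0 (- \<phi> x)) \<in> L2 m"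
    by (rule V.L2_abs_le[OF \<phi>], simp)+
  then obtain f g where 
    "form_operator m \<mu> f (\<lambda>x. \<alpha> * (max 0 (\<phi> x) - f x))" "form_operator m \<mu> g (\<lambda>x. \<alpha> * (max 0 (- \<phi> x) - g x))"
    using iterate_converges[OF \<alpha>] by (metis max.cobounded1)
  from form_operator_diff[OF this]
  have "form_operator m \<mu> (\<lambda>x. f x - g x) (\<lambda>x. \<alpha> * (\<phi> x - (f x - g x)))"
    by (rule back_subst[of "form_operator m \<mu> (\<lambda>x. f x - g x)"]) (auto simp: max_def algebra_simps)
  then show ?thesis using resolvent_eqI by metis
qed

lemma resolvent_L2: "\<phi> \<in> L2 m \<Longrightarrow> resolvent \<alpha> \<phi> \<in> L2 m"
  using resolvent_operator form_operatorD(1) form_domain_L2 by blast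

lemma resolvent_norm_le: "\<phi> \<in> L2 m \<Longrightarrow> L2_norm m (resolvent \<alpha> \<phi>) \<le> L2_norm m \<phi>"
  using resolvent_operator resolvent_equation_norm_le by blast

lemma resolvent_diff:
  assumes "\<phi> \<in> L2 m" "\<psi> \<in> L2 m"
  shows "resolvent \<alpha> (\<lambda>x. \<phi> x - \<psi> x) = (\<lambda>x. resolvent \<alpha> \<phi> x - resolvent \<alpha> \<psi> x)"
  using form_operator_diff[OF assms[THEN resolvent_operator]]
  by (intro resolvent_eqI) (simp add: algebra_simps)

lemma resolvent_nonneg:
  assumes "\<phi> \<in> L2 m" "\<And>x. 0 \<le> \<phi> x"
  shows "0 \<le> resolvent \<alpha> \<phi> x"
  using iterate_nonneg[OF \<alpha> assms(2)]
  by (intro LIMSEQ_le_const[OF iterate_tendsto_resolvent[OF assms(2,1)]]) auto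

lemma resolvent_le_1:
  assumes "\<phi> \<in> L2 m" "\<And>x. 0 \<le> \<phi> x" "\<And>x. \<phi> x \<le> 1"
  shows "resolvent \<alpha> \<phi> x \<le> 1"
  using iterate_le_1[OF \<alpha> assms(3)]
  by (intro LIMSEQ_le_const2[OF iterate_tendsto_resolvent[OF assms(2,1)]]) auto

text \<open>
  With \<open>f\<close> the resolvent of \<open>g\<close>, testing the equation of \<open>f\<close> with \<open>f - g\<close> gives
  \<open>\<alpha> \<parallel>f - g\<parallel>\<^sup>2 = Q(f, g) - Q(f, f)\<close>; completing the square bounds the right-hand side by \<open>Q(g, g) / 4\<close>.
\<close>

lemma resolvent_finitely_supported_near:
  assumes g: "g \<in> finitely_supported"
  shows "(L2_norm m (\<lambda>x. resolvent \<alpha> g x - g x))\<^sup>2 \<le> energy \<mu> g / (4 * \<alpha>)"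
proof -
  let ?f = "resolvent \<alpha> g"
  note gD = finitely_supported_in_form_domain[OF g]
  note D = form_operatorD[OF resolvent_operator[OF form_domain_L2[OF gD]]]
  note L2 = form_domain_L2[OF gD] form_domain_L2[OF D(1)]
  note grad_L2 = form_domain_grad[OF gD] form_domain_grad[OF D(1)]
  have "energy_form \<mu> ?f (\<lambda>x. ?f x - g x) = L2_inner m (\<lambda>x. \<alpha> * (g x - ?f x)) (\<lambda>x. ?f x - g x)"
    by (intro D(3) form_domain_diff D(1) gD)
  also have "\<dots> = - \<alpha> * L2_inner m (\<lambda>x. ?f x - g x) (\<lambda>x. ?f x - g x)"
    unfolding V.inner_scale_left[symmetric] by (simp add: algebra_simps)
  finally have 1: "energy_form \<mu> ?f (\<lambda>x. ?f x - g x) = - \<alpha> * (L2_norm m (\<lambda>x. ?f x - g x))\<^sup>2"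
    by (simp add: V.norm_square)
  have 2: "energy_form \<mu> ?f (\<lambda>x. ?f x - g x) = energy \<mu> ?f - energy_form \<mu> ?f g"
    unfolding energy_form_self[symmetric]
    by (simp add: energy_form_def grad_diff E.inner_diff_right grad_L2)
  have "0 \<le> energy \<mu> (\<lambda>x. ?f x - 1 / 2 * g x)" by (rule energy_nonneg)
  also have "\<dots> = energy \<mu> ?f - energy_form \<mu> ?f g + energy \<mu> g / 4"
    unfolding energy_diff E.norm_square grad_scale E.norm_square_diff[OF grad_L2(2) E.L2_scale[OF grad_L2(1)]]
      energy_form_self[symmetric] energy_form_def E.inner_scale_left E.inner_scale_right
    by simp
  finally have "\<alpha> * (L2_norm m (\<lambda>x. ?f x - g x))\<^sup>2 \<le> energy \<mu> g / 4"
    using 1 2 by linarith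
  then show ?thesis using \<alpha> by (simp add: field_simps)
qed

end

lemma finitely_supported_dense:
  assumes g: "g \<in> L2 m" and e: "e > 0"
  obtains h where "h \<in> finitely_supported" "L2_norm m (\<lambda>x. h x - g x) < e"
proof -
  define h where "h n x = (if x \<in> exhaustion n then g x else 0)" for n x
  have "(\<lambda>n. L2_norm m (\<lambda>x. h n x - g x)) \<longlonglongrightarrow> 0"
  proof (rule V.norm_dominated)
    show "(\<lambda>x. \<bar>g x\<bar>) \<in> L2 m" using g by (rule V.L2_abs_le) simp
    show "\<bar>h n x - g x\<bar> \<le> \<bar>g x\<bar>" for n x by (simp add: h_def)
    show "(\<lambda>n. h n x) \<longlonglongrightarrow> g x" for x
      by (rule tendsto_eventually, rule eventually_mono[OF eventually_in_exhaustion[of x]]) (simp add: h_def)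
  qed
  then have "\<forall>\<^sub>F n in sequentially. L2_norm m (\<lambda>x. h n x - g x) < e"
    using e by (rule order_tendstoD)
  then obtain n where "L2_norm m (\<lambda>x. h n x - g x) < e" by (auto simp: eventually_sequentially)
  moreover have "h n \<in> finitely_supported"
    unfolding finitely_supported_def mem_Collect_eq
    by (intro finite_subset[OF _ finite_exhaustion[of n]]) (auto simp: h_def)
  ultimately show ?thesis by (rule that[rotated])
qed

lemma resolvent_tendsto_identity:
  assumes g: "g \<in> L2 m"
  shows "((\<lambda>\<alpha>. L2_norm m (\<lambda>x. resolvent \<alpha> g x - g x)) \<longlongrightarrow> 0) at_top"
proof (rule tendstoI)
  fix e :: real assume e: "e > 0"
  then obtain h where h: "h \<in> finitely_supported" "L2_norm m (\<lambda>x. h x - g x) < e / 3"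
    using finitely_supported_dense[OF g, of "e / 3"] by auto
  note hL2 = finitely_supported_in_L2[OF h(1)]
  have "((\<lambda>\<alpha>. sqrt (energy \<mu> h / (4 * \<alpha>))) \<longlongrightarrow> sqrt 0) at_top"
    by (intro tendsto_real_sqrt tendsto_divide_0[OF tendsto_const] filterlim_at_top_imp_at_infinity
        filterlim_tendsto_pos_mult_at_top[OF tendsto_const _ filterlim_ident]) auto
  then have "\<forall>\<^sub>F \<alpha> in at_top. sqrt (energy \<mu> h / (4 * \<alpha>)) < e / 3"
    using e by (intro order_tendstoD(2)) auto
  then show "\<forall>\<^sub>F \<alpha> in at_top. dist (L2_norm m (\<lambda>x. resolvent \<alpha> g x - g x)) 0 < e"
    using eventually_gt_at_top[of 0]
  proof eventually_elim
    case (elim \<alpha>)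
    note R = resolvent_L2[OF elim(2)]
    have "L2_norm m (\<lambda>x. resolvent \<alpha> g x - resolvent \<alpha> h x) \<le> L2_norm m (\<lambda>x. g x - h x)"
      using resolvent_norm_le[OF elim(2) V.L2_diff[OF g hL2]] by (simp add: resolvent_diff[OF elim(2) g hL2])
    moreover have "L2_norm m (\<lambda>x. resolvent \<alpha> h x - h x) \<le> sqrt (energy \<mu> h / (4 * \<alpha>))"
      by (rule real_le_rsqrt[OF resolvent_finitely_supported_near[OF elim(2) h(1)]])
    moreover have "L2_norm m (\<lambda>x. resolvent \<alpha> g x - g x) \<le> L2_norm m (\<lambda>x. resolvent \<alpha> g x - resolvent \<alpha> h x)
        + (L2_norm m (\<lambda>x. resolvent \<alpha> h x - h x) + L2_norm m (\<lambda>x. h x - g x))"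
      using V.norm_triangle_diff[OF R[OF g] R[OF hL2] g] V.norm_triangle_diff[OF R[OF hL2] hL2 g] by linarith
    ultimately have "L2_norm m (\<lambda>x. resolvent \<alpha> g x - g x) < e"
      using elim(1) h(2) V.norm_minus_commute[of h g] by linarith
    then show ?case by (simp add: V.norm_nonneg)
  qed
qed

end


section \<open>Uniform boundedness\<close>

context weight
begin

lemma operator_add: "L2_bounded_operator w T \<Longrightarrow> f \<in> L2 w \<Longrightarrow> g \<in> L2 w \<Longrightarrow> T (\<lambda>x. f x + g x) = (\<lambda>x. T f x + T g x)"
  and operator_scale: "L2_bounded_operator w T \<Longrightarrow> f \<in> L2 w \<Longrightarrow> T (\<lambda>x. c * f x) = (\<lambda>x. c * T f x)"
  and operator_L2: "L2_bounded_operator w T \<Longrightarrow> f \<in> L2 w \<Longrightarrow> T f \<in> L2 w"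
  by (auto simp: L2_bounded_operator_def)

lemma operator_diff:
  assumes "L2_bounded_operator w T" "f \<in> L2 w" "g \<in> L2 w"
  shows "T (\<lambda>x. f x - g x) = (\<lambda>x. T f x - T g x)"
  using operator_add[OF assms(1,2) L2_scale[OF assms(3), of "-1"]] operator_scale[OF assms(1,3), of "-1"] by simp

lemma operator_bound:
  assumes "L2_bounded_operator w T"
  obtains C where "C \<ge> 0" "\<And>f. f \<in> L2 w \<Longrightarrow> L2_norm w (T f) \<le> C * L2_norm w f"
proof -
  obtain C where C: "\<And>f. f \<in> L2 w \<Longrightarrow> L2_norm w (T f) \<le> C * L2_norm w f"
    using assms unfolding L2_bounded_operator_def by blast
  have "L2_norm w (T f) \<le> \<bar>C\<bar> * L2_norm w f" if "f \<in> L2 w" for f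
    using C[OF that] mult_right_mono[OF abs_ge_self[of C] norm_nonneg[of f]] by linarith
  then show ?thesis using that[of "\<bar>C\<bar>"] by simp
qed

text \<open>
  Here \<open>B\<close> is the operator norm.
\<close>

lemma operator_almost_norming:
  assumes T: "L2_bounded_operator w T" and C: "C > 0" and "\<exists>f\<in>L2 w. L2_norm w (T f) > C * L2_norm w f"
  obtains B g where "B \<ge> C" "\<And>f. f \<in> L2 w \<Longrightarrow> L2_norm w (T f) \<le> B * L2_norm w f"
    "g \<in> L2 w" "L2_norm w g \<le> 1" "L2_norm w (T g) \<ge> 3 / 4 * B"
proof -
  define A where "A = (\<lambda>f. L2_norm w (T f)) ` {f \<in> L2 w. L2_norm w f \<le> 1}"
  obtain K where K: "K \<ge> 0" "\<And>f. f \<in> L2 w \<Longrightarrow> L2_norm w (T f) \<le> K * L2_norm w f"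
    using operator_bound[OF T] by blast
  have bdd: "bdd_above A"
    unfolding A_def using K mult_left_le[of _ K] by (intro bdd_aboveI2[of _ _ K]) fastforce
  define B where "B = Sup A"
  have le: "L2_norm w (T f) \<le> B * L2_norm w f" if f: "f \<in> L2 w" for f
  proof (cases "L2_norm w f = 0")
    case True
    then show ?thesis using K(2)[OF f] by simp
  next
    case False
    then have pos: "L2_norm w f > 0" using norm_nonneg[of f] by simp
    let ?g = "\<lambda>x. (1 / L2_norm w f) * f x"
    have "?g \<in> L2 w" by (rule L2_scale[OF f])
    moreover have "L2_norm w ?g \<le> 1" unfolding norm_scale using pos by simp
    ultimately have "L2_norm w (T ?g) \<in> A" unfolding A_def by blast
    then have "L2_norm w (T ?g) \<le> B" unfolding B_def by (rule cSup_upper[OF _ bdd])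
    then show ?thesis
      unfolding operator_scale[OF T f] norm_scale using pos by (simp add: pos_divide_le_eq)
  qed
  obtain f where f: "f \<in> L2 w" "L2_norm w (T f) > C * L2_norm w f" using assms(3) by blast
  have "C \<le> B"
  proof (rule ccontr)
    assume "\<not> C \<le> B"
    then have "B * L2_norm w f \<le> C * L2_norm w f" by (intro mult_right_mono norm_nonneg) simp
    with le[OF f(1)] f(2) show False by simp
  qed
  with C have "3 / 4 * B < Sup A" by (simp add: B_def)
  moreover have "A \<noteq> {}" using L2_zero norm_zero by (auto simp: A_def intro!: exI[of _ "\<lambda>x. 0"])
  ultimately obtain a where "a \<in> A" "3 / 4 * B < a" using less_cSup_iff[OF _ bdd] by blast
  then obtain g where "g \<in> L2 w" "L2_norm w g \<le> 1" "3 / 4 * B \<le> L2_norm w (T g)"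
    by (auto simp: A_def)
  with \<open>C \<le> B\<close> le show ?thesis by (rule that)
qed

text \<open>
  The Banach--Steinhaus theorem, by a gliding hump. If the norms are unbounded, choose operators \<open>S\<^sub>k\<close> of norm
  \<open>B\<^sub>k \<ge> 4\<^sup>k\<close> and almost norming vectors \<open>g\<^sub>k\<close> in the unit ball, and add up \<open>\<plusminus> 3\<^sup>-\<^sup>k g\<^sub>k\<close>. The sign is chosen such that
  \<open>S\<^sub>k\<close> is at least \<open>3 / 4 * 3\<^sup>-\<^sup>k B\<^sub>k\<close> on the new partial sum, while the remaining terms have total norm at most \<open>1 / 2 * 3\<^sup>-\<^sup>k\<close>. Hence
  \<open>S\<^sub>k\<close> is at least \<open>1 / 4 * (4 / 3)\<^sup>k\<close> on the limit.
\<close>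

lemma uniform_boundedness:
  fixes T :: "nat \<Rightarrow> ('a \<Rightarrow> real) \<Rightarrow> 'a \<Rightarrow> real"
  assumes pos: "\<And>x. w x > 0" and T: "\<And>n. L2_bounded_operator w (T n)"
    and pointwise: "\<And>f. f \<in> L2 w \<Longrightarrow> \<exists>C. \<forall>n. L2_norm w (T n f) \<le> C"
  shows "\<exists>C. \<forall>n. \<forall>f\<in>L2 w. L2_norm w (T n f) \<le> C * L2_norm w f"
proof (rule ccontr)
  assume "\<not> ?thesis"
  then have unbdd: "\<exists>n. \<exists>f\<in>L2 w. L2_norm w (T n f) > C * L2_norm w f" for C
    by (metis not_le)
  have "\<exists>n B g. B \<ge> 4 ^ k \<and> (\<forall>f\<in>L2 w. L2_norm w (T n f) \<le> B * L2_norm w f) \<and>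
      g \<in> L2 w \<and> L2_norm w g \<le> 1 \<and> L2_norm w (T n g) \<ge> 3 / 4 * B" for k :: nat
  proof -
    obtain n where n: "\<exists>f\<in>L2 w. L2_norm w (T n f) > 4 ^ k * L2_norm w f" using unbdd by blast
    show ?thesis
      by (rule operator_almost_norming[OF T _ n]) (simp, blast)
  qed
  then obtain N B g where B: "\<And>k. B k \<ge> (4::real) ^ k"
    and bound: "\<And>k f. f \<in> L2 w \<Longrightarrow> L2_norm w (T (N k) f) \<le> B k * L2_norm w f"
    and g: "\<And>k. g k \<in> L2 w" "\<And>k. L2_norm w (g k) \<le> 1" "\<And>k. L2_norm w (T (N k) (g k)) \<ge> 3 / 4 * B k"
    by metis
  define S where "S k = T (N k)" for k
  have S: "L2_bounded_operator w (S k)" for k by (simp add: S_def T)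
  define c where "c k = (1 / 3 :: real) ^ k" for k
  have c_pos: "c k > 0" for k by (simp add: c_def)
  define step where "step k x = (if L2_norm w (S k (\<lambda>v. x v + c k * g k v)) \<ge> L2_norm w (S k (\<lambda>v. c k * g k v)) then c k else - c k)" for k x
  define x where "x = rec_nat (\<lambda>v. 0) (\<lambda>k xk v. xk v + step k xk * g k v)"
  have x_Suc: "x (Suc k) = (\<lambda>v. x k v + step k (x k) * g k v)" and x_0: "x 0 = (\<lambda>v. 0)" for k
    by (simp_all add: x_def)
  have xL2: "x k \<in> L2 w" for k
    by (induction k) (simp_all add: x_0 x_Suc L2_zero L2_add L2_scale g)
  have abs_step: "\<bar>step k y\<bar> = c k" for k y
    using c_pos[of k] by (simp add: step_def)
  have hump: "L2_norm w (S k (x (Suc k))) \<ge> c k * (3 / 4 * B k)" for k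
  proof -
    let ?a = "\<lambda>v. c k * g k v"
    have aL2: "?a \<in> L2 w" by (intro L2_scale g)
    have Sa: "L2_norm w (S k ?a) \<ge> c k * (3 / 4 * B k)"
      unfolding operator_scale[OF S g(1)] norm_scale using g(3)[of k] c_pos[of k] by (simp add: S_def)
    show ?thesis
    proof (cases "L2_norm w (S k (\<lambda>v. x k v + ?a v)) \<ge> L2_norm w (S k ?a)")
      case True
      then show ?thesis using Sa by (simp add: x_Suc step_def)
    next
      case False
      then have eq: "x (Suc k) = (\<lambda>v. x k v - ?a v)" by (simp add: x_Suc step_def)
      have "2 * L2_norm w (S k ?a) = L2_norm w (\<lambda>v. S k (\<lambda>v. x k v + ?a v) v - S k (\<lambda>v. x k v - ?a v) v)"
        using norm_scale[of 2 "S k ?a"]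
        by (simp add: operator_add[OF S xL2 aL2] operator_diff[OF S xL2 aL2])
      also have "\<dots> \<le> L2_norm w (S k (\<lambda>v. x k v + ?a v)) + L2_norm w (S k (\<lambda>v. x k v - ?a v))"
        using norm_triangle[OF operator_L2[OF S L2_add[OF xL2 aL2]] L2_uminus[OF operator_L2[OF S L2_diff[OF xL2 aL2]]]]
        by (simp add: norm_uminus)
      finally show ?thesis using False Sa unfolding eq by linarith
    qed
  qed
  have dist: "L2_norm w (\<lambda>v. x (k + n) v - x k v) \<le> 3 / 2 * (c k - c (k + n))" for k n
  proof (induction n)
    case (Suc n)
    have "L2_norm w (\<lambda>v. x (k + Suc n) v - x k v)
        \<le> L2_norm w (\<lambda>v. x (k + Suc n) v - x (k + n) v) + L2_norm w (\<lambda>v. x (k + n) v - x k v)"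
      by (rule norm_triangle_diff[OF xL2 xL2 xL2])
    also have "L2_norm w (\<lambda>v. x (k + Suc n) v - x (k + n) v) \<le> c (k + n)"
      using g(2)[of "k + n"] c_pos[of "k + n"] by (simp add: x_Suc norm_scale abs_step mult_left_le)
    also have "c (k + n) + L2_norm w (\<lambda>v. x (k + n) v - x k v) \<le> 3 / 2 * (c k - c (k + Suc n))"
      using Suc by (simp add: c_def)
    finally show ?case by simp
  qed (simp add: norm_zero)
  have c_lim: "c \<longlonglongrightarrow> 0" unfolding c_def by (rule LIMSEQ_power_zero) simp
  have "Cauchy_norm x"
  proof (rule Cauchy_normI[OF xL2])
    fix e :: real assume "e > 0"
    then have "\<forall>\<^sub>F k in sequentially. c k < e / 2"
      using c_lim by (intro order_tendstoD(2)[OF c_lim]) simp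
    then obtain k where k: "c k < e / 2" by (auto simp: eventually_sequentially)
    have "L2_norm w (\<lambda>v. x n v - x k v) < e" if "n \<ge> k" for n
      using dist[of k "n - k"] that k c_pos[of n] \<open>e > 0\<close> by simp
    then show "\<exists>g\<in>L2 w. \<forall>\<^sub>F n in sequentially. L2_norm w (\<lambda>v. x n v - g v) < e"
      by (intro bexI[of _ "x k"] xL2 eventually_sequentiallyI)
  qed
  then obtain y where y: "y \<in> L2 w" "(\<lambda>n. L2_norm w (\<lambda>v. x n v - y v)) \<longlonglongrightarrow> 0"
    using Cauchy_norm_imp_limit[where f=x, OF pos xL2] by blast
  \<comment> \<open>the geometric series with first term \<open>c k\<close> and ratio \<open>1 / 3\<close> has the sum \<open>3 / 2 * c k\<close>\<close>
  have y_dist: "L2_norm w (\<lambda>v. x k v - y v) \<le> 3 / 2 * c k" for k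
  proof (rule LIMSEQ_le_const)
    show "(\<lambda>n. 3 / 2 * c k + L2_norm w (\<lambda>v. x n v - y v)) \<longlonglongrightarrow> 3 / 2 * c k"
      using tendsto_add[OF tendsto_const y(2), of "3 / 2 * c k"] by simp
    have "L2_norm w (\<lambda>v. x k v - y v) \<le> 3 / 2 * c k + L2_norm w (\<lambda>v. x n v - y v)" if "n \<ge> k" for n
      using dist[of k "n - k"] that c_pos[of n] norm_triangle_diff[OF xL2[of k] xL2[of n] y(1)]
        norm_minus_commute[of "x n" "x k"] by simp
    then show "\<exists>N. \<forall>n\<ge>N. L2_norm w (\<lambda>v. x k v - y v) \<le> 3 / 2 * c k + L2_norm w (\<lambda>v. x n v - y v)"
      by blast
  qed
  have large: "L2_norm w (S k y) \<ge> 1 / 4 * (4 / 3) ^ k" for k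
  proof -
    have Bk: "B k > 0" using less_le_trans[OF _ B[of k]] by simp
    have "L2_norm w (S k (x (Suc k))) \<le> L2_norm w (S k y) + L2_norm w (\<lambda>v. S k (x (Suc k)) v - S k y v)"
      by (intro norm_le_add operator_L2[OF S] xL2 y)
    also have "L2_norm w (\<lambda>v. S k (x (Suc k)) v - S k y v) \<le> B k * L2_norm w (\<lambda>v. x (Suc k) v - y v)"
      using bound[OF L2_diff[OF xL2 y(1)], of k "Suc k"] operator_diff[OF S xL2 y(1)] by (simp add: S_def)
    also have "\<dots> \<le> B k * (3 / 2 * c (Suc k))"
      using Bk y_dist by (intro mult_left_mono) auto
    finally have "c k * (3 / 4 * B k) \<le> L2_norm w (S k y) + B k * (3 / 2 * c (Suc k))"
      using hump[of k] by linarith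
    then have "1 / 4 * (c k * B k) \<le> L2_norm w (S k y)" by (simp add: c_def mult.commute)
    moreover have "(4 / 3) ^ k \<le> c k * B k"
      using mult_left_mono[OF B[of k], of "c k"] c_pos[of k] by (simp add: c_def power_divide)
    ultimately show ?thesis by linarith
  qed
  obtain C where C: "\<And>n. L2_norm w (T n y) \<le> C" using pointwise[OF y(1)] by blast
  obtain k where "4 * C < (4 / 3) ^ k" using real_arch_pow[of "4/3" "4 * C"] by auto
  with large[of k] C[of "N k"] show False by (simp add: S_def)
qed

end

section \<open>The heat semigroup is Markovian\<close>

locale heat = graph +
  fixes P :: "real \<Rightarrow> ('a \<Rightarrow> real) \<Rightarrow> 'a \<Rightarrow> real"
  assumes heat_semigroup: "heat_semigroup m \<mu> P"
begin

lemma P_operator: "t \<ge> 0 \<Longrightarrow> L2_bounded_operator m (P t)"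
  and P_0: "f \<in> L2 m \<Longrightarrow> P 0 f = f"
  and P_plus: "s \<ge> 0 \<Longrightarrow> t \<ge> 0 \<Longrightarrow> f \<in> L2 m \<Longrightarrow> P (s + t) f = P s (P t f)"
  and P_tendsto_identity: "f \<in> L2 m \<Longrightarrow> ((\<lambda>t. L2_norm m (\<lambda>x. P t f x - f x)) \<longlongrightarrow> 0) (at_right 0)"
  and generator_iff: "generator m P f g \<longleftrightarrow> form_operator m \<mu> f (\<lambda>x. - g x)"
  using heat_semigroup by (auto simp: heat_semigroup_def C0_semigroup_def)

lemma P_L2: "t \<ge> 0 \<Longrightarrow> f \<in> L2 m \<Longrightarrow> P t f \<in> L2 m"
  using P_operator V.operator_L2 by blast

lemma P_diff: "t \<ge> 0 \<Longrightarrow> f \<in> L2 m \<Longrightarrow> g \<in> L2 m \<Longrightarrow> P t (\<lambda>x. f x - g x) = (\<lambda>x. P t f x - P t g x)"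
  using P_operator V.operator_diff by blast

lemma P_add: "t \<ge> 0 \<Longrightarrow> f \<in> L2 m \<Longrightarrow> g \<in> L2 m \<Longrightarrow> P t (\<lambda>x. f x + g x) = (\<lambda>x. P t f x + P t g x)"
  using P_operator V.operator_add by blast

lemma P_scale: "t \<ge> 0 \<Longrightarrow> f \<in> L2 m \<Longrightarrow> P t (\<lambda>x. c * f x) = (\<lambda>x. c * P t f x)"
  using P_operator V.operator_scale by blast

lemma P_commute: "s \<ge> 0 \<Longrightarrow> t \<ge> 0 \<Longrightarrow> f \<in> L2 m \<Longrightarrow> P s (P t f) = P t (P s f)"
  using P_plus by (metis add.commute)

text \<open>
  Along any sequence of times tending to \<open>0\<close> the semigroup is pointwise bounded by strong continuity, so
  an unbounded such sequence of operators would contradict the uniform boundedness principle.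
\<close>

lemma P_bounded_near_0:
  obtains \<delta> M where "\<delta> > 0" "M \<ge> 1" "\<And>t f. 0 \<le> t \<Longrightarrow> t \<le> \<delta> \<Longrightarrow> f \<in> L2 m \<Longrightarrow> L2_norm m (P t f) \<le> M * L2_norm m f"
proof -
  have "\<exists>n. \<forall>t. 0 < t \<and> t \<le> 1 / real (Suc n) \<longrightarrow> (\<forall>f\<in>L2 m. L2_norm m (P t f) \<le> real n * L2_norm m f)"
  proof (rule ccontr)
    assume "\<not> ?thesis"
    then have "\<forall>n. \<exists>t. 0 < t \<and> t \<le> 1 / real (Suc n) \<and> (\<exists>f\<in>L2 m. L2_norm m (P t f) > real n * L2_norm m f)"
      by (metis not_le)
    then obtain t where t: "\<And>n. 0 < t n" "\<And>n. t n \<le> 1 / real (Suc n)"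
      and ex: "\<And>n. \<exists>f\<in>L2 m. L2_norm m (P (t n) f) > real n * L2_norm m f"
      by metis
    have "(\<lambda>n. 1 / real (Suc n)) \<longlonglongrightarrow> 0"
      using LIMSEQ_inverse_real_of_nat by (simp add: inverse_eq_divide)
    then have "t \<longlonglongrightarrow> 0"
      by (rule tendsto_sandwich[rotated -1]) (use t in \<open>auto intro!: always_eventually less_imp_le\<close>)
    then have t0: "filterlim t (at_right 0) sequentially"
      using t(1) less_imp_neq[OF t(1), symmetric] by (simp add: filterlim_at)
    have "\<exists>C. \<forall>n. L2_norm m (P (t n) f) \<le> C" if f: "f \<in> L2 m" for f
    proof -
      have "(\<lambda>n. L2_norm m (\<lambda>x. P (t n) f x - f x)) \<longlonglongrightarrow> 0"
        by (rule filterlim_compose[OF P_tendsto_identity[OF f] t0])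
      then have "Bseq (\<lambda>n. L2_norm m (\<lambda>x. P (t n) f x - f x))"
        by (intro convergent_imp_Bseq convergentI)
      then obtain K where K: "\<And>n. L2_norm m (\<lambda>x. P (t n) f x - f x) \<le> K"
        by (auto simp: Bseq_def V.norm_nonneg)
      have "L2_norm m (P (t n) f) \<le> L2_norm m f + K" for n
        using V.norm_le_add[OF P_L2[OF _ f] f, of "t n"] K[of n] t(1)[of n] by simp
      then show ?thesis by blast
    qed
    then obtain C where C: "\<And>n f. f \<in> L2 m \<Longrightarrow> L2_norm m (P (t n) f) \<le> C * L2_norm m f"
      using V.uniform_boundedness[OF m_pos, of "\<lambda>n. P (t n)"] P_operator t(1) by (metis less_imp_le)
    obtain n where n: "C \<le> real n" using real_arch_simple by blast
    obtain f where "f \<in> L2 m" "L2_norm m (P (t n) f) > real n * L2_norm m f" using ex by blast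
    with C[of f n] mult_right_mono[OF n V.norm_nonneg[of f]] show False by simp
  qed
  then obtain n where n: "\<And>t f. 0 < t \<Longrightarrow> t \<le> 1 / real (Suc n) \<Longrightarrow> f \<in> L2 m \<Longrightarrow> L2_norm m (P t f) \<le> real n * L2_norm m f"
    by blast
  have "L2_norm m (P t f) \<le> real (Suc n) * L2_norm m f" if "0 \<le> t" "t \<le> 1 / real (Suc n)" "f \<in> L2 m" for t f
  proof (cases "t = 0")
    case True
    then show ?thesis using P_0[OF that(3)] V.norm_nonneg[of f] by (simp add: algebra_simps)
  next
    case False
    then show ?thesis using n[OF _ that(2,3)] that(1) V.norm_nonneg[of f] by (simp add: algebra_simps)
  qed
  then show ?thesis by (intro that[of "1 / real (Suc n)" "real (Suc n)"]) auto
qed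

lemma P_locally_bounded:
  obtains M where "M > 0" "\<And>t f. 0 \<le> t \<Longrightarrow> t \<le> T \<Longrightarrow> f \<in> L2 m \<Longrightarrow> L2_norm m (P t f) \<le> M * L2_norm m f"
proof -
  obtain \<delta> M where \<delta>: "\<delta> > 0" "M \<ge> 1"
    and M: "\<And>t f. 0 \<le> t \<Longrightarrow> t \<le> \<delta> \<Longrightarrow> f \<in> L2 m \<Longrightarrow> L2_norm m (P t f) \<le> M * L2_norm m f"
    using P_bounded_near_0 by blast
  have *: "0 \<le> t \<Longrightarrow> t \<le> real k * \<delta> \<Longrightarrow> f \<in> L2 m \<Longrightarrow> L2_norm m (P t f) \<le> M ^ k * L2_norm m f" for k t f
  proof (induction k arbitrary: t)
    case 0
    then show ?case by (simp add: P_0)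
  next
    case (Suc k)
    show ?case
    proof (cases "t \<le> \<delta>")
      case True
      have "M * 1 \<le> M * M ^ k" using \<delta>(2) by (intro mult_left_mono one_le_power) auto
      then have "M * L2_norm m f \<le> M ^ Suc k * L2_norm m f" by (intro mult_right_mono V.norm_nonneg) simp
      then show ?thesis using M[OF Suc.prems(1) True Suc.prems(3)] by linarith
    next
      case False
      then have "L2_norm m (P (\<delta> + (t - \<delta>)) f) \<le> M * L2_norm m (P (t - \<delta>) f)"
        using \<delta> by (subst P_plus) (auto intro!: M P_L2 Suc.prems)
      also have "\<dots> \<le> M * (M ^ k * L2_norm m f)"
        using False \<delta> Suc.prems by (intro mult_left_mono Suc.IH) (auto simp: algebra_simps)
      finally show ?thesis by (simp add: mult.assoc)
    qed
  qed
  obtain k :: nat where "T \<le> real k * \<delta>"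
    using real_arch_simple[of "T / \<delta>"] \<delta>(1) by (auto simp: pos_divide_le_eq)
  then have "0 \<le> t \<Longrightarrow> t \<le> T \<Longrightarrow> f \<in> L2 m \<Longrightarrow> L2_norm m (P t f) \<le> M ^ k * L2_norm m f" for t f
    using *[of t k f] by simp
  then show ?thesis using \<delta>(2) by (intro that[of "M ^ k"]) auto
qed

lemma generator_tendsto:
  assumes "form_operator m \<mu> f g"
  shows "((\<lambda>t. L2_norm m (\<lambda>x. (P t f x - f x) / t + g x)) \<longlongrightarrow> 0) (at_right 0)"
  using generator_iff[of f "\<lambda>x. - g x"] assms by (simp add: generator_def)

text \<open>
  A semigroup commutes with its generator.
\<close>

lemma form_operator_P:
  assumes op: "form_operator m \<mu> f g" and s: "s \<ge> 0"
  shows "form_operator m \<mu> (P s f) (P s g)"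
proof -
  have f: "f \<in> L2 m" and g: "g \<in> L2 m"
    using form_operatorD[OF op] form_domain_L2 by auto
  note Pf = P_L2[OF s f] and Pg = P_L2[OF s g]
  obtain C where C: "C \<ge> 0" "\<And>h. h \<in> L2 m \<Longrightarrow> L2_norm m (P s h) \<le> C * L2_norm m h"
    using V.operator_bound[OF P_operator[OF s]] by blast
  have "((\<lambda>t. L2_norm m (\<lambda>x. (P t (P s f) x - P s f x) / t + P s g x)) \<longlongrightarrow> 0) (at_right 0)"
  proof (rule Lim_null_comparison)
    show "((\<lambda>t. C * L2_norm m (\<lambda>x. (P t f x - f x) / t + g x)) \<longlongrightarrow> 0) (at_right 0)"
      by (intro tendsto_mult_right_zero generator_tendsto op)
    have "\<forall>\<^sub>F t in at_right (0::real). t > 0" by (auto simp: eventually_at_right_less)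
    then show "\<forall>\<^sub>F t in at_right 0. norm (L2_norm m (\<lambda>x. (P t (P s f) x - P s f x) / t + P s g x))
        \<le> C * L2_norm m (\<lambda>x. (P t f x - f x) / t + g x)"
    proof eventually_elim
      case (elim t)
      note Ptf = P_L2[OF less_imp_le[OF elim] f]
      have dL2: "(\<lambda>x. 1 / t * (P t f x - f x)) \<in> L2 m" by (intro V.L2_scale V.L2_diff Ptf f)
      have "(\<lambda>x. (P t (P s f) x - P s f x) / t + P s g x) = P s (\<lambda>x. 1 / t * (P t f x - f x) + g x)"
        unfolding P_add[OF s dL2 g] P_scale[OF s V.L2_diff[OF Ptf f]] P_diff[OF s Ptf f]
        using P_commute[OF s less_imp_le[OF elim] f] by simp
      then show ?case
        using C(2)[OF V.L2_add[OF dL2 g]] by (simp add: V.norm_nonneg)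
    qed
  qed
  then have "generator m P (P s f) (\<lambda>x. - P s g x)"
    using Pf V.L2_uminus[OF Pg] by (simp add: generator_def)
  then show ?thesis by (simp add: generator_iff)
qed

lemma resolvent_P_commute:
  assumes \<alpha>: "\<alpha> > 0" and s: "s \<ge> 0" and f: "f \<in> L2 m"
  shows "resolvent \<alpha> (P s f) = P s (resolvent \<alpha> f)"
proof (rule resolvent_eqI[OF \<alpha>])
  have "form_operator m \<mu> (P s (resolvent \<alpha> f)) (P s (\<lambda>x. \<alpha> * (f x - resolvent \<alpha> f x)))"
    by (rule form_operator_P[OF resolvent_operator[OF \<alpha> f] s])
  then show "form_operator m \<mu> (P s (resolvent \<alpha> f)) (\<lambda>x. \<alpha> * (P s f x - P s (resolvent \<alpha> f) x))"
    using resolvent_L2[OF \<alpha> f] by (simp add: P_scale P_diff V.L2_diff s f)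
qed

text \<open>
  The resolvent \<open>V = \<alpha> (L + \<alpha>)\<^sup>-\<^sup>1\<close> satisfies \<open>\<alpha> (V f - f) = - V (L f)\<close> on the domain of \<open>L\<close>. With
  \<open>\<alpha> = 1 / h\<close> its difference quotient has therefore the same limit \<open>- L f\<close> as that of the semigroup.
\<close>

lemma resolvent_tendsto_generator:
  assumes op: "form_operator m \<mu> f g"
  shows "((\<lambda>h. L2_norm m (\<lambda>x. (resolvent (1 / h) f x - f x) / h + g x)) \<longlongrightarrow> 0) (at_right 0)"
proof -
  have f: "f \<in> L2 m" and g: "g \<in> L2 m"
    using form_operatorD[OF op] form_domain_L2 by auto
  have "((\<lambda>h. L2_norm m (\<lambda>x. resolvent (inverse h) g x - g x)) \<longlongrightarrow> 0) (at_right 0)"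
    by (rule filterlim_compose[OF resolvent_tendsto_identity[OF g] filterlim_inverse_at_top_right])
  then show ?thesis
  proof (rule Lim_transform_eventually)
    have "\<forall>\<^sub>F t in at_right (0::real). t > 0" by (auto simp: eventually_at_right_less)
    then show "\<forall>\<^sub>F h in at_right 0. L2_norm m (\<lambda>x. resolvent (inverse h) g x - g x)
        = L2_norm m (\<lambda>x. (resolvent (1 / h) f x - f x) / h + g x)"
    proof eventually_elim
      case (elim h)
      then have \<alpha>: "1 / h > 0" by simp
      let ?v = "resolvent (1 / h) g"
      have "form_operator m \<mu> (\<lambda>x. f x - h * ?v x) (\<lambda>x. g x - h * (1 / h * (g x - ?v x)))"
        by (intro form_operator_diff form_operator_scale op resolvent_operator \<alpha> g)
      then have "form_operator m \<mu> (\<lambda>x. f x - h * ?v x) (\<lambda>x. 1 / h * (f x - (f x - h * ?v x)))"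
        using elim by simp
      then have "resolvent (1 / h) f = (\<lambda>x. f x - h * ?v x)" by (rule resolvent_eqI[OF \<alpha>])
      then have "(\<lambda>x. (resolvent (1 / h) f x - f x) / h + g x) = (\<lambda>x. g x - ?v x)"
        using elim by auto
      then show ?case
        by (simp add: inverse_eq_divide V.norm_minus_commute[of g])
    qed
  qed
qed

lemma resolvent_power_L2: "\<alpha> > 0 \<Longrightarrow> f \<in> L2 m \<Longrightarrow> (resolvent \<alpha> ^^ k) f \<in> L2 m"
  by (induction k) (auto intro: resolvent_L2)

text \<open>
  Telescoping: as \<open>P\<close> and \<open>V\<close> commute and \<open>V\<close> is a contraction, replacing one factor \<open>P\<^sub>h\<close> by \<open>V\<close> costs
  at most \<open>M \<parallel>P\<^sub>h f - V f\<parallel>\<close>.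
\<close>

lemma P_resolvent_power_near:
  assumes h: "h > 0" and f: "f \<in> L2 m" and M: "\<And>s g. 0 \<le> s \<Longrightarrow> s \<le> real k * h \<Longrightarrow> g \<in> L2 m \<Longrightarrow> L2_norm m (P s g) \<le> M * L2_norm m g"
  shows "L2_norm m (\<lambda>x. P (real k * h) f x - (resolvent (1 / h) ^^ k) f x)
    \<le> real k * M * L2_norm m (\<lambda>x. P h f x - resolvent (1 / h) f x)"
  using M
proof (induction k)
  case 0
  then show ?case by (simp add: P_0 f V.norm_zero)
next
  case (Suc k)
  let ?V = "resolvent (1 / h)" and ?s = "real k * h"
  have \<alpha>: "1 / h > 0" and s: "?s \<ge> 0" and h0: "h \<ge> 0" using h by auto
  note L2 = P_L2[OF h0 f] resolvent_L2[OF \<alpha> f] P_L2[OF s f] resolvent_power_L2[OF \<alpha> f, of k]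
  have "real (Suc k) * h = ?s + h" by (simp add: algebra_simps)
  then have "P (real (Suc k) * h) f = P ?s (P h f)" by (simp add: P_plus s h0 f)
  moreover have "P ?s (?V f) = ?V (P ?s f)" by (rule resolvent_P_commute[OF \<alpha> s f, symmetric])
  ultimately have "L2_norm m (\<lambda>x. P (real (Suc k) * h) f x - (?V ^^ Suc k) f x)
      = L2_norm m (\<lambda>x. P ?s (\<lambda>x. P h f x - ?V f x) x + ?V (\<lambda>x. P ?s f x - (?V ^^ k) f x) x)"
    by (simp add: P_diff s L2 resolvent_diff \<alpha> h)
  also have "\<dots> \<le> L2_norm m (P ?s (\<lambda>x. P h f x - ?V f x)) + L2_norm m (?V (\<lambda>x. P ?s f x - (?V ^^ k) f x))"
    by (intro V.norm_triangle P_L2 s resolvent_L2 \<alpha> V.L2_diff L2)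
  also have "\<dots> \<le> M * L2_norm m (\<lambda>x. P h f x - ?V f x) + L2_norm m (\<lambda>x. P ?s f x - (?V ^^ k) f x)"
    using h by (intro add_mono Suc.prems resolvent_norm_le \<alpha> V.L2_diff L2 s) (simp add: algebra_simps)
  also have "L2_norm m (\<lambda>x. P ?s f x - (?V ^^ k) f x) \<le> real k * M * L2_norm m (\<lambda>x. P h f x - ?V f x)"
    using h by (intro Suc.IH Suc.prems) (auto simp: algebra_simps)
  finally show ?case by (simp add: algebra_simps)
qed

text \<open>
  There are \<open>n\<close> replacements, and each costs \<open>o(t / n)\<close> because \<open>P\<^sub>h\<close> and \<open>V\<close> have the same derivative at
  \<open>h = 0\<close> on the domain of the generator.
\<close>

lemma Euler_formula:
  assumes op: "form_operator m \<mu> f g" and t: "t > 0"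
  shows "(\<lambda>n. (resolvent (real n / t) ^^ n) f x) \<longlonglongrightarrow> P t f x"
proof -
  have f: "f \<in> L2 m" and g: "g \<in> L2 m"
    using form_operatorD[OF op] form_domain_L2 by auto
  obtain M where M: "M > 0" "\<And>s g. 0 \<le> s \<Longrightarrow> s \<le> t \<Longrightarrow> g \<in> L2 m \<Longrightarrow> L2_norm m (P s g) \<le> M * L2_norm m g"
    using P_locally_bounded[of t] by blast
  define h where "h n = t / real (Suc n)" for n
  have h: "h n > 0" for n using t by (simp add: h_def)
  have "h \<longlonglongrightarrow> 0"
    unfolding h_def using tendsto_mult_right_zero[OF LIMSEQ_inverse_real_of_nat, of t] by (simp add: divide_inverse)
  then have h0: "filterlim h (at_right 0) sequentially"
    using h less_imp_neq[OF h, symmetric] by (simp add: filterlim_at)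
  let ?R = "\<lambda>n. resolvent (1 / h n)"
  let ?a = "\<lambda>h. L2_norm m (\<lambda>x. (P h f x - f x) / h + g x)"
  let ?b = "\<lambda>h. L2_norm m (\<lambda>x. (resolvent (1 / h) f x - f x) / h + g x)"
  have near: "L2_norm m (\<lambda>x. (?R n ^^ Suc n) f x - P t f x) \<le> t * M * (?a (h n) + ?b (h n))" for n
  proof -
    have th: "real (Suc n) * h n = t" by (simp add: h_def)
    have \<alpha>: "1 / h n > 0" using h by simp
    note L2 = P_L2[OF less_imp_le[OF h] f, of n] resolvent_L2[OF \<alpha> f]
    let ?p = "\<lambda>x. 1 / h n * (P (h n) f x - f x) + g x" and ?q = "\<lambda>x. 1 / h n * (?R n f x - f x) + g x"
    have pq: "?p \<in> L2 m" "?q \<in> L2 m" by (intro V.L2_add V.L2_scale V.L2_diff L2 f g)+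
    have "L2_norm m (\<lambda>x. P (h n) f x - ?R n f x) = L2_norm m (\<lambda>x. h n * (?p x - ?q x))"
      using h[of n] by (intro arg_cong[of _ _ "L2_norm m"]) (auto simp: field_simps)
    also have "\<dots> \<le> h n * (?a (h n) + ?b (h n))"
      unfolding V.norm_scale using h[of n] V.norm_triangle_minus[OF pq] by simp
    finally have "real (Suc n) * M * L2_norm m (\<lambda>x. P (h n) f x - ?R n f x)
        \<le> real (Suc n) * M * (h n * (?a (h n) + ?b (h n)))"
      using M(1) by (intro mult_left_mono) auto
    also have "\<dots> = t * M * (?a (h n) + ?b (h n))"
      unfolding th[symmetric] by (simp only: mult_ac)
    finally show ?thesis
      using P_resolvent_power_near[OF h f, of "Suc n" n M] M(2) unfolding th
      by (subst V.norm_minus_commute) (meson order_trans)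
  qed
  have "(\<lambda>n. L2_norm m (\<lambda>x. (?R n ^^ Suc n) f x - P t f x)) \<longlonglongrightarrow> 0"
  proof (rule Lim_null_comparison)
    show "\<forall>\<^sub>F n in sequentially. norm (L2_norm m (\<lambda>x. (?R n ^^ Suc n) f x - P t f x)) \<le> t * M * (?a (h n) + ?b (h n))"
      using near by (intro always_eventually allI) (simp add: V.norm_nonneg)
    show "(\<lambda>n. t * M * (?a (h n) + ?b (h n))) \<longlonglongrightarrow> 0"
      by (intro tendsto_mult_right_zero tendsto_add_zero filterlim_compose[OF generator_tendsto[OF op] h0]
          filterlim_compose[OF resolvent_tendsto_generator[OF op] h0])
  qed
  then have "(\<lambda>n. (?R n ^^ Suc n) f x) \<longlonglongrightarrow> P t f x"
  proof (rule V.tendsto_point[where f="\<lambda>n. (?R n ^^ Suc n) f", OF m_pos, rotated 2])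
    show "(?R n ^^ Suc n) f \<in> L2 m" for n
      by (rule resolvent_power_L2[OF _ f]) (simp add: h)
    show "P t f \<in> L2 m" by (rule P_L2[OF less_imp_le[OF t] f])
  qed
  moreover have "1 / h n = real (Suc n) / t" for n by (simp add: h_def)
  ultimately have "(\<lambda>n. (resolvent (real (Suc n) / t) ^^ Suc n) f x) \<longlonglongrightarrow> P t f x"
    by (simp only:)
  then show ?thesis
    by (rule LIMSEQ_imp_Suc[where f="\<lambda>n. (resolvent (real n / t) ^^ n) f x"])
qed

lemma P_tendsto:
  assumes t: "t \<ge> 0" and L2: "\<And>n. f n \<in> L2 m" "g \<in> L2 m" and lim: "(\<lambda>n. L2_norm m (\<lambda>x. f n x - g x)) \<longlonglongrightarrow> 0"
  shows "(\<lambda>n. P t (f n) x) \<longlonglongrightarrow> P t g x"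
proof -
  obtain C where C: "C \<ge> 0" "\<And>h. h \<in> L2 m \<Longrightarrow> L2_norm m (P t h) \<le> C * L2_norm m h"
    using V.operator_bound[OF P_operator[OF t]] by blast
  have "(\<lambda>n. C * L2_norm m (\<lambda>x. f n x - g x)) \<longlonglongrightarrow> 0"
    by (rule tendsto_mult_right_zero[OF lim])
  then have "(\<lambda>n. L2_norm m (\<lambda>x. P t (f n) x - P t g x)) \<longlonglongrightarrow> 0"
    by (rule Lim_null_comparison[rotated])
      (use C(2)[OF V.L2_diff[OF L2]] in \<open>simp add: P_diff[OF t L2] V.norm_nonneg\<close>)
  then show ?thesis
    by (rule V.tendsto_point[OF m_pos P_L2[OF t L2(1)] P_L2[OF t L2(2)]])
qed

text \<open>
  Euler's formula carries pointwise closed constraints from the resolvent to the semigroup. It is available on the domain of \<open>L\<close> only;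
  a general \<open>f\<close> is approximated by its resolvents, which lie in that domain and obey the constraint.
\<close>

lemma P_invariant:
  assumes resolvent: "\<And>\<alpha> f. \<alpha> > 0 \<Longrightarrow> f \<in> L2 m \<Longrightarrow> Q f \<Longrightarrow> Q (resolvent \<alpha> f)"
    and closed: "\<And>f g. (\<And>n::nat. Q (f n)) \<Longrightarrow> (\<And>x. (\<lambda>n. f n x) \<longlonglongrightarrow> g x) \<Longrightarrow> Q g"
    and f: "f \<in> L2 m" "Q f" and t: "t \<ge> 0"
  shows "Q (P t f)"
proof (cases "t = 0")
  case True
  then show ?thesis using f by (simp add: P_0)
next
  case False
  with t have t': "t > 0" by simp
  have pow: "h \<in> L2 m \<Longrightarrow> Q h \<Longrightarrow> \<alpha> > 0 \<Longrightarrow> Q ((resolvent \<alpha> ^^ k) h)" for h \<alpha> k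
    by (induction k) (auto intro: resolvent resolvent_power_L2)
  have domain: "Q (P t h)" if op: "form_operator m \<mu> h g" and "Q h" for h g
  proof (rule closed)
    have "h \<in> L2 m" using form_operatorD[OF op] form_domain_L2 by auto
    then show "Q ((resolvent (real (Suc n) / t) ^^ Suc n) h)" for n
      using t' that(2) by (intro pow) auto
    show "(\<lambda>n. (resolvent (real (Suc n) / t) ^^ Suc n) h x) \<longlonglongrightarrow> P t h x" for x
      by (rule LIMSEQ_Suc[OF Euler_formula[OF op t']])
  qed
  let ?f = "\<lambda>n. resolvent (real (Suc n)) f"
  have fL2: "?f n \<in> L2 m" for n by (intro resolvent_L2 f) simp
  show ?thesis
  proof (rule closed)
    show "Q (P t (?f n))" for n
      by (rule domain[OF resolvent_operator[OF _ f(1)] resolvent[OF _ f]]) simp_all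
    fix x
    have "filterlim (\<lambda>n. real (Suc n)) at_top sequentially"
      by (rule filterlim_compose[OF filterlim_real_sequentially filterlim_Suc])
    then have "(\<lambda>n. L2_norm m (\<lambda>x. ?f n x - f x)) \<longlonglongrightarrow> 0"
      by (rule filterlim_compose[OF resolvent_tendsto_identity[OF f(1)]])
    then show "(\<lambda>n. P t (?f n) x) \<longlonglongrightarrow> P t f x"
      by (rule P_tendsto[OF t fL2 f(1)])
  qed
qed

lemma P_nonneg:
  assumes "f \<in> L2 m" "\<And>x. 0 \<le> f x" "t \<ge> 0"
  shows "0 \<le> P t f x"
proof -
  have "\<forall>x. 0 \<le> P t f x"
  proof (rule P_invariant[where Q="\<lambda>f. \<forall>x. 0 \<le> f x"])
    show "\<forall>x. 0 \<le> resolvent \<alpha> f x" if "\<alpha> > 0" "f \<in> L2 m" "\<forall>x. 0 \<le> f x" for \<alpha> f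
      using that by (simp add: resolvent_nonneg)
    show "\<forall>x. 0 \<le> g x" if "\<And>n. \<forall>x. 0 \<le> f n x" "\<And>x. (\<lambda>n. f n x) \<longlonglongrightarrow> g x" for f :: "nat \<Rightarrow> 'a \<Rightarrow> real" and g
      using that by (blast intro: LIMSEQ_le_const)
  qed (use assms in auto)
  then show ?thesis ..
qed

lemma P_le_1:
  assumes "f \<in> L2 m" "\<And>x. 0 \<le> f x" "\<And>x. f x \<le> 1" "t \<ge> 0"
  shows "P t f x \<le> 1"
proof -
  have "\<forall>x. 0 \<le> P t f x \<and> P t f x \<le> 1"
  proof (rule P_invariant[where Q="\<lambda>f. \<forall>x. 0 \<le> f x \<and> f x \<le> 1"])
    show "\<forall>x. 0 \<le> resolvent \<alpha> f x \<and> resolvent \<alpha> f x \<le> 1"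
      if "\<alpha> > 0" "f \<in> L2 m" "\<forall>x. 0 \<le> f x \<and> f x \<le> 1" for \<alpha> f
      using that by (simp add: resolvent_nonneg resolvent_le_1)
    show "\<forall>x. 0 \<le> g x \<and> g x \<le> 1"
      if "\<And>n. \<forall>x. 0 \<le> f n x \<and> f n x \<le> 1" "\<And>x. (\<lambda>n. f n x) \<longlonglongrightarrow> g x" for f :: "nat \<Rightarrow> 'a \<Rightarrow> real" and g
      using that by (blast intro: LIMSEQ_le_const LIMSEQ_le_const2)
  qed (use assms in auto)
  then show ?thesis by blast
qed

lemma P_mono:
  assumes "f \<in> L2 m" "g \<in> L2 m" "\<And>x. f x \<le> g x" "t \<ge> 0"
  shows "P t f x \<le> P t g x"
  using P_nonneg[OF V.L2_diff[OF assms(2,1)], of t x] assms by (simp add: P_diff)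

text \<open>
  The minimum of \<open>\<phi>\<^sub>k\<close> and \<open>\<psi>\<^sub>n\<close> converges to \<open>\<phi>\<^sub>k\<close> in \<open>L\<^sup>2\<close> as \<open>n \<rightarrow> \<infinity>\<close>, and \<open>P\<close> is continuous and order
  preserving. Used in both directions, this makes the value of the monotone extension independent of the approximating sequence.
\<close>

lemma monotone_limit_le:
  assumes t: "t \<ge> 0" and \<phi>: "\<And>n. \<phi> n \<in> L2 m" "\<And>n y. 0 \<le> \<phi> n y" "\<And>n y. \<phi> n y \<le> \<phi> (Suc n) y" "\<And>y. (\<lambda>n. \<phi> n y) \<longlonglongrightarrow> f y"
    and \<psi>: "\<And>n. \<psi> n \<in> L2 m" "\<And>n y. 0 \<le> \<psi> n y" "\<And>y. (\<lambda>n. \<psi> n y) \<longlonglongrightarrow> f y"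
    and a: "(\<lambda>n. P t (\<phi> n) x) \<longlonglongrightarrow> a" and b: "(\<lambda>n. P t (\<psi> n) x) \<longlonglongrightarrow> b"
  shows "a \<le> b"
proof (rule LIMSEQ_le_const2[OF a], intro exI allI impI)
  fix k
  have le: "\<phi> k y \<le> f y" for y
    using incseq_le[OF incseq_SucI \<phi>(4)] \<phi>(3) by blast
  let ?h = "\<lambda>n y. min (\<phi> k y) (\<psi> n y)"
  have hL2: "?h n \<in> L2 m" for n
    using \<phi>(2)[of k] \<psi>(2)[of n] by (intro V.L2_abs_le[OF \<phi>(1)[of k]]) auto
  have "(\<lambda>n. L2_norm m (\<lambda>y. ?h n y - \<phi> k y)) \<longlonglongrightarrow> 0"
  proof (rule V.norm_dominated)
    show "\<phi> k \<in> L2 m" by (rule \<phi>)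
    show "\<bar>?h n y - \<phi> k y\<bar> \<le> \<phi> k y" for n y
      using \<phi>(2)[of k y] \<psi>(2)[of n y] by auto
    show "(\<lambda>n. ?h n y) \<longlonglongrightarrow> \<phi> k y" for y
      using tendsto_min[OF tendsto_const \<psi>(3)[of y], of "\<phi> k y"] le[of y] by (simp add: min_absorb1)
  qed
  then have "(\<lambda>n. P t (?h n) x) \<longlonglongrightarrow> P t (\<phi> k) x"
    by (rule P_tendsto[OF t hL2 \<phi>(1)])
  then show "P t (\<phi> k) x \<le> b"
    by (rule LIMSEQ_le[OF _ b]) (auto intro!: P_mono hL2 \<psi> t)
qed

text \<open>
  The indicators of the exhaustion witness existence of the limit described by the monotone extension.
\<close>

lemma monotone_extension_one:
  assumes t: "t \<ge> 0" and complete: "monotone_extension m (P t) (\<lambda>x. 1) = (\<lambda>x. 1)"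
  shows "(\<lambda>n. P t (indicator (exhaustion n)) x) \<longlonglongrightarrow> 1"
proof -
  let ?\<phi> = "\<lambda>n. indicator (exhaustion n) :: 'a \<Rightarrow> real"
  have L2: "?\<phi> n \<in> L2 m" for n
    by (intro V.L2_finite_support finite_subset[OF _ finite_exhaustion[of n]]) (auto simp: indicator_def)
  have mono: "?\<phi> n y \<le> ?\<phi> (Suc n) y" for n y
    using exhaustion_mono[of n "Suc n"] by (auto simp: indicator_def)
  have lim: "(\<lambda>n. ?\<phi> n y) \<longlonglongrightarrow> 1" for y
    by (rule tendsto_eventually, rule eventually_mono[OF eventually_in_exhaustion[of y]]) simp
  have "incseq (\<lambda>n. P t (?\<phi> n) x)"
    by (intro incseq_SucI P_mono L2 mono t)
  moreover have "\<forall>n. P t (?\<phi> n) x \<le> 1"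
    by (intro allI P_le_1 L2 t) (auto simp: indicator_def)
  ultimately obtain a where a: "(\<lambda>n. P t (?\<phi> n) x) \<longlonglongrightarrow> a"
    by (rule incseq_convergent)
  have "monotone_extension m (P t) (\<lambda>x. 1) x = a"
    unfolding monotone_extension_def
  proof (rule the_equality)
    show "\<exists>\<phi>. (\<forall>n. \<phi> n \<in> L2 m) \<and> (\<forall>n y. 0 \<le> \<phi> n y \<and> \<phi> n y \<le> \<phi> (Suc n) y) \<and>
        (\<forall>y. (\<lambda>n. \<phi> n y) \<longlonglongrightarrow> 1) \<and> (\<lambda>n. P t (\<phi> n) x) \<longlonglongrightarrow> a"
      using L2 mono lim a by (intro exI[of _ ?\<phi>]) auto
    fix b
    assume "\<exists>\<phi>. (\<forall>n. \<phi> n \<in> L2 m) \<and> (\<forall>n y. 0 \<le> \<phi> n y \<and> \<phi> n y \<le> \<phi> (Suc n) y) \<and>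
        (\<forall>y. (\<lambda>n. \<phi> n y) \<longlonglongrightarrow> 1) \<and> (\<lambda>n. P t (\<phi> n) x) \<longlonglongrightarrow> b"
    then obtain \<psi> where \<psi>: "\<And>n. \<psi> n \<in> L2 m" "\<And>n y. 0 \<le> \<psi> n y" "\<And>n y. \<psi> n y \<le> \<psi> (Suc n) y"
      "\<And>y. (\<lambda>n. \<psi> n y) \<longlonglongrightarrow> 1" "(\<lambda>n. P t (\<psi> n) x) \<longlonglongrightarrow> b" by blast
    have "b \<le> a" by (rule monotone_limit_le[OF t \<psi>(1-4) L2 _ lim \<psi>(5) a]) simp
    moreover have "a \<le> b" by (rule monotone_limit_le[OF t L2 _ mono lim \<psi>(1,2,4) a \<psi>(5)]) simp
    ultimately show "b = a" by simp
  qed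
  with complete a show ?thesis by simp
qed

end


section \<open>Stochastic completeness and the exhaustion by subsolutions\<close>

context heat
begin

lemma P_difference_quotient_bound:
  assumes op: "form_operator m \<mu> f g" and s: "s \<ge> 0" and h: "h > 0"
    and M: "\<And>f. f \<in> L2 m \<Longrightarrow> L2_norm m (P s f) \<le> M * L2_norm m f"
  shows "\<bar>(P (s + h) f x - P s f x) / h + P s g x\<bar>
    \<le> M / sqrt (m x) * L2_norm m (\<lambda>x. (P h f x - f x) / h + g x)"
proof -
  have f: "f \<in> L2 m" and g: "g \<in> L2 m"
    using form_operatorD[OF op] form_domain_L2 by auto
  have h0: "h \<ge> 0" using h by simp
  note Phf = P_L2[OF h0 f]
  let ?d = "\<lambda>x. 1 / h * (P h f x - f x)"
  have d: "?d \<in> L2 m" by (intro V.L2_scale V.L2_diff Phf f)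
  have eq: "P s (\<lambda>x. ?d x + g x) = (\<lambda>x. (P (s + h) f x - P s f x) / h + P s g x)"
    unfolding P_add[OF s d g] P_scale[OF s V.L2_diff[OF Phf f]] P_diff[OF s Phf f] P_plus[OF s h0 f] by simp
  have "sqrt (m x) * \<bar>P s (\<lambda>x. ?d x + g x) x\<bar> \<le> M * L2_norm m (\<lambda>x. ?d x + g x)"
    by (rule order_trans[OF V.point_le_norm[OF P_L2[OF s V.L2_add[OF d g]]] M[OF V.L2_add[OF d g]]])
  then show ?thesis
    unfolding eq using m_pos[of x] by (simp add: field_simps)
qed

text \<open>
  On the domain of \<open>L\<close> the orbit is differentiable from both sides. From the left, \<open>P\<^sub>s\<close> with \<open>s < t\<close> is factored
  out of the difference quotient, which needs the bound for \<open>P\<^sub>s\<close> to be uniform in \<open>s\<close>.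
\<close>

lemma P_has_derivative:
  assumes op: "form_operator m \<mu> f g" and t: "t \<in> {0..T}"
  shows "((\<lambda>t. P t f x) has_real_derivative - P t g x) (at t within {0..T})"
proof -
  have f: "f \<in> L2 m" and g: "g \<in> L2 m"
    using form_operatorD[OF op] form_domain_L2 by auto
  obtain M where M: "M > 0" "\<And>s f. 0 \<le> s \<Longrightarrow> s \<le> T \<Longrightarrow> f \<in> L2 m \<Longrightarrow> L2_norm m (P s f) \<le> M * L2_norm m f"
    using P_locally_bounded[of T] by blast
  let ?a = "\<lambda>h. L2_norm m (\<lambda>x. (P h f x - f x) / h + g x)" and ?b = "\<lambda>h. L2_norm m (\<lambda>x. P h g x - g x)"
  let ?C = "M / sqrt (m x)"
  let ?F = "at t within {0..T}"
  have "((\<lambda>s. \<bar>s - t\<bar>) \<longlongrightarrow> \<bar>t - t\<bar>) ?F"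
    by (intro tendsto_intros)
  moreover have "\<forall>\<^sub>F s in ?F. \<bar>s - t\<bar> \<in> {0<..} \<and> \<bar>s - t\<bar> \<noteq> 0"
    by (auto simp: eventually_at_filter)
  ultimately have lim: "filterlim (\<lambda>s. \<bar>s - t\<bar>) (at_right 0) ?F"
    by (simp add: filterlim_at)
  have "((\<lambda>s. ?C * (?a \<bar>s - t\<bar> + ?b \<bar>s - t\<bar>)) \<longlongrightarrow> 0) ?F"
    by (intro tendsto_mult_right_zero tendsto_add_zero filterlim_compose[OF generator_tendsto[OF op] lim]
        filterlim_compose[OF P_tendsto_identity[OF g] lim])
  moreover have "\<forall>\<^sub>F s in ?F. norm ((P s f x - P t f x) / (s - t) - (- P t g x)) \<le> ?C * (?a \<bar>s - t\<bar> + ?b \<bar>s - t\<bar>)"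
    unfolding eventually_at_filter
  proof (intro always_eventually allI impI)
    fix s assume "s \<noteq> t" and s: "s \<in> {0..T}"
    have C: "?C \<ge> 0" using M(1) m_pos[of x] by simp
    consider "t < s" | "s < t" using \<open>s \<noteq> t\<close> by linarith
    then show "norm ((P s f x - P t f x) / (s - t) - (- P t g x)) \<le> ?C * (?a \<bar>s - t\<bar> + ?b \<bar>s - t\<bar>)"
    proof cases
      case 1
      have "norm ((P s f x - P t f x) / (s - t) - (- P t g x)) \<le> ?C * ?a \<bar>s - t\<bar>"
        using P_difference_quotient_bound[OF op, of t "s - t" M x] 1 s t M(2)[of t] by simp
      also have "\<dots> \<le> ?C * (?a \<bar>s - t\<bar> + ?b \<bar>s - t\<bar>)"
        by (intro mult_left_mono C) (simp add: V.norm_nonneg)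
      finally show ?thesis .
    next
      case 2
      define h where "h = t - s"
      have h: "h > 0" "t = s + h" "\<bar>s - t\<bar> = h" using 2 by (simp_all add: h_def)
      have s0: "0 \<le> s" and sT: "s \<le> T" and h0: "0 \<le> h" using s h by auto
      have "\<bar>(P (s + h) f x - P s f x) / h + P s g x\<bar> \<le> ?C * ?a h"
        using P_difference_quotient_bound[OF op s0 h(1)] M(2)[OF s0 sT] by simp
      moreover have "\<bar>P (s + h) g x - P s g x\<bar> \<le> ?C * ?b h"
      proof -
        note Phg = P_L2[OF h0 g]
        have "sqrt (m x) * \<bar>P s (\<lambda>x. P h g x - g x) x\<bar> \<le> M * ?b h"
          by (rule order_trans[OF V.point_le_norm[OF P_L2[OF s0 V.L2_diff[OF Phg g]]] M(2)[OF s0 sT V.L2_diff[OF Phg g]]])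
        then show ?thesis
          unfolding P_diff[OF s0 Phg g] P_plus[OF s0 h0 g] using m_pos[of x] by (simp add: field_simps)
      qed
      moreover have "(P s f x - P t f x) / (s - t) - (- P t g x)
          = ((P (s + h) f x - P s f x) / h + P s g x) + (P (s + h) g x - P s g x)"
        unfolding h(2) using h(1) by (simp add: field_simps)
      ultimately show ?thesis
        unfolding h(3) by (simp add: distrib_left)
    qed
  qed
  ultimately have "((\<lambda>s. (P s f x - P t f x) / (s - t) - (- P t g x)) \<longlongrightarrow> 0) ?F"
    by (rule Lim_null_comparison[rotated])
  then show ?thesis
    unfolding has_field_derivative_iff by (rule LIM_zero_cancel)
qed

text \<open>
  The resolvent is the Laplace transform of the semigroup. Over a finite time interval this is the fundamental theorem of
  calculus for \<open>exp (- t) * P t v x\<close> with \<open>v\<close> the resolvent of \<open>\<phi>\<close>, whose derivative is \<open>- exp (- t) * P t \<phi> x\<close>. The boundary term at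
  \<open>T\<close> is non-negative for \<open>\<phi> \<ge> 0\<close> and can be dropped from lower bounds.
\<close>

lemma resolvent_integral:
  assumes \<phi>: "\<phi> \<in> L2 m" and T: "T \<ge> 0"
  shows "((\<lambda>t. exp (- t) * P t \<phi> x) has_integral (resolvent 1 \<phi> x - exp (- T) * P T (resolvent 1 \<phi>) x)) {0..T}"
proof -
  let ?v = "resolvent 1 \<phi>"
  have v: "?v \<in> L2 m" by (rule resolvent_L2[OF _ \<phi>]) simp
  have op: "form_operator m \<mu> ?v (\<lambda>x. \<phi> x - ?v x)"
    using resolvent_operator[of 1 \<phi>] \<phi> by simp
  have "((\<lambda>t. - (exp (- t) * P t ?v x)) has_vector_derivative exp (- t) * P t \<phi> x) (at t within {0..T})"
    if t: "t \<in> {0..T}" for t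
  proof -
    have "P t (\<lambda>x. \<phi> x - ?v x) = (\<lambda>x. P t \<phi> x - P t ?v x)"
      using t by (intro P_diff \<phi> v) simp
    then have "((\<lambda>t. P t ?v x) has_real_derivative - (P t \<phi> x - P t ?v x)) (at t within {0..T})"
      using P_has_derivative[OF op t, of x] by simp
    then have "((\<lambda>t. - (exp (- t) * P t ?v x)) has_real_derivative
        - (exp (- t) * - (P t \<phi> x - P t ?v x) + exp (- t) * (- 1) * P t ?v x)) (at t within {0..T})"
      by (intro derivative_intros) (auto intro!: derivative_eq_intros)
    then show ?thesis
      by (simp add: has_real_derivative_iff_has_vector_derivative algebra_simps)
  qed
  from fundamental_theorem_of_calculus[OF T this] show ?thesis
    by (simp add: P_0 v)
qed

text \<open>
  Let \<open>H\<close> be the limit at \<open>x\<close>. It bounds the resolvents of the indicators \<open>\<phi>\<^sub>n\<close> of finite sets, hence also the integrals of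
  \<open>exp (- t) * P t \<phi>\<^sub>n x\<close> over \<open>{0..T}\<close>. By completeness these increase to \<open>1 - exp (- T)\<close>, and \<open>T\<close> is arbitrary.
\<close>

lemma iterate_one_tendsto:
  assumes complete: "\<And>t. t \<ge> 0 \<Longrightarrow> monotone_extension m (P t) (\<lambda>x. 1) = (\<lambda>x. 1)"
  shows "(\<lambda>k. iterate 1 (\<lambda>x. 1) k x) \<longlonglongrightarrow> 1"
proof -
  have "incseq (\<lambda>k. iterate 1 (\<lambda>x. 1) k x)"
    by (rule iterate_incseq) simp_all
  moreover have "\<forall>k. iterate 1 (\<lambda>x. 1) k x \<le> 1"
    by (intro allI iterate_le_1) simp_all
  ultimately obtain H where H: "(\<lambda>k. iterate 1 (\<lambda>x. 1) k x) \<longlonglongrightarrow> H"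
    by (rule incseq_convergent)
  let ?\<phi> = "\<lambda>n. indicator (exhaustion n) :: 'a \<Rightarrow> real"
  have L2: "?\<phi> n \<in> L2 m" for n
    by (intro V.L2_finite_support finite_subset[OF _ finite_exhaustion[of n]]) (auto simp: indicator_def)
  have mono: "?\<phi> n y \<le> ?\<phi> (Suc n) y" for n y
    using exhaustion_mono[of n "Suc n"] by (auto simp: indicator_def)
  have R_le: "resolvent 1 (?\<phi> n) x \<le> H" for n
  proof (rule LIMSEQ_le[OF iterate_tendsto_resolvent H])
    show "\<exists>N. \<forall>k\<ge>N. iterate 1 (?\<phi> n) k x \<le> iterate 1 (\<lambda>x. 1) k x"
      by (intro exI allI impI iterate_mono_source) (auto simp: indicator_def)
  qed (auto intro: L2)
  have lower: "1 - exp (- T) \<le> H" if T: "T \<ge> 0" for T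
  proof -
    let ?f = "\<lambda>n t. exp (- t) * P t (?\<phi> n) x"
    note int = resolvent_integral[OF L2 T, of _ x]
    have nonneg: "0 \<le> integral {0..T} (?f n)" for n
    proof (rule integral_nonneg)
      show "?f n integrable_on {0..T}" using int by (rule has_integral_integrable)
      show "0 \<le> ?f n t" if "t \<in> {0..T}" for t
        using that by (intro mult_nonneg_nonneg P_nonneg L2) auto
    qed
    have le: "integral {0..T} (?f n) \<le> H" for n
    proof -
      have "0 \<le> exp (- T) * P T (resolvent 1 (?\<phi> n)) x"
        by (intro mult_nonneg_nonneg P_nonneg resolvent_L2 resolvent_nonneg L2 T) auto
      then show ?thesis
        using integral_unique[OF int[of n]] R_le[of n] by simp
    qed
    have "(\<lambda>t. exp (- t)) integrable_on {0..T} \<and>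
        (\<lambda>n. integral {0..T} (?f n)) \<longlonglongrightarrow> integral {0..T} (\<lambda>t. exp (- t))"
    proof (rule monotone_convergence_increasing)
      show "?f n integrable_on {0..T}" for n using int by (rule has_integral_integrable)
      show "?f n t \<le> ?f (Suc n) t" if "t \<in> {0..T}" for n t
        using that by (intro mult_left_mono P_mono L2 mono) auto
      show "(\<lambda>n. ?f n t) \<longlonglongrightarrow> exp (- t)" if "t \<in> {0..T}" for t
        using tendsto_mult[OF tendsto_const monotone_extension_one[OF _ complete], of t "exp (- t)" x] that by simp
      show "bounded (range (\<lambda>n. integral {0..T} (?f n)))"
        unfolding bounded_iff using nonneg le by (intro exI[of _ H]) auto
    qed
    then have lim: "(\<lambda>n. integral {0..T} (?f n)) \<longlonglongrightarrow> integral {0..T} (\<lambda>t. exp (- t))" ..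
    have "((\<lambda>t. exp (- t)) has_integral (- exp (- T) - (- exp (- 0)))) {0..T}"
      using T by (intro fundamental_theorem_of_calculus)
        (auto intro!: derivative_eq_intros simp flip: has_real_derivative_iff_has_vector_derivative)
    then have "integral {0..T} (\<lambda>t. exp (- t)) = 1 - exp (- T)"
      by (simp add: integral_unique)
    with LIMSEQ_le_const2[OF lim] le show ?thesis by auto
  qed
  have "((\<lambda>T. 1 - exp (- T)) \<longlongrightarrow> 1 - (0::real)) at_top"
    by (intro tendsto_diff tendsto_const filterlim_compose[OF exp_at_bot] filterlim_uminus_at_bot_at_top)
  then have "1 \<le> H"
    by (intro tendsto_le[OF _ tendsto_const, of at_top "\<lambda>T. 1 - exp (- T)"])
      (auto intro: eventually_mono[OF eventually_ge_at_top[of 0]] lower)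
  moreover have "H \<le> 1"
    by (rule LIMSEQ_le_const2[OF H]) (auto intro!: iterate_le_1)
  ultimately show ?thesis using H by simp
qed

end

section \<open>Integrable superharmonic functions\<close>

lemma has_sum_finite_sum:
  fixes f :: "'i \<Rightarrow> 'a \<Rightarrow> real"
  assumes "finite K" "\<And>i. i \<in> K \<Longrightarrow> (f i has_sum s i) A"
  shows "((\<lambda>y. \<Sum>i\<in>K. f i y) has_sum (\<Sum>i\<in>K. s i)) A"
  using assms by (induction K rule: finite_induct) (auto intro: has_sum_add)

context graph
begin

lemma laplacian_eq: "laplacian m \<mu> f x = weighted_laplacian \<mu> f x / m x"
  by (simp add: laplacian_def weighted_laplacian_def)

lemma superharmonic_iff:
  "superharmonic m \<mu> f \<longleftrightarrow> f \<in> formal_domain \<mu> \<and> (\<forall>x. 0 \<le> weighted_laplacian \<mu> f x)"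
proof -
  have "0 \<le> laplacian m \<mu> f x \<longleftrightarrow> 0 \<le> weighted_laplacian \<mu> f x" for x
    using m_pos[of x] by (simp add: laplacian_eq zero_le_divide_iff)
  then show ?thesis by (simp add: superharmonic_def)
qed

lemma formal_domain_summable:
  assumes "f \<in> formal_domain \<mu>"
  shows "(\<lambda>y. \<mu> x y * f y) summable_on UNIV" "(\<lambda>y. \<mu> x y * (c - f y)) summable_on UNIV"
proof -
  show *: "(\<lambda>y. \<mu> x y * f y) summable_on UNIV"
    by (rule summable_on_abs_le[of "\<lambda>y. \<mu> x y * \<bar>f y\<bar>"])
      (use assms \<mu>_nonneg in \<open>auto simp: formal_domain_def abs_mult\<close>)
  show "(\<lambda>y. \<mu> x y * (c - f y)) summable_on UNIV"
    unfolding right_diff_distrib by (intro infsum_diff_real(2) summable_on_cmult_left \<mu>_summable *)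
qed

text \<open>
  Green's formula for a function \<open>v\<close> that need not have finite energy; interchanging the sums is
  harmless since one of them is finite.
\<close>

lemma Green_formula_formal:
  assumes h: "h \<in> finitely_supported" and v: "v \<in> formal_domain \<mu>"
  shows "((\<lambda>y. v y * weighted_laplacian \<mu> h y) has_sum (\<Sum>x | h x \<noteq> 0. weighted_laplacian \<mu> v x * h x)) UNIV"
proof -
  let ?K = "{x. h x \<noteq> 0}"
  have K: "finite ?K" using h by (simp add: finitely_supported_def)
  have "((\<lambda>y. v y * (deg y * h y)) has_sum (\<Sum>y\<in>?K. v y * (deg y * h y))) ?K"
    by (intro has_sum_finite K)
  then have 1: "((\<lambda>y. v y * (deg y * h y)) has_sum (\<Sum>y\<in>?K. v y * (deg y * h y))) UNIV"
    by (rule has_sum_cong_neutral[THEN iffD1, rotated -1]) auto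
  have 2: "((\<lambda>y. \<Sum>x\<in>?K. h x * (\<mu> x y * v y)) has_sum (\<Sum>x\<in>?K. h x * (\<Sum>\<^sub>\<infinity>y\<in>UNIV. \<mu> x y * v y))) UNIV"
    by (intro has_sum_finite_sum K has_sum_cmult_right has_sum_infsum formal_domain_summable v)
  have nb: "(\<Sum>x\<in>?K. h x * (\<mu> x y * v y)) = v y * (\<Sum>\<^sub>\<infinity>x\<in>UNIV. \<mu> y x * h x)" for y
  proof -
    have "(\<Sum>\<^sub>\<infinity>x\<in>UNIV. \<mu> y x * h x) = (\<Sum>\<^sub>\<infinity>x\<in>?K. \<mu> y x * h x)"
      by (rule infsum_cong_neutral) auto
    also have "\<dots> = (\<Sum>x\<in>?K. \<mu> y x * h x)" by (rule infsum_finite[OF K])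
    finally show ?thesis by (simp add: sum_distrib_left \<mu>_commute[of y] mult_ac)
  qed
  have "((\<lambda>y. v y * (deg y * h y) + (-1) * (\<Sum>x\<in>?K. h x * (\<mu> x y * v y))) has_sum
      ((\<Sum>y\<in>?K. v y * (deg y * h y)) + (-1) * (\<Sum>x\<in>?K. h x * (\<Sum>\<^sub>\<infinity>y\<in>UNIV. \<mu> x y * v y)))) UNIV"
    by (intro has_sum_add has_sum_cmult_right 1 2)
  moreover have "v y * (deg y * h y) + (-1) * (\<Sum>x\<in>?K. h x * (\<mu> x y * v y)) = v y * weighted_laplacian \<mu> h y" for y
    unfolding nb weighted_laplacian_eq[OF finitely_supported_neighbour_summable[OF h]] by (simp add: right_diff_distrib)
  moreover have "(\<Sum>y\<in>?K. v y * (deg y * h y)) + (-1) * (\<Sum>x\<in>?K. h x * (\<Sum>\<^sub>\<infinity>y\<in>UNIV. \<mu> x y * v y))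
      = (\<Sum>x\<in>?K. weighted_laplacian \<mu> v x * h x)"
    unfolding weighted_laplacian_eq[OF formal_domain_summable(1)[OF v]]
    unfolding sum_distrib_left sum.distrib[symmetric]
    by (intro sum.cong) (simp_all add: algebra_simps)
  ultimately show ?thesis by simp
qed

text \<open>
  Testing with the iterates \<open>h\<^sub>k\<close> for the source \<open>1\<close>: a single term \<open>m x \<Delta>v(x) h\<^sub>k(x)\<close> is at most
  \<open>\<Sum> m v \<Delta>h\<^sub>k \<le> \<Sum> m v (1 - h\<^sub>k)\<close>, and the last sum tends to \<open>0\<close>.
\<close>

lemma superharmonic_L1_imp_harmonic:
  assumes complete: "\<And>x. (\<lambda>k. iterate 1 (\<lambda>x. 1) k x) \<longlonglongrightarrow> 1"
    and v: "superharmonic m \<mu> v" "v \<in> L1 m" "\<And>x. 0 \<le> v x"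
  shows "weighted_laplacian \<mu> v x = 0"
proof -
  let ?h = "iterate 1 (\<lambda>x. 1)"
  have fd: "v \<in> formal_domain \<mu>" and sup: "\<And>x. 0 \<le> weighted_laplacian \<mu> v x"
    using v(1) by (auto simp: superharmonic_iff)
  have h: "0 \<le> ?h k y" "?h k y \<le> 1" for k y
    by (rule iterate_nonneg iterate_le_1, simp, simp)+
  have mv: "(\<lambda>y. m y * v y) summable_on UNIV"
    using v(2,3) by (simp add: L1_def)
  define r where "r k y = m y * v y * (1 - ?h k y)" for k y
  have r_le: "\<bar>r k y\<bar> \<le> m y * v y" for k y
  proof -
    have "0 \<le> m y * v y" using v(3)[of y] m_pos[of y] by simp
    then show ?thesis
      using h[of k y] mult_left_le[of "1 - ?h k y" "m y * v y"] unfolding r_def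
      by (subst abs_of_nonneg) (auto intro!: mult_nonneg_nonneg simp del: mult_eq_0_iff)
  qed
  have "(\<lambda>k. \<Sum>\<^sub>\<infinity>y\<in>UNIV. r k y) \<longlonglongrightarrow> 0"
  proof (rule infsum_dominated_null[OF mv r_le])
    fix y
    have "(\<lambda>k. m y * v y * (1 - ?h k y)) \<longlonglongrightarrow> m y * v y * (1 - 1)"
      by (intro tendsto_intros complete)
    then show "(\<lambda>k. r k y) \<longlonglongrightarrow> 0" by (simp add: r_def)
  qed
  moreover have "(\<lambda>k. weighted_laplacian \<mu> v x * ?h k x) \<longlonglongrightarrow> weighted_laplacian \<mu> v x * 1"
    by (intro tendsto_intros complete)
  moreover have "weighted_laplacian \<mu> v x * ?h k x \<le> (\<Sum>\<^sub>\<infinity>y\<in>UNIV. r k y)" for k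
  proof -
    note fs = iterate_finitely_supported[of 1 "\<lambda>x. 1" k]
    note G = Green_formula_formal[OF fs fd]
    have "weighted_laplacian \<mu> v x * ?h k x \<le> (\<Sum>x | ?h k x \<noteq> 0. weighted_laplacian \<mu> v x * ?h k x)"
    proof (cases "?h k x = 0")
      case True
      then show ?thesis using sup h by (auto intro!: sum_nonneg)
    next
      case False
      then show ?thesis
        using fs sup h by (intro member_le_sum) (auto simp: finitely_supported_def)
    qed
    also have "\<dots> \<le> (\<Sum>\<^sub>\<infinity>y\<in>UNIV. r k y)"
    proof (rule has_sum_mono[OF G has_sum_infsum])
      show "r k summable_on UNIV"
        by (rule summable_on_abs_le[OF mv r_le])
      fix y
      have "weighted_laplacian \<mu> (?h k) y \<le> 1 * m y * (1 - ?h k y)"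
        by (rule iterate_subsolution) simp_all
      then show "v y * weighted_laplacian \<mu> (?h k) y \<le> r k y"
        using mult_left_mono[OF _ v(3)[of y]] by (fastforce simp: r_def mult_ac)
    qed
    finally show ?thesis .
  qed
  ultimately have "weighted_laplacian \<mu> v x * 1 \<le> 0"
    by (intro LIMSEQ_le[of _ _ "\<lambda>k. \<Sum>\<^sub>\<infinity>y\<in>UNIV. r k y"]) auto
  with sup[of x] show ?thesis by simp
qed

lemma superharmonic_min:
  assumes u: "superharmonic m \<mu> u" "\<And>x. 0 \<le> u x" and c: "0 \<le> c"
  shows "superharmonic m \<mu> (\<lambda>x. min (u x) c)"
  unfolding superharmonic_iff
proof (intro conjI allI)
  have fd: "u \<in> formal_domain \<mu>" and sup: "\<And>x. 0 \<le> weighted_laplacian \<mu> u x"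
    using u(1) by (auto simp: superharmonic_iff)
  show min_fd: "(\<lambda>x. min (u x) c) \<in> formal_domain \<mu>"
    unfolding formal_domain_def mem_Collect_eq
  proof
    fix x
    show "(\<lambda>y. \<mu> x y * \<bar>min (u y) c\<bar>) summable_on UNIV"
    proof (rule summable_on_comparison_test)
      show "(\<lambda>y. \<mu> x y * \<bar>u y\<bar>) summable_on UNIV" using fd by (simp add: formal_domain_def)
      show "\<mu> x y * \<bar>min (u y) c\<bar> \<le> \<mu> x y * \<bar>u y\<bar>" for y
        using u(2)[of y] c by (intro mult_left_mono \<mu>_nonneg) auto
    qed (simp add: \<mu>_nonneg)
  qed
  fix x
  show "0 \<le> weighted_laplacian \<mu> (\<lambda>x. min (u x) c) x"
  proof (cases "u x \<le> c")
    case True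
    have "weighted_laplacian \<mu> u x \<le> weighted_laplacian \<mu> (\<lambda>x. min (u x) c) x"
      unfolding weighted_laplacian_def using True
      by (intro infsum_mono formal_domain_summable fd min_fd mult_left_mono \<mu>_nonneg) auto
    with sup[of x] show ?thesis by simp
  next
    case False
    then show ?thesis
      unfolding weighted_laplacian_def by (intro infsum_nonneg mult_nonneg_nonneg \<mu>_nonneg) auto
  qed
qed

text \<open>
  The truncation of \<open>u\<close> at height \<open>u x\<close> is harmonic and maximal at \<open>x\<close>, so it takes the same value at every
  neighbour of \<open>x\<close>.
\<close>

lemma superharmonic_L1_le_neighbour:
  assumes complete: "\<And>x. (\<lambda>k. iterate 1 (\<lambda>x. 1) k x) \<longlonglongrightarrow> 1"
    and u: "superharmonic m \<mu> u" "u \<in> L1 m" "\<And>x. 0 \<le> u x" and adj: "adjacent \<mu> x y"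
  shows "u x \<le> u y"
proof -
  let ?v = "\<lambda>z. min (u z) (u x)"
  have v: "superharmonic m \<mu> ?v" by (rule superharmonic_min[OF u(1,3) u(3)])
  have "?v \<in> L1 m"
    unfolding L1_def mem_Collect_eq
  proof (rule summable_on_comparison_test)
    show "(\<lambda>z. m z * \<bar>u z\<bar>) summable_on UNIV" using u(2) by (simp add: L1_def)
    show "m z * \<bar>?v z\<bar> \<le> m z * \<bar>u z\<bar>" for z
      using u(3)[of z] u(3)[of x] m_pos[of z] by (intro mult_left_mono) auto
    show "0 \<le> m z * \<bar>?v z\<bar>" for z
      using m_pos[of z] by simp
  qed
  then have "weighted_laplacian \<mu> ?v x = 0"
    using u(3) by (intro superharmonic_L1_imp_harmonic complete v) auto
  then have zero: "(\<Sum>\<^sub>\<infinity>z\<in>UNIV. \<mu> x z * (u x - ?v z)) \<le> 0"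
    by (simp add: weighted_laplacian_def)
  have "?v \<in> formal_domain \<mu>" using v by (simp add: superharmonic_iff)
  then have "\<mu> x y * (u x - ?v y) = 0"
    using \<mu>_nonneg by (intro nonneg_infsum_le_0D[OF zero formal_domain_summable(2)]) auto
  then show ?thesis using adj by (simp add: adjacent_def min_def split: if_splits)
qed

end

theorem theorem1p7:
  fixes m :: "'v::countable \<Rightarrow> real"
    and \<mu> :: "'v \<Rightarrow> 'v \<Rightarrow> real"
    and u :: "'v \<Rightarrow> real"
  assumes "weighted_graph m \<mu>"
    and "connected_graph \<mu>"
    and "stochastically_complete m \<mu>"
    and "\<forall>x. 0 \<le> u x"
    and "superharmonic m \<mu> u"
    and "u \<in> L1 m"
  shows "u constant_on UNIV"
proof -
  obtain P where P: "heat_semigroup m \<mu> P" "\<And>t. t \<ge> 0 \<Longrightarrow> monotone_extension m (P t) (\<lambda>x. 1) = (\<lambda>x. 1)"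
    using assms(3) by (auto simp: stochastically_complete_def)
  interpret heat m \<mu> P
    by unfold_locales (use assms(1) P(1) in auto)
  have step: "u x \<le> u y" if "adjacent \<mu> x y" for x y
    using assms(4) by (intro superharmonic_L1_le_neighbour[OF iterate_one_tendsto[OF P(2)] assms(5,6) _ that]) auto
  have "u x \<le> u y" for x y
  proof -
    have "(adjacent \<mu>)\<^sup>*\<^sup>* x y" using assms(2) by (simp add: connected_graph_def)
    then show ?thesis
      by (induction rule: rtranclp_induct) (auto dest: step)
  qed
  then show ?thesis
    unfolding constant_on_def by (intro exI[of _ "u undefined"]) (auto intro: antisym)
qed

end
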